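(* Let $0\le k<n$ and let $\sigma\overline{\mathcal D}_k$ be the $\sigma$-ideal on $\mathbb{R}^n$ generated by closed subsets of $\mathbb{R}^n$ of dimension at most $k$. Let $\mathcal M$ be the ideal of meager subsets of $\mathbb{R}^n$. Then $\mathrm{add}(\sigma\overline{\mathcal D}_k)=\mathrm{add}(\mathcal M)$, $\mathrm{cov}(\sigma\overline{\mathcal D}_k)=\mathrm{cov}(\mathcal M)$, $\mathrm{non}(\sigma\overline{\mathcal D}_k)=\mathrm{non}(\mathcal M)$ and $\mathrm{cof}(\sigma\overline{\mathcal D}_k)=\mathrm{cof}(\mathcal M)$.
   Context: $\sigma\overline{\mathcal D}_k$ consists of all subsets of countable unions of closed subsets of $\mathbb{R}^n$ of (covering) dimension $\le k$. For an ideal $\mathcal I$ on $X=\bigcup\mathcal I$: $\mathrm{add}(\mathcal I)=\min\{|\mathcal A|:\mathcal A\subseteq\mathcal I,\bigcup\mathcal A\notin\mathcal I\}$, $\mathrm{non}(\mathcal I)=\min\{|A|:A\subseteq X,A\notin\mathcal I\}$, $\mathrm{cov}(\mathcal I)=\min\{|\mathcal A|:\mathcal A\subseteq\mathcal I,\bigcup\mathcal A=X\}$, $\mathrm{cof}(\mathcal I)=\min\{|\mathcal A|:\mathcal A\subseteq\mathcal I,\ \forall B\in\mathcal I\ \exists A\in\mathcal A\ (B\subseteq A)\}$. *)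

theory Defs
  imports "HOL-Analysis.Analysis"
begin

unbundle cardinal_syntax

section \<open>Covering dimension\<close>

definition finite_open_cover :: "'a topology \<Rightarrow> 'a set set \<Rightarrow> bool" where
  "finite_open_cover X \<U> \<longleftrightarrow> finite \<U> \<and> (\<forall>U\<in>\<U>. openin X U) \<and> \<Union>\<U> = topspace X"

text \<open>
  Lebesgue covering dimension \<open>\<le> k\<close>, in the form used for normal spaces: every finite open
  cover has a finite open refinement of order \<open>\<le> k\<close>, that is, no point lies in more than
  \<open>k + 1\<close> members of the refinement. The empty space satisfies this for every \<open>k\<close>.
  This is not the small inductive dimension \<open>dim_le\<close> of HOL-Analysis.
\<close>
definition covering_dim_le :: "'a topology \<Rightarrow> nat \<Rightarrow> bool" where
  "covering_dim_le X k \<longleftrightarrow>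
     (\<forall>\<U>. finite_open_cover X \<U> \<longrightarrow>
        (\<exists>\<V>. finite_open_cover X \<V> \<and> (\<forall>V\<in>\<V>. \<exists>U\<in>\<U>. V \<subseteq> U) \<and>
             (\<forall>x\<in>topspace X. card {V \<in> \<V>. x \<in> V} \<le> k + 1)))"

section \<open>The two ideals\<close>

definition sigma_closed_dim :: "nat \<Rightarrow> 'a::topological_space set set" where
  "sigma_closed_dim k =
     {A. \<exists>\<C>. countable \<C> \<and> (\<forall>C\<in>\<C>. closed C \<and> covering_dim_le (top_of_set C) k) \<and> A \<subseteq> \<Union>\<C>}"

definition nowhere_dense :: "'a::topological_space set \<Rightarrow> bool" where
  "nowhere_dense N \<longleftrightarrow> interior (closure N) = {}"

definition meager_sets :: "'a::topological_space set set" where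
  "meager_sets = {A. \<exists>\<N>. countable \<N> \<and> (\<forall>N\<in>\<N>. nowhere_dense N) \<and> A = \<Union>\<N>}"

section \<open>Cardinal invariants\<close>

text \<open>
  The least cardinality of a member of a nonempty collection \<open>\<F>\<close> of sets, as a cardinal in the
  sense of the HOL cardinals library, hence determined only up to the isomorphism \<open>=o\<close>.
  The value for empty \<open>\<F>\<close> is unspecified.
\<close>
definition min_card :: "'b set set \<Rightarrow> 'b rel" where
  "min_card \<F> = |SOME A. A \<in> \<F> \<and> (\<forall>B\<in>\<F>. |A| \<le>o |B| )|"

lemma min_card:
  assumes "\<F> \<noteq> {}"
  shows "\<exists>A\<in>\<F>. min_card \<F> = |A|" and "\<forall>B\<in>\<F>. min_card \<F> \<le>o |B|"
proof -
  have "\<exists>r\<in>card_of ` \<F>. \<forall>r'\<in>card_of ` \<F>. r \<le>o r'"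
    by (rule exists_minim_Card_order) (use assms card_of_Card_order in auto)
  then have "\<exists>A. A \<in> \<F> \<and> (\<forall>B\<in>\<F>. |A| \<le>o |B| )"
    by auto
  from someI_ex[OF this] show "\<exists>A\<in>\<F>. min_card \<F> = |A|" and "\<forall>B\<in>\<F>. min_card \<F> \<le>o |B|"
    unfolding min_card_def by auto
qed

definition add_ideal :: "'a set set \<Rightarrow> 'a set rel" where
  "add_ideal \<I> = min_card {\<A>. \<A> \<subseteq> \<I> \<and> \<Union>\<A> \<notin> \<I>}"

definition cov_ideal :: "'a set set \<Rightarrow> 'a set rel" where
  "cov_ideal \<I> = min_card {\<A>. \<A> \<subseteq> \<I> \<and> \<Union>\<A> = \<Union>\<I>}"

definition non_ideal :: "'a set set \<Rightarrow> 'a rel" where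
  "non_ideal \<I> = min_card {A. A \<subseteq> \<Union>\<I> \<and> A \<notin> \<I>}"

definition cof_ideal :: "'a set set \<Rightarrow> 'a set rel" where
  "cof_ideal \<I> = min_card {\<A>. \<A> \<subseteq> \<I> \<and> (\<forall>B\<in>\<I>. \<exists>A\<in>\<A>. B \<subseteq> A)}"

end

theory Submission
  imports Defs
begin

text \<open>
  All comparisons are Tukey reductions between ideals, with the ideal of meager subsets of the Cantor
  space as an intermediate station; binary expansion identifies it with the meager ideal of any
  \<open>\<real>\<^sup>m\<close>.

  Covering dimension enters only through Ostrand's colouring form: a compact set has dimension
  \<open>\<le> k\<close> iff, at every mesh, it is covered by \<open>k + 1\<close> uniformly separated families of small sets.
  Such coverings can be merged when the second one is much finer than the gaps of the first, so a
  point of the Cantor space can be read as a sequence of ever finer codes of coverings. A generic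
  point guesses a code of a given compact set infinitely often, and a meager set is determined by a
  real and an interval partition; merging all codes in one interval of the partition then gives a
  covering that works for every set guessed in that interval. This reduces the dimension ideal to
  the meager ideal.

  Conversely, a meager subset \<open>A\<close> of the line is sent to \<open>A \<times> [0,1]\<^sup>k \<times> {0}\<close>. The Lebesgue covering
  theorem (from Brouwer's fixed point theorem) and Baire's theorem show that a set of the dimension
  ideal contains only a meager set of fibres \<open>{t} \<times> [0,1]\<^sup>k \<times> {0}\<close>. For \<open>cov\<close> and \<open>non\<close> it remains
  to note that a product of \<open>n\<close> meager subsets of the line lies in the ideal for \<open>k = 0\<close>.
\<close>

section \<open>Tukey reductions\<close>

text \<open>Reductions between ideals ordered by inclusion control only \<open>add\<close> and
  \<open>cof\<close>; \<open>cov\<close> and \<open>non\<close> also involve points. The difficult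
  reduction, of the dimension ideal to the meager one, therefore serves \<open>add\<close> and
  \<open>cof\<close>, while for \<open>cov\<close> and \<open>non\<close> the inclusion of the
  dimension ideal in the meager ideal takes its place. The obstacle in that reduction: a meager
  superset of the non-guessing points reveals in which blocks of positions a guess occurs, but not
  which of the codes in the block is the right one. All of them have to be kept, so an unbounded
  number of coverings must be merged without a further colour and with mesh still tending to zero.
  Merging works only in order of decreasing scale. Hence a code is a pair of positions: the first
  says how fine the new covering has to be, the second how small its gaps may be. With scales
  \<open>(1/4) ^ m\<close> the growth of the mesh is a geometric sum, bounded by a multiple of the
  scale at which the block begins.\<close>

lemma min_card_le:
  assumes "\<G> \<noteq> {}" "\<And>B. B \<in> \<G> \<Longrightarrow> \<exists>A\<in>\<F>. |A| \<le>o |B|"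
  shows "min_card \<F> \<le>o min_card \<G>"
proof -
  obtain B where B: "B \<in> \<G>" "min_card \<G> = |B|" using min_card(1)[OF assms(1)] by blast
  obtain A where A: "A \<in> \<F>" "|A| \<le>o |B|" using assms(2)[OF B(1)] by blast
  then have "min_card \<F> \<le>o |A|" using min_card(2)[of \<F>] by blast
  then show ?thesis unfolding B(2) using A(2) ordLeq_transitive by blast
qed

text \<open>The last two clauses keep the collections minimised in \<open>add\<close>,
  \<open>cov\<close> and \<open>non\<close> nonempty, which is where \<open>min_card\<close> has a
  specified value.\<close>

definition covering_ideal :: "'a set set \<Rightarrow> bool" where
  "covering_ideal \<I> \<longleftrightarrow> (\<forall>A B. B \<in> \<I> \<longrightarrow> A \<subseteq> B \<longrightarrow> A \<in> \<I>) \<and> \<Union>\<I> = UNIV \<and> UNIV \<notin> \<I>"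

lemma covering_idealD:
  assumes "covering_ideal \<I>"
  shows "\<And>A B. B \<in> \<I> \<Longrightarrow> A \<subseteq> B \<Longrightarrow> A \<in> \<I>" "\<Union>\<I> = UNIV" "UNIV \<notin> \<I>"
  using assms unfolding covering_ideal_def by blast+

text \<open>A Galois-Tukey connection between two ideals under inclusion. As \<open>\<phi>\<close>
  and \<open>\<psi>\<close> are total functions, their values are constrained on the ideals
  only.\<close>

definition tukey :: "('a set \<Rightarrow> 'b set) \<Rightarrow> ('b set \<Rightarrow> 'a set) \<Rightarrow> 'a set set \<Rightarrow> 'b set set \<Rightarrow> bool" where
  "tukey \<phi> \<psi> \<I> \<J> \<longleftrightarrow> (\<forall>A\<in>\<I>. \<phi> A \<in> \<J>) \<and> (\<forall>B\<in>\<J>. \<psi> B \<in> \<I>) \<and>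
     (\<forall>A\<in>\<I>. \<forall>B\<in>\<J>. \<phi> A \<subseteq> B \<longrightarrow> A \<subseteq> \<psi> B)"

lemma tukeyD:
  assumes "tukey \<phi> \<psi> \<I> \<J>"
  shows "A \<in> \<I> \<Longrightarrow> \<phi> A \<in> \<J>" "B \<in> \<J> \<Longrightarrow> \<psi> B \<in> \<I>"
    "A \<in> \<I> \<Longrightarrow> B \<in> \<J> \<Longrightarrow> \<phi> A \<subseteq> B \<Longrightarrow> A \<subseteq> \<psi> B"
  using assms unfolding tukey_def by simp_all

text \<open>Image and preimage under one map are adjoint for inclusion, so only membership in the
  ideals has to be assumed.\<close>

lemma tukey_map:
  assumes "\<And>A. A \<in> \<I> \<Longrightarrow> f ` A \<in> \<J>" "\<And>B. B \<in> \<J> \<Longrightarrow> f -` B \<in> \<I>"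
  shows "tukey (image f) (vimage f) \<I> \<J>"
  using assms unfolding tukey_def by blast

text \<open>A bound \<open>B\<close> in \<open>\<J>\<close> for all images \<open>\<phi> A\<close>
  would give the bound \<open>\<psi> B\<close> in \<open>\<I>\<close> for the family itself.\<close>

lemma add_ideal_tukey:
  assumes "covering_ideal \<I>" and t: "tukey \<phi> \<psi> \<I> \<J>"
  shows "add_ideal \<J> \<le>o add_ideal \<I>"
  unfolding add_ideal_def
proof (rule min_card_le)
  show "{\<A>. \<A> \<subseteq> \<I> \<and> \<Union>\<A> \<notin> \<I>} \<noteq> {}"
    using covering_idealD(2,3)[OF assms(1)] by auto
  fix \<A> assume \<A>: "\<A> \<in> {\<A>. \<A> \<subseteq> \<I> \<and> \<Union>\<A> \<notin> \<I>}"
  have "\<Union>(\<phi> ` \<A>) \<notin> \<J>"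
  proof
    assume *: "\<Union>(\<phi> ` \<A>) \<in> \<J>"
    have "A \<subseteq> \<psi> (\<Union>(\<phi> ` \<A>))" if "A \<in> \<A>" for A
      using that \<A> by (intro tukeyD(3)[OF t _ *]) auto
    then have "\<Union>\<A> \<subseteq> \<psi> (\<Union>(\<phi> ` \<A>))" by blast
    moreover have "\<psi> (\<Union>(\<phi> ` \<A>)) \<in> \<I>" by (rule tukeyD(2)[OF t *])
    ultimately have "\<Union>\<A> \<in> \<I>" by (rule covering_idealD(1)[OF assms(1), rotated])
    then show False using \<A> by simp
  qed
  moreover have "\<phi> ` \<A> \<subseteq> \<J>" using tukeyD(1)[OF t] \<A> by auto
  ultimately show "\<exists>\<B>\<in>{\<A>. \<A> \<subseteq> \<J> \<and> \<Union>\<A> \<notin> \<J>}. |\<B>| \<le>o |\<A>|"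
    by (intro bexI[of _ "\<phi> ` \<A>"] card_of_image CollectI conjI)
qed

lemma cof_ideal_tukey:
  assumes t: "tukey \<phi> \<psi> \<I> \<J>"
  shows "cof_ideal \<I> \<le>o cof_ideal \<J>"
  unfolding cof_ideal_def
proof (rule min_card_le)
  have "\<J> \<in> {\<A>. \<A> \<subseteq> \<J> \<and> (\<forall>B\<in>\<J>. \<exists>A\<in>\<A>. B \<subseteq> A)}" by auto
  then show "{\<A>. \<A> \<subseteq> \<J> \<and> (\<forall>B\<in>\<J>. \<exists>A\<in>\<A>. B \<subseteq> A)} \<noteq> {}" by (metis empty_iff)
  fix \<B> assume \<B>: "\<B> \<in> {\<A>. \<A> \<subseteq> \<J> \<and> (\<forall>B\<in>\<J>. \<exists>A\<in>\<A>. B \<subseteq> A)}"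
  have "\<exists>C\<in>\<psi> ` \<B>. A \<subseteq> C" if A: "A \<in> \<I>" for A
  proof -
    have "\<phi> A \<in> \<J>" by (rule tukeyD(1)[OF t A])
    then obtain B where "B \<in> \<B>" "B \<in> \<J>" "\<phi> A \<subseteq> B" using \<B> by blast
    then show ?thesis using tukeyD(3)[OF t A] by blast
  qed
  moreover have "\<psi> ` \<B> \<subseteq> \<I>" using tukeyD(2)[OF t] \<B> by auto
  ultimately show "\<exists>\<A>\<in>{\<A>. \<A> \<subseteq> \<I> \<and> (\<forall>B\<in>\<I>. \<exists>A\<in>\<A>. B \<subseteq> A)}. |\<A>| \<le>o |\<B>|"
    by (intro bexI[of _ "\<psi> ` \<B>"] card_of_image CollectI conjI ballI)
qed

text \<open>A point map pulls coverings back and pushes sets outside the ideal forward. Only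
  preimages of small sets must be small, which is weaker than what \<open>tukey_map\<close>
  asks.\<close>

lemma cov_ideal_vimage:
  assumes "covering_ideal \<I>" "covering_ideal \<J>" and f: "\<And>B. B \<in> \<J> \<Longrightarrow> f -` B \<in> \<I>"
  shows "cov_ideal \<I> \<le>o cov_ideal \<J>"
  unfolding cov_ideal_def covering_idealD(2)[OF assms(1)] covering_idealD(2)[OF assms(2)]
proof (rule min_card_le)
  show "{\<A>. \<A> \<subseteq> \<J> \<and> \<Union>\<A> = UNIV} \<noteq> {}" using covering_idealD(2)[OF assms(2)] by blast
  fix \<B> assume \<B>: "\<B> \<in> {\<A>. \<A> \<subseteq> \<J> \<and> \<Union>\<A> = UNIV}"
  have "\<Union>(vimage f ` \<B>) = f -` (\<Union>\<B>)" by blast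
  then have "\<Union>(vimage f ` \<B>) = UNIV" using \<B> by simp
  moreover have "vimage f ` \<B> \<subseteq> \<I>" using f \<B> by blast
  ultimately show "\<exists>\<A>\<in>{\<A>. \<A> \<subseteq> \<I> \<and> \<Union>\<A> = UNIV}. |\<A>| \<le>o |\<B>|"
    by (intro bexI[of _ "vimage f ` \<B>"] card_of_image CollectI conjI)
qed

lemma non_ideal_vimage:
  assumes "covering_ideal \<I>" "covering_ideal \<J>" and f: "\<And>B. B \<in> \<J> \<Longrightarrow> f -` B \<in> \<I>"
  shows "non_ideal \<J> \<le>o non_ideal \<I>"
  unfolding non_ideal_def covering_idealD(2)[OF assms(1)] covering_idealD(2)[OF assms(2)]
proof (rule min_card_le)
  show "{A. A \<subseteq> UNIV \<and> A \<notin> \<I>} \<noteq> {}" using covering_idealD(3)[OF assms(1)] by blast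
  fix A assume A: "A \<in> {A. A \<subseteq> UNIV \<and> A \<notin> \<I>}"
  have "f ` A \<notin> \<J>"
  proof
    assume "f ` A \<in> \<J>"
    then have "f -` (f ` A) \<in> \<I>" by (rule f)
    moreover have "A \<subseteq> f -` (f ` A)" by blast
    ultimately have "A \<in> \<I>" by (rule covering_idealD(1)[OF assms(1)])
    then show False using A by simp
  qed
  then show "\<exists>B\<in>{A. A \<subseteq> UNIV \<and> A \<notin> \<J>}. |B| \<le>o |A|"
    by (intro bexI[of _ "f ` A"] card_of_image) simp
qed

section \<open>Separated coverings\<close>

text \<open>
  Neither finiteness nor closedness of the families is required: the separation \<open>\<delta>\<close> replaces both.
\<close>

definition sep_cover :: "nat \<Rightarrow> real \<Rightarrow> real \<Rightarrow> 'a::metric_space set \<Rightarrow> bool" where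
  "sep_cover k \<epsilon> \<delta> X \<longleftrightarrow> (\<exists>Z::nat \<Rightarrow> 'a set set. X \<subseteq> (\<Union>i\<le>k. \<Union>(Z i)) \<and>
     (\<forall>i\<le>k. \<forall>A\<in>Z i. \<forall>x\<in>A. \<forall>y\<in>A. dist x y \<le> \<epsilon>) \<and>
     (\<forall>i\<le>k. \<forall>A\<in>Z i. \<forall>B\<in>Z i. A \<noteq> B \<longrightarrow> (\<forall>x\<in>A. \<forall>y\<in>B. \<delta> \<le> dist x y)))"

lemma sep_coverI:
  assumes "X \<subseteq> (\<Union>i\<le>k. \<Union>(Z i))"
    and "\<And>i A x y. i \<le> k \<Longrightarrow> A \<in> Z i \<Longrightarrow> x \<in> A \<Longrightarrow> y \<in> A \<Longrightarrow> dist x y \<le> \<epsilon>"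
    and "\<And>i A B x y. i \<le> k \<Longrightarrow> A \<in> Z i \<Longrightarrow> B \<in> Z i \<Longrightarrow> A \<noteq> B \<Longrightarrow> x \<in> A \<Longrightarrow> y \<in> B \<Longrightarrow> \<delta> \<le> dist x y"
  shows "sep_cover k \<epsilon> \<delta> X"
  unfolding sep_cover_def using assms by (intro exI[of _ Z] conjI allI impI ballI) auto

lemma sep_coverE:
  assumes "sep_cover k \<epsilon> \<delta> X"
  obtains Z where "X \<subseteq> (\<Union>i\<le>k. \<Union>(Z i))"
    and "\<And>i A x y. i \<le> k \<Longrightarrow> A \<in> Z i \<Longrightarrow> x \<in> A \<Longrightarrow> y \<in> A \<Longrightarrow> dist x y \<le> \<epsilon>"
    and "\<And>i A B x y. i \<le> k \<Longrightarrow> A \<in> Z i \<Longrightarrow> B \<in> Z i \<Longrightarrow> A \<noteq> B \<Longrightarrow> x \<in> A \<Longrightarrow> y \<in> B \<Longrightarrow> \<delta> \<le> dist x y"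
proof -
  from assms obtain Z where "X \<subseteq> (\<Union>i\<le>k. \<Union>(Z i))"
    "\<forall>i\<le>k. \<forall>A\<in>Z i. \<forall>x\<in>A. \<forall>y\<in>A. dist x y \<le> \<epsilon>"
    "\<forall>i\<le>k. \<forall>A\<in>Z i. \<forall>B\<in>Z i. A \<noteq> B \<longrightarrow> (\<forall>x\<in>A. \<forall>y\<in>B. \<delta> \<le> dist x y)"
    unfolding sep_cover_def by (elim exE conjE)
  then show thesis by (intro that[of Z]; simp)
qed

lemma sep_cover_empty: "sep_cover k \<epsilon> \<delta> {}"
  by (rule sep_coverI[where Z = "\<lambda>_. {}"]) auto

lemma sep_cover_mono:
  assumes "sep_cover k \<epsilon> \<delta> X" "Y \<subseteq> X" "k \<le> l" "\<epsilon> \<le> \<epsilon>'" "\<delta>' \<le> \<delta>"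
  shows "sep_cover l \<epsilon>' \<delta>' Y"
proof -
  from assms(1) obtain Z where Z: "X \<subseteq> (\<Union>i\<le>k. \<Union>(Z i))"
    "\<And>i A x y. i \<le> k \<Longrightarrow> A \<in> Z i \<Longrightarrow> x \<in> A \<Longrightarrow> y \<in> A \<Longrightarrow> dist x y \<le> \<epsilon>"
    "\<And>i A B x y. i \<le> k \<Longrightarrow> A \<in> Z i \<Longrightarrow> B \<in> Z i \<Longrightarrow> A \<noteq> B \<Longrightarrow> x \<in> A \<Longrightarrow> y \<in> B \<Longrightarrow> \<delta> \<le> dist x y"
    by (rule sep_coverE) blast
  show ?thesis
  proof (rule sep_coverI[where Z = "\<lambda>i. if i \<le> k then Z i else {}"])
    show "Y \<subseteq> (\<Union>i\<le>l. \<Union>(if i \<le> k then Z i else {}))"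
    proof
      fix x assume "x \<in> Y"
      then obtain i A where "i \<le> k" "A \<in> Z i" "x \<in> A" using Z(1) assms(2) by blast
      then show "x \<in> (\<Union>i\<le>l. \<Union>(if i \<le> k then Z i else {}))"
        using assms(3) by (intro UN_I[of i]) auto
    qed
    show "dist x y \<le> \<epsilon>'" if "i \<le> l" "A \<in> (if i \<le> k then Z i else {})" "x \<in> A" "y \<in> A" for i A x y
      using Z(2)[of i A x y] that assms(4) by (auto split: if_splits)
    show "\<delta>' \<le> dist x y" if "i \<le> l" "A \<in> (if i \<le> k then Z i else {})"
      "B \<in> (if i \<le> k then Z i else {})" "A \<noteq> B" "x \<in> A" "y \<in> B" for i A B x y
      using Z(3)[of i A B x y] that assms(5) by (auto split: if_splits)
  qed
qed

text \<open>Moving both ends by at most \<eta> changes a distance by at most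
  \<open>2 * \<eta>\<close>, in the mesh as in the gaps. A compact set can thus be exchanged for a
  nearby finite union of balls at small cost.\<close>

lemma sep_cover_thicken:
  assumes "sep_cover k \<epsilon> \<delta> X"
  shows "sep_cover k (\<epsilon> + 2 * \<eta>) (\<delta> - 2 * \<eta>) {y. \<exists>x\<in>X. dist x y \<le> \<eta>}"
proof -
  from assms obtain Z where Z: "X \<subseteq> (\<Union>i\<le>k. \<Union>(Z i))"
    "\<And>i A x y. i \<le> k \<Longrightarrow> A \<in> Z i \<Longrightarrow> x \<in> A \<Longrightarrow> y \<in> A \<Longrightarrow> dist x y \<le> \<epsilon>"
    "\<And>i A B x y. i \<le> k \<Longrightarrow> A \<in> Z i \<Longrightarrow> B \<in> Z i \<Longrightarrow> A \<noteq> B \<Longrightarrow> x \<in> A \<Longrightarrow> y \<in> B \<Longrightarrow> \<delta> \<le> dist x y"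
    by (rule sep_coverE) blast
  have tri: "dist x' y' \<le> dist x y + 2 * \<eta>" "dist x y \<le> dist x' y' + 2 * \<eta>"
    if "dist x x' \<le> \<eta>" "dist y y' \<le> \<eta>" for x x' y y' :: 'a
    using that dist_triangle[of x' y' x] dist_triangle[of x y' y]
      dist_triangle[of x y x'] dist_triangle[of x' y y'] by (auto simp: dist_commute)
  show ?thesis
  proof (rule sep_coverI[where Z = "\<lambda>i. (\<lambda>A. {y. \<exists>x\<in>A. dist x y \<le> \<eta>}) ` Z i"])
    show "{y. \<exists>x\<in>X. dist x y \<le> \<eta>} \<subseteq> (\<Union>i\<le>k. \<Union>((\<lambda>A. {y. \<exists>x\<in>A. dist x y \<le> \<eta>}) ` Z i))"
    proof
      fix y assume "y \<in> {y. \<exists>x\<in>X. dist x y \<le> \<eta>}"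
      then obtain i A x where "i \<le> k" "A \<in> Z i" "x \<in> A" "dist x y \<le> \<eta>" using Z(1) by blast
      then show "y \<in> (\<Union>i\<le>k. \<Union>((\<lambda>A. {y. \<exists>x\<in>A. dist x y \<le> \<eta>}) ` Z i))"
        by (intro UN_I[of i] UnionI[of "{y. \<exists>x\<in>A. dist x y \<le> \<eta>}"]) auto
    qed
  next
    fix i A x y assume *: "i \<le> k" "A \<in> (\<lambda>A. {y. \<exists>x\<in>A. dist x y \<le> \<eta>}) ` Z i" "x \<in> A" "y \<in> A"
    then obtain A' x' y' where "A' \<in> Z i" "x' \<in> A'" "y' \<in> A'" "dist x' x \<le> \<eta>" "dist y' y \<le> \<eta>"
      by auto
    with *(1) Z(2)[of i A' x' y'] tri(1)[of x' x y' y] show "dist x y \<le> \<epsilon> + 2 * \<eta>"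
      by auto
  next
    fix i A B x y assume *: "i \<le> k" "A \<in> (\<lambda>A. {y. \<exists>x\<in>A. dist x y \<le> \<eta>}) ` Z i"
      "B \<in> (\<lambda>A. {y. \<exists>x\<in>A. dist x y \<le> \<eta>}) ` Z i" "A \<noteq> B" "x \<in> A" "y \<in> B"
    then obtain A' B' x' y' where "A' \<in> Z i" "B' \<in> Z i" "A' \<noteq> B'" "x' \<in> A'" "y' \<in> B'"
      "dist x' x \<le> \<eta>" "dist y' y \<le> \<eta>"
      by blast
    with *(1) Z(3)[of i A' B' x' y'] tri(2)[of x' x y' y] show "\<delta> - 2 * \<eta> \<le> dist x y"
      by auto
  qed
qed

text \<open>
  Every member of the finer family is glued to the member of the coarser family that it nearly touches;
  there is at most one, because the gaps of the coarser family exceed the finer mesh.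
\<close>

lemma sep_cover_Un:
  assumes X: "sep_cover k \<epsilon> \<delta> X" and Y: "sep_cover k \<epsilon>' \<delta>' Y"
    and "0 \<le> \<epsilon>" "0 \<le> \<epsilon>'" "0 \<le> \<tau>" "\<tau> \<le> \<delta>'" "2 * \<tau> + \<epsilon>' \<le> \<delta>"
  shows "sep_cover k (\<epsilon> + 2 * \<epsilon>' + 2 * \<tau>) \<tau> (X \<union> Y)"
proof -
  from X obtain Z where Z: "X \<subseteq> (\<Union>i\<le>k. \<Union>(Z i))"
    "\<And>i A x y. i \<le> k \<Longrightarrow> A \<in> Z i \<Longrightarrow> x \<in> A \<Longrightarrow> y \<in> A \<Longrightarrow> dist x y \<le> \<epsilon>"
    "\<And>i A B x y. i \<le> k \<Longrightarrow> A \<in> Z i \<Longrightarrow> B \<in> Z i \<Longrightarrow> A \<noteq> B \<Longrightarrow> x \<in> A \<Longrightarrow> y \<in> B \<Longrightarrow> \<delta> \<le> dist x y"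
    by (rule sep_coverE) blast
  from Y obtain W where W: "Y \<subseteq> (\<Union>i\<le>k. \<Union>(W i))"
    "\<And>i A x y. i \<le> k \<Longrightarrow> A \<in> W i \<Longrightarrow> x \<in> A \<Longrightarrow> y \<in> A \<Longrightarrow> dist x y \<le> \<epsilon>'"
    "\<And>i A B x y. i \<le> k \<Longrightarrow> A \<in> W i \<Longrightarrow> B \<in> W i \<Longrightarrow> A \<noteq> B \<Longrightarrow> x \<in> A \<Longrightarrow> y \<in> B \<Longrightarrow> \<delta>' \<le> dist x y"
    by (rule sep_coverE) blast
  define near where "near A B \<longleftrightarrow> (\<exists>x\<in>A. \<exists>y\<in>B. dist x y < \<tau>)" for A B :: "'a set"
  define sat where "sat i A = A \<union> \<Union>{B \<in> W i. near A B}" for i A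
  have near_unique: "A = A'"
    if "i \<le> k" "A \<in> Z i" "A' \<in> Z i" "B \<in> W i" "near A B" "near A' B" for i A A' B
  proof (rule ccontr)
    assume "A \<noteq> A'"
    from that obtain x y x' y' where *: "x \<in> A" "y \<in> B" "dist x y < \<tau>" "x' \<in> A'" "y' \<in> B" "dist x' y' < \<tau>"
      unfolding near_def by blast
    have "\<delta> \<le> dist x x'" using Z(3) that * \<open>A \<noteq> A'\<close> by blast
    moreover have "dist y y' \<le> \<epsilon>'" using W(2) that * by blast
    moreover have "dist x x' \<le> dist x y + dist y y' + dist x' y'"
      using dist_triangle[of x x' y] dist_triangle[of y x' y'] by (simp add: dist_commute)
    ultimately show False using * assms(7) by linarith
  qed
  show ?thesis
  proof (rule sep_coverI[where Z = "\<lambda>i. sat i ` Z i \<union> {B \<in> W i. \<forall>A\<in>Z i. \<not> near A B}"])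
    show "X \<union> Y \<subseteq> (\<Union>i\<le>k. \<Union>(sat i ` Z i \<union> {B \<in> W i. \<forall>A\<in>Z i. \<not> near A B}))"
    proof (intro subsetI, elim UnE)
      fix x assume "x \<in> X"
      then obtain i A where "i \<le> k" "A \<in> Z i" "x \<in> A" using Z(1) by auto
      moreover have "A \<subseteq> sat i A" unfolding sat_def by simp
      ultimately show "x \<in> (\<Union>i\<le>k. \<Union>(sat i ` Z i \<union> {B \<in> W i. \<forall>A\<in>Z i. \<not> near A B}))"
        by blast
    next
      fix x assume "x \<in> Y"
      then obtain i B where "i \<le> k" "B \<in> W i" "x \<in> B" using W(1) by auto
      show "x \<in> (\<Union>i\<le>k. \<Union>(sat i ` Z i \<union> {B \<in> W i. \<forall>A\<in>Z i. \<not> near A B}))"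
      proof (cases "\<exists>A\<in>Z i. near A B")
        case True
        then obtain A where "A \<in> Z i" "x \<in> sat i A"
          using \<open>B \<in> W i\<close> \<open>x \<in> B\<close> unfolding sat_def by blast
        then show ?thesis using \<open>i \<le> k\<close> by blast
      next
        case False
        then show ?thesis using \<open>i \<le> k\<close> \<open>B \<in> W i\<close> \<open>x \<in> B\<close> by blast
      qed
    qed
  next
    fix i C x y assume i: "i \<le> k" and C: "C \<in> sat i ` Z i \<union> {B \<in> W i. \<forall>A\<in>Z i. \<not> near A B}"
      and xy: "x \<in> C" "y \<in> C"
    from C show "dist x y \<le> \<epsilon> + 2 * \<epsilon>' + 2 * \<tau>"
    proof
      assume "C \<in> sat i ` Z i"
      then obtain A where A: "A \<in> Z i" "C = sat i A" by auto
      \<comment> \<open>A glued set reaches at most \<open>\<epsilon>' + \<tau>\<close> beyond its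
        core \<open>A\<close>; doing so at both ends accounts for the mesh in the
        conclusion.\<close>
      have close: "\<exists>u\<in>A. dist u z \<le> \<epsilon>' + \<tau>" if z: "z \<in> C" for z
      proof (cases "z \<in> A")
        case True
        then show ?thesis using assms by (intro bexI[of _ z]) auto
      next
        case False
        then obtain B where B: "B \<in> W i" "near A B" "z \<in> B" using z A unfolding sat_def by blast
        then obtain u v where uv: "u \<in> A" "v \<in> B" "dist u v < \<tau>" unfolding near_def by blast
        have "dist v z \<le> \<epsilon>'" using W(2) i B uv by blast
        then show ?thesis using uv dist_triangle[of u z v] by (intro bexI[of _ u]) auto
      qed
      from close[OF xy(1)] close[OF xy(2)] obtain u v where uv: "u \<in> A" "v \<in> A"
        "dist u x \<le> \<epsilon>' + \<tau>" "dist v y \<le> \<epsilon>' + \<tau>" by blast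
      have "dist u v \<le> \<epsilon>" using Z(2) i A uv by blast
      moreover have "dist x y \<le> dist u x + dist u v + dist v y"
        using dist_triangle[of x y u] dist_triangle[of u y v] by (simp add: dist_commute)
      ultimately show ?thesis using uv by linarith
    next
      assume "C \<in> {B \<in> W i. \<forall>A\<in>Z i. \<not> near A B}"
      then show ?thesis using W(2)[of i C x y] i xy assms by auto
    qed
  next
    fix i C D x y assume i: "i \<le> k" and C: "C \<in> sat i ` Z i \<union> {B \<in> W i. \<forall>A\<in>Z i. \<not> near A B}"
      and D: "D \<in> sat i ` Z i \<union> {B \<in> W i. \<forall>A\<in>Z i. \<not> near A B}"
      and ne: "C \<noteq> D" and xy: "x \<in> C" "y \<in> D"
    have one: "\<tau> \<le> dist x y"
      if A: "A \<in> Z i" and x: "x \<in> sat i A" and B: "B \<in> W i" "\<not> near A B" "y \<in> B" for A B x y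
    proof (cases "x \<in> A")
      case True
      then show ?thesis using B unfolding near_def by force
    next
      case False
      then obtain B' where B': "B' \<in> W i" "near A B'" "x \<in> B'" using x unfolding sat_def by blast
      then have "B \<noteq> B'" using B by blast
      then have "\<delta>' \<le> dist x y" using W(3)[of i B' B x y] i B B' by blast
      then show ?thesis using assms by simp
    qed
    \<comment> \<open>A point of \<open>sat i A\<close> outside \<open>A\<close> lies in a fine set
      glued to \<open>A\<close>, which by \<open>near_unique\<close> is not near \<open>A'\<close>.
      This leads back to \<open>one\<close>.\<close>
    have two: "\<tau> \<le> dist x y"
      if A: "A \<in> Z i" "x \<in> sat i A" and A': "A' \<in> Z i" "y \<in> sat i A'" "A \<noteq> A'" for A A' x y
    proof (cases "y \<in> A'")
      case True
      show ?thesis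
      proof (cases "x \<in> A")
        case True
        then have "\<delta> \<le> dist x y" using Z(3) i A A' \<open>y \<in> A'\<close> by blast
        then show ?thesis using assms by simp
      next
        case False
        then obtain B where "B \<in> W i" "near A B" "x \<in> B" using A unfolding sat_def by blast
        moreover then have "\<not> near A' B" using near_unique[of i A A' B] i A A' by blast
        moreover have "y \<in> sat i A'" by fact
        ultimately show ?thesis using one[of A' y B x] A' by (simp add: dist_commute)
      qed
    next
      case False
      then obtain B where "B \<in> W i" "near A' B" "y \<in> B" using A' unfolding sat_def by blast
      moreover then have "\<not> near A B" using near_unique[of i A A' B] i A A' by blast
      ultimately show ?thesis using one A by blast
    qed
    from C D show "\<tau> \<le> dist x y"
    proof (elim UnE)
      assume "C \<in> sat i ` Z i" "D \<in> sat i ` Z i"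
      then show ?thesis using two xy ne by blast
    next
      assume "C \<in> sat i ` Z i" "D \<in> {B \<in> W i. \<forall>A\<in>Z i. \<not> near A B}"
      then show ?thesis using one xy by blast
    next
      assume "D \<in> sat i ` Z i" "C \<in> {B \<in> W i. \<forall>A\<in>Z i. \<not> near A B}"
      then show ?thesis using one[of _ y C x] xy by (auto simp: dist_commute)
    next
      assume "C \<in> {B \<in> W i. \<forall>A\<in>Z i. \<not> near A B}" "D \<in> {B \<in> W i. \<forall>A\<in>Z i. \<not> near A B}"
      then have "\<delta>' \<le> dist x y" using W(3)[of i C D x y] i xy ne by blast
      then show ?thesis using assms by simp
    qed
  qed
qed

section \<open>Covering dimension of compact sets in terms of separated coverings\<close>

lemma covering_dim_le_closed_subset:
  fixes C D :: "'a::topological_space set"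
  assumes dim: "covering_dim_le (top_of_set C) k" and "closed D" "D \<subseteq> C"
  shows "covering_dim_le (top_of_set D) k"
  unfolding covering_dim_le_def
proof (intro allI impI)
  fix \<U> assume "finite_open_cover (top_of_set D) \<U>"
  then have \<U>: "finite \<U>" "\<And>U. U \<in> \<U> \<Longrightarrow> openin (top_of_set D) U" "\<Union>\<U> = D"
    by (auto simp: finite_open_cover_def)
  then have "\<forall>U\<in>\<U>. \<exists>T. open T \<and> U = D \<inter> T"
    by (auto simp: openin_open)
  then obtain T where T: "\<And>U. U \<in> \<U> \<Longrightarrow> open (T U)" "\<And>U. U \<in> \<U> \<Longrightarrow> U = D \<inter> T U"
    by metis
  define \<U>' where "\<U>' = insert (C \<inter> - D) ((\<lambda>U. C \<inter> T U) ` \<U>)"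
  have "finite_open_cover (top_of_set C) \<U>'"
    unfolding finite_open_cover_def
  proof (intro conjI ballI)
    show "finite \<U>'" using \<U>(1) by (simp add: \<U>'_def)
    show "openin (top_of_set C) U" if "U \<in> \<U>'" for U
      using that T(1) \<open>closed D\<close> by (auto simp: \<U>'_def intro!: openin_open_Int)
    have "D \<subseteq> (\<Union>U\<in>\<U>. T U)" using \<U>(3) T(2) by fastforce
    then show "\<Union>\<U>' = topspace (top_of_set C)" by (auto simp: \<U>'_def)
  qed
  then obtain \<V> where \<V>: "finite_open_cover (top_of_set C) \<V>" "\<And>V. V \<in> \<V> \<Longrightarrow> \<exists>U\<in>\<U>'. V \<subseteq> U"
    "\<And>x. x \<in> C \<Longrightarrow> card {V \<in> \<V>. x \<in> V} \<le> k + 1"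
    using dim unfolding covering_dim_le_def by auto
  then have fin: "finite \<V>" and op: "\<And>V. V \<in> \<V> \<Longrightarrow> openin (top_of_set C) V" and cov: "\<Union>\<V> = C"
    by (auto simp: finite_open_cover_def)
  show "\<exists>\<W>. finite_open_cover (top_of_set D) \<W> \<and> (\<forall>W\<in>\<W>. \<exists>U\<in>\<U>. W \<subseteq> U) \<and>
    (\<forall>x\<in>topspace (top_of_set D). card {W \<in> \<W>. x \<in> W} \<le> k + 1)"
  proof (intro exI conjI ballI)
    \<comment> \<open>Once the empty trace is discarded, no remaining \<open>V\<close> lies inside
      \<open>C \<inter> - D\<close>, so each lies in one of the sets \<open>T U\<close>.\<close>
    let ?\<W> = "(\<lambda>V. D \<inter> V) ` \<V> - {{}}"
    show "finite_open_cover (top_of_set D) ?\<W>"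
      unfolding finite_open_cover_def
    proof (intro conjI ballI)
      show "finite ?\<W>" using fin by simp
      show "openin (top_of_set D) W" if W: "W \<in> ?\<W>" for W
      proof -
        obtain V where "V \<in> \<V>" "W = D \<inter> V" using W by auto
        moreover obtain S where "open S" "V = C \<inter> S" using op \<open>V \<in> \<V>\<close> by (auto simp: openin_open)
        ultimately have "W = D \<inter> S" using assms(3) by auto
        then show ?thesis using \<open>open S\<close> by (simp add: openin_open_Int)
      qed
      have "x \<in> \<Union>?\<W>" if xD: "x \<in> D" for x
      proof -
        obtain V where "V \<in> \<V>" "x \<in> V" using cov assms(3) xD by blast
        then show ?thesis using xD by (intro UnionI[of "D \<inter> V"]) auto
      qed
      then show "\<Union>?\<W> = topspace (top_of_set D)" by auto
    qed
    show "\<exists>U\<in>\<U>. W \<subseteq> U" if W: "W \<in> ?\<W>" for W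
    proof -
      obtain V where V: "V \<in> \<V>" "W = D \<inter> V" "W \<noteq> {}" using W by auto
      obtain U' where "U' \<in> \<U>'" "V \<subseteq> U'" using \<V>(2) V(1) by blast
      with V obtain U where "U \<in> \<U>" "V \<subseteq> C \<inter> T U" by (auto simp: \<U>'_def)
      then show ?thesis using V T(2)[of U] by blast
    qed
    fix x assume "x \<in> topspace (top_of_set D)"
    then have "x \<in> C" using assms(3) by auto
    have "card {W \<in> ?\<W>. x \<in> W} \<le> card ((\<lambda>V. D \<inter> V) ` {V \<in> \<V>. x \<in> V})"
      using fin by (intro card_mono) auto
    also have "\<dots> \<le> card {V \<in> \<V>. x \<in> V}" using fin by (intro card_image_le) auto
    also have "\<dots> \<le> k + 1" using \<V>(3) \<open>x \<in> C\<close> by blast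
    finally show "card {W \<in> ?\<W>. x \<in> W} \<le> k + 1" .
  qed
qed

text \<open>
  Ostrand's argument: for a finite cover \<open>\<V>\<close> let \<open>lam V\<close> be the distance to the complement of \<open>V\<close>. The sets
  on which the members of \<open>S \<subseteq> \<V>\<close> beat all the others are disjoint for distinct \<open>S\<close> of equal cardinality,
  so \<open>card S\<close> serves as the colour.
\<close>

lemma covering_dim_imp_sep_cover:
  fixes K :: "'a::euclidean_space set"
  assumes "compact K" and dim: "covering_dim_le (top_of_set K) k" and "0 < \<epsilon>"
  obtains \<delta> where "\<delta> > 0" "sep_cover k \<epsilon> \<delta> K"
proof -
  have "K \<subseteq> (\<Union>x\<in>K. ball x (\<epsilon>/2))" using \<open>0 < \<epsilon>\<close> by auto
  then obtain C where C: "C \<subseteq> K" "finite C" "K \<subseteq> (\<Union>x\<in>C. ball x (\<epsilon>/2))"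
    using compactE_image[OF \<open>compact K\<close>, of K "\<lambda>x. ball x (\<epsilon>/2)"] by auto
  have "finite_open_cover (top_of_set K) ((\<lambda>x. K \<inter> ball x (\<epsilon>/2)) ` C)"
    using C by (auto simp: finite_open_cover_def intro!: openin_open_Int)
  then obtain \<V> where \<V>: "finite_open_cover (top_of_set K) \<V>"
    "\<And>V. V \<in> \<V> \<Longrightarrow> \<exists>x\<in>C. V \<subseteq> ball x (\<epsilon>/2)"
    "\<And>x. x \<in> K \<Longrightarrow> card {V \<in> \<V>. x \<in> V} \<le> k + 1"
    using dim unfolding covering_dim_le_def by (auto 4 4 simp: ball_Un)
  then have fin: "finite \<V>" and op: "\<And>V. V \<in> \<V> \<Longrightarrow> openin (top_of_set K) V" and cov: "\<Union>\<V> = K"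
    by (auto simp: finite_open_cover_def)
  have diam: "dist x y \<le> \<epsilon>" if "V \<in> \<V>" "x \<in> V" "y \<in> V" for V x y
  proof -
    obtain u where "V \<subseteq> ball u (\<epsilon>/2)" using \<V>(2) \<open>V \<in> \<V>\<close> by blast
    then have "dist u x < \<epsilon>/2" "dist u y < \<epsilon>/2" using that by auto
    then show ?thesis using dist_triangle[of x y u] by (simp add: dist_commute)
  qed
  \<comment> \<open>\<open>infdist\<close> to the empty set is 0. The point \<open>z\<close> keeps
    \<open>insert z (K - V)\<close> nonempty when \<open>V = K\<close>, so that \<open>lam V\<close>
    is positive on \<open>V\<close> in that case too.\<close>
  obtain z where z: "z \<notin> K"
    using compact_imp_bounded[OF \<open>compact K\<close>] not_bounded_UNIV[where 'a='a] by (metis UNIV_eq_I)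
  define lam where "lam V x = infdist x (insert z (K - V))" for V x
  have lam_pos: "0 < lam V x" if "V \<in> \<V>" "x \<in> V" for V x
    unfolding lam_def
  proof (rule infdist_pos_not_in_closed)
    obtain T where "open T" "V = K \<inter> T" using op \<open>V \<in> \<V>\<close> by (auto simp: openin_open)
    then have "K - V = K \<inter> - T" by auto
    then have "closed (K - V)"
      using \<open>open T\<close> compact_imp_closed[OF \<open>compact K\<close>] by auto
    then show "closed (insert z (K - V))" by (rule closed_insert)
    show "x \<notin> insert z (K - V)" using that cov z by auto
  qed auto
  have lam_zero: "lam V x = 0" if "x \<in> K" "x \<notin> V" for V x
    unfolding lam_def using that by (intro infdist_zero) auto
  have lam_nonneg: "0 \<le> lam V x" for V x
    unfolding lam_def by (rule infdist_nonneg)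
  have lam_lip: "lam V x \<le> lam V y + dist x y" for V x y
    unfolding lam_def by (rule infdist_triangle)
  have lam_cont: "continuous_on UNIV (lam V)" for V
    unfolding lam_def by (intro continuous_intros)
  define P where "P S \<eta> x \<longleftrightarrow> (\<forall>V\<in>S. \<eta> < lam V x \<and> (\<forall>V'\<in>\<V>-S. lam V' x + \<eta> < lam V x))" for S \<eta> x
  define \<S> where "\<S> = {S. S \<subseteq> \<V> \<and> S \<noteq> {} \<and> card S \<le> k + 1}"
  have fin\<S>: "finite \<S>" unfolding \<S>_def using fin by simp
  \<comment> \<open>Each point of \<open>K\<close> has some positive margin; the open sets
    \<open>G n\<close> and compactness turn these into one margin \<eta> for all of
    \<open>K\<close>.\<close>
  define G where "G n = {x. \<exists>S\<in>\<S>. P S (1 / Suc n) x}" for n :: nat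
  have "open (G n)" for n
  proof -
    have "open {x. P S (1 / Suc n) x}" if "S \<in> \<S>" for S
    proof -
      have "finite S" using that fin by (auto simp: \<S>_def intro: finite_subset)
      then have "open (\<Inter>V\<in>S. {x. 1 / Suc n < lam V x} \<inter> (\<Inter>V'\<in>\<V>-S. {x. lam V' x + 1 / Suc n < lam V x}))"
        using fin
        by (intro open_INT open_Int ballI open_Collect_less continuous_intros continuous_on_subset[OF lam_cont])
          auto
      moreover have "{x. P S (1 / Suc n) x} =
        (\<Inter>V\<in>S. {x. 1 / Suc n < lam V x} \<inter> (\<Inter>V'\<in>\<V>-S. {x. lam V' x + 1 / Suc n < lam V x}))"
        by (auto simp: P_def)
      ultimately show ?thesis by simp
    qed
    then have "open (\<Union>S\<in>\<S>. {x. P S (1 / Suc n) x})" by auto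
    moreover have "G n = (\<Union>S\<in>\<S>. {x. P S (1 / Suc n) x})" by (auto simp: G_def)
    ultimately show ?thesis by simp
  qed
  moreover have "K \<subseteq> (\<Union>n. G n)"
  proof
    fix x assume x: "x \<in> K"
    define S where "S = {V \<in> \<V>. x \<in> V}"
    have S: "S \<in> \<S>" "finite S" "S \<noteq> {}" using \<V>(3)[OF x] cov x fin unfolding S_def \<S>_def by auto
    then have "0 < Min ((\<lambda>V. lam V x) ` S)" using lam_pos by (auto simp: S_def)
    then obtain n where n: "1 / Suc n < Min ((\<lambda>V. lam V x) ` S)"
      using nat_approx_posE by blast
    have "P S (1 / Suc n) x"
      unfolding P_def
    proof (intro ballI conjI)
      fix V assume "V \<in> S"
      then have *: "Min ((\<lambda>V. lam V x) ` S) \<le> lam V x" using S by auto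
      then show "1 / Suc n < lam V x" using n by linarith
      fix V' assume "V' \<in> \<V> - S"
      then have "lam V' x = 0" using x by (auto simp: S_def intro: lam_zero)
      then show "lam V' x + 1 / Suc n < lam V x" using n * by linarith
    qed
    then show "x \<in> (\<Union>n. G n)" using S by (auto simp: G_def)
  qed
  ultimately obtain I where I: "finite I" "K \<subseteq> (\<Union>n\<in>I. G n)"
    using compactE_image[OF \<open>compact K\<close>, of UNIV G] by auto
  define N where "N = Max (insert 0 I)"
  define \<eta> where "\<eta> = 1 / Suc N"
  have "\<eta> > 0" by (simp add: \<eta>_def)
  have P_ex: "\<exists>S\<in>\<S>. P S \<eta> x" if x: "x \<in> K" for x
  proof -
    obtain n S where n: "n \<in> I" "S \<in> \<S>" "P S (1 / Suc n) x" using I(2) x by (auto simp: G_def)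
    have "n \<le> N" unfolding N_def using n(1) I(1) by auto
    then have "\<eta> \<le> 1 / Suc n" by (auto simp: \<eta>_def field_simps)
    then have "P S \<eta> x" using n(3) unfolding P_def by (meson add_left_mono le_less_trans)
    then show ?thesis using n(2) by blast
  qed
  have "sep_cover k \<epsilon> \<eta> K"
  proof (rule sep_coverI[where Z = "\<lambda>j. (\<lambda>S. {x \<in> K. P S \<eta> x}) ` {S. S \<subseteq> \<V> \<and> card S = Suc j}"])
    show "K \<subseteq> (\<Union>j\<le>k. \<Union> ((\<lambda>S. {x \<in> K. P S \<eta> x}) ` {S. S \<subseteq> \<V> \<and> card S = Suc j}))"
    proof
      fix x assume x: "x \<in> K"
      then obtain S where S: "S \<in> \<S>" "P S \<eta> x" using P_ex by blast
      then have "finite S" using fin by (auto simp: \<S>_def intro: finite_subset)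
      then have "card S = Suc (card S - 1)" "card S - 1 \<le> k" using S(1)
        by (auto simp: \<S>_def card_gt_0_iff Suc_diff_Suc)
      then show "x \<in> (\<Union>j\<le>k. \<Union> ((\<lambda>S. {x \<in> K. P S \<eta> x}) ` {S. S \<subseteq> \<V> \<and> card S = Suc j}))"
        using S x by (auto simp: \<S>_def intro!: bexI[of _ "card S - 1"])
    qed
  next
    fix j A x y
    assume "A \<in> (\<lambda>S. {x \<in> K. P S \<eta> x}) ` {S. S \<subseteq> \<V> \<and> card S = Suc j}" "x \<in> A" "y \<in> A"
    then obtain S where S: "S \<subseteq> \<V>" "card S = Suc j" "x \<in> K" "y \<in> K" "P S \<eta> x" "P S \<eta> y" by auto
    then obtain V where V: "V \<in> S" by fastforce
    then have "0 < lam V x" "0 < lam V y" using S \<open>\<eta> > 0\<close> unfolding P_def by force+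
    then have "x \<in> V" "y \<in> V" using lam_zero S by force+
    then show "dist x y \<le> \<epsilon>" using diam V S by blast
  next
    fix j A B x y
    assume A: "A \<in> (\<lambda>S. {x \<in> K. P S \<eta> x}) ` {S. S \<subseteq> \<V> \<and> card S = Suc j}" "x \<in> A"
      and B: "B \<in> (\<lambda>S. {x \<in> K. P S \<eta> x}) ` {S. S \<subseteq> \<V> \<and> card S = Suc j}" "y \<in> B" and ne: "A \<noteq> B"
    obtain S where S: "S \<subseteq> \<V>" "card S = Suc j" "P S \<eta> x" "A = {x \<in> K. P S \<eta> x}" using A by auto
    obtain S' where S': "S' \<subseteq> \<V>" "card S' = Suc j" "P S' \<eta> y" "B = {x \<in> K. P S' \<eta> x}" using B by auto
    have "S \<noteq> S'" using ne S S' by auto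
    moreover have "finite S" "finite S'" using fin S S' by (auto intro: finite_subset)
    \<comment> \<open>Distinct finite sets of equal size are incomparable. At \<open>x\<close> some
      \<open>V\<close> beats some \<open>V'\<close> by \<eta>, at \<open>y\<close> the order is
      reversed, and \<open>lam\<close> is 1-Lipschitz, so \<open>2 * \<eta>\<close> is below
      \<open>2 * dist x y\<close>.\<close>
    ultimately have "\<not> S \<subseteq> S'" "\<not> S' \<subseteq> S" using S S' card_subset_eq by metis+
    then obtain V V' where V: "V \<in> S" "V \<notin> S'" "V' \<in> S'" "V' \<notin> S" by blast
    then have "lam V' x + \<eta> < lam V x" "lam V y + \<eta> < lam V' y"
      using S S' unfolding P_def by blast+
    moreover have "lam V x \<le> lam V y + dist x y" "lam V' y \<le> lam V' x + dist x y"
      using lam_lip[of V x y] lam_lip[of V' y x] by (auto simp: dist_commute)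
    ultimately show "\<eta> \<le> dist x y" by linarith
  qed
  then show thesis using that \<open>\<eta> > 0\<close> by blast
qed

text \<open>With mesh a third of a Lebesgue number \<open>e\<close> and gaps
  \<open>\<delta> \<le> e/3\<close>, the open \<open>\<delta>/3\<close>-neighbourhoods of the pieces
  are still smaller than \<open>e\<close> and disjoint within one colour. A point then lies in at
  most one set per colour, which bounds the order by \<open>k + 1\<close>.\<close>

lemma sep_cover_imp_covering_dim:
  fixes K :: "'a::metric_space set"
  assumes "compact K" and sep: "\<And>\<epsilon>. 0 < \<epsilon> \<Longrightarrow> \<exists>\<delta>>0. sep_cover k \<epsilon> \<delta> K"
  shows "covering_dim_le (top_of_set K) k"
  unfolding covering_dim_le_def
proof (intro allI impI)
  fix \<U> assume "finite_open_cover (top_of_set K) \<U>"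
  then have \<U>: "\<And>U. U \<in> \<U> \<Longrightarrow> openin (top_of_set K) U" "\<Union>\<U> = K"
    by (auto simp: finite_open_cover_def)
  then have "\<forall>U\<in>\<U>. \<exists>T. open T \<and> U = K \<inter> T"
    by (auto simp: openin_open)
  then obtain T where T: "\<And>U. U \<in> \<U> \<Longrightarrow> open (T U)" "\<And>U. U \<in> \<U> \<Longrightarrow> U = K \<inter> T U"
    by metis
  have "K \<subseteq> \<Union>(T ` \<U>)" using \<U>(2) T(2) by fastforce
  moreover have "open G" if "G \<in> T ` \<U>" for G using T(1) that by auto
  ultimately obtain e where e: "0 < e" "\<forall>x\<in>K. \<exists>G\<in>T ` \<U>. ball x e \<subseteq> G"
    using Heine_Borel_lemma[OF \<open>compact K\<close>, of "T ` \<U>"] by metis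
  obtain \<delta>0 where \<delta>0: "\<delta>0 > 0" "sep_cover k (e/3) \<delta>0 K" using sep[of "e/3"] e(1) by auto
  define \<delta> where "\<delta> = min \<delta>0 (e/3)"
  have \<delta>: "\<delta> > 0" "\<delta> \<le> e/3" using \<delta>0 e(1) by (auto simp: \<delta>_def)
  have "sep_cover k (e/3) \<delta> K" using \<delta>0(2) by (rule sep_cover_mono) (auto simp: \<delta>_def)
  then obtain Z where Z: "K \<subseteq> (\<Union>i\<le>k. \<Union>(Z i))"
    "\<And>i A x y. i \<le> k \<Longrightarrow> A \<in> Z i \<Longrightarrow> x \<in> A \<Longrightarrow> y \<in> A \<Longrightarrow> dist x y \<le> e/3"
    "\<And>i A B x y. i \<le> k \<Longrightarrow> A \<in> Z i \<Longrightarrow> B \<in> Z i \<Longrightarrow> A \<noteq> B \<Longrightarrow> x \<in> A \<Longrightarrow> y \<in> B \<Longrightarrow> \<delta> \<le> dist x y"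
    by (rule sep_coverE) metis
  define h where "h A = (\<Union>z\<in>A. ball z (\<delta>/3))" for A :: "'a set"
  have h_unique: "A = B" if "i \<le> k" "A \<in> Z i" "B \<in> Z i" and xh: "x \<in> h A" "x \<in> h B" for i A B x
  proof (rule ccontr)
    assume "A \<noteq> B"
    obtain a b where "a \<in> A" "b \<in> B" "dist a x < \<delta>/3" "dist b x < \<delta>/3"
      using xh unfolding h_def UN_iff mem_ball by blast
    moreover from this have "\<delta> \<le> dist a b" using Z(3)[of i A B a b] that \<open>A \<noteq> B\<close> by simp
    ultimately show False using dist_triangle[of a b x] \<delta>(1) by (simp add: dist_commute)
  qed
  have "K \<subseteq> (\<Union>A\<in>(\<Union>i\<le>k. Z i). h A)"
  proof
    fix x assume "x \<in> K"
    then obtain i A where "i \<le> k" "A \<in> Z i" "x \<in> A" using Z(1) by auto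
    moreover from this have "x \<in> h A" unfolding h_def using \<delta>(1) by (intro UN_I[of x]) auto
    ultimately show "x \<in> (\<Union>A\<in>(\<Union>i\<le>k. Z i). h A)" by auto
  qed
  moreover have "open (h A)" for A unfolding h_def by auto
  ultimately obtain \<A> where \<A>: "\<A> \<subseteq> (\<Union>i\<le>k. Z i)" "finite \<A>" "K \<subseteq> (\<Union>A\<in>\<A>. h A)"
    using compactE_image[OF \<open>compact K\<close>, of "\<Union>i\<le>k. Z i" h] by metis
  define \<V> where "\<V> = (\<lambda>A. K \<inter> h A) ` \<A> - {{}}"
  show "\<exists>\<V>. finite_open_cover (top_of_set K) \<V> \<and> (\<forall>V\<in>\<V>. \<exists>U\<in>\<U>. V \<subseteq> U) \<and>
    (\<forall>x\<in>topspace (top_of_set K). card {V \<in> \<V>. x \<in> V} \<le> k + 1)"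
  proof (intro exI[of _ \<V>] conjI ballI)
    have "x \<in> \<Union>\<V>" if x: "x \<in> K" for x
    proof -
      obtain A where "A \<in> \<A>" "x \<in> h A" using \<A>(3) x by blast
      then show ?thesis unfolding \<V>_def using x by (intro UnionI[of "K \<inter> h A"]) auto
    qed
    then have "\<Union>\<V> = K" by (auto simp: \<V>_def)
    then show "finite_open_cover (top_of_set K) \<V>"
      using \<A> \<open>\<And>A. open (h A)\<close> by (auto simp: finite_open_cover_def \<V>_def intro!: openin_open_Int)
    show "\<exists>U\<in>\<U>. V \<subseteq> U" if V: "V \<in> \<V>" for V
    proof -
      obtain A where A': "A \<in> \<A>" "V = K \<inter> h A" "V \<noteq> {}" using V unfolding \<V>_def by blast
      then obtain x where A: "A \<in> \<A>" "V = K \<inter> h A" "x \<in> V" by blast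
      then obtain i where i: "i \<le> k" "A \<in> Z i" using \<A>(1) by auto
      obtain U where U: "U \<in> \<U>" "ball x e \<subseteq> T U" using e(2) A by auto
      have "V \<subseteq> ball x e"
      proof
        fix y assume "y \<in> V"
        have "x \<in> h A" "y \<in> h A" using A \<open>y \<in> V\<close> by simp_all
        then obtain a b where ab: "a \<in> A" "b \<in> A" "dist a x < \<delta>/3" "dist b y < \<delta>/3"
          unfolding h_def UN_iff mem_ball by blast
        have "dist a b \<le> e/3" using Z(2)[of i A a b] i ab by simp
        then have "dist x y < e"
          using dist_triangle[of x y a] dist_triangle[of a y b] ab \<delta> e(1) by (simp add: dist_commute)
        then show "y \<in> ball x e" by simp
      qed
      then have "V \<subseteq> U" using U T(2)[OF U(1)] A by blast
      then show ?thesis using U by blast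
    qed
    fix x
    define \<B> where "\<B> = {V \<in> \<V>. x \<in> V}"
    have "\<forall>V\<in>\<B>. \<exists>i\<le>k. \<exists>A\<in>Z i. V = K \<inter> h A" using \<A>(1) by (force simp: \<B>_def \<V>_def)
    then obtain c A where c: "\<And>V. V \<in> \<B> \<Longrightarrow> c V \<le> k" "\<And>V. V \<in> \<B> \<Longrightarrow> A V \<in> Z (c V)"
      "\<And>V. V \<in> \<B> \<Longrightarrow> V = K \<inter> h (A V)"
      by metis
    have "inj_on c \<B>"
    proof
      fix V W assume VW: "V \<in> \<B>" "W \<in> \<B>" "c V = c W"
      have "x \<in> V" "x \<in> W" using VW by (auto simp: \<B>_def)
      then have "x \<in> h (A V)" "x \<in> h (A W)" using c(3)[OF VW(1)] c(3)[OF VW(2)] by blast+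
      then have "A V = A W" using h_unique[of "c V" "A V" "A W" x] c(1,2)[OF VW(1)] c(2)[OF VW(2)] VW(3) by simp
      then show "V = W" using c(3)[OF VW(1)] c(3)[OF VW(2)] by simp
    qed
    then have "card \<B> \<le> card {..k}" by (rule card_inj_on_le) (use c(1) in auto)
    then show "card {V \<in> \<V>. x \<in> V} \<le> k + 1" by (simp add: \<B>_def)
  qed
qed

text \<open>
  Lebesgue's covering theorem. Colour \<open>i\<close> is split into the pieces near the lower face in direction
  \<open>col i\<close> and the rest, and \<open>f i\<close> separates the two parts. Some \<open>f i x\<close> is \<open>0\<close> or \<open>1\<close> at every point \<open>x\<close>,
  whereas the map \<open>G\<close>, which swaps opposite faces, has a fixed point by Brouwer.
\<close>

lemma no_sep_cover_box:
  fixes a b :: "real ^ 'n" and S :: "'n::finite set"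
  assumes card: "k < card S" and less: "\<And>c. c \<in> S \<Longrightarrow> a $ c < b $ c"
    and eq: "\<And>c. c \<notin> S \<Longrightarrow> a $ c = b $ c"
  obtains \<epsilon> where "0 < \<epsilon>" "\<And>\<delta>. 0 < \<delta> \<Longrightarrow> \<not> sep_cover k \<epsilon> \<delta> (cbox a b)"
proof -
  \<comment> \<open>A quarter of the shortest side in the directions of \<open>S\<close>: a piece of
    mesh \<epsilon> that meets the band of width \<epsilon> along the lower face stays within
    \<open>2 * \<epsilon>\<close> of that face, hence at least \<open>2 * \<epsilon>\<close> away
    from the opposite one.\<close>
  define \<epsilon> where "\<epsilon> = Min ((\<lambda>c. b $ c - a $ c) ` S) / 4"
  have "S \<noteq> {}" "finite S" using card by auto
  then have \<epsilon>: "0 < \<epsilon>" using less by (auto simp: \<epsilon>_def)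
  have \<epsilon>_le: "a $ c + 4 * \<epsilon> \<le> b $ c" if "c \<in> S" for c
  proof -
    have "Min ((\<lambda>c. b $ c - a $ c) ` S) \<le> b $ c - a $ c" using that \<open>finite S\<close> by auto
    then show ?thesis by (simp add: \<epsilon>_def)
  qed
  have "\<not> sep_cover k \<epsilon> \<delta> (cbox a b)" if \<delta>: "0 < \<delta>" for \<delta>
  proof
    assume "sep_cover k \<epsilon> \<delta> (cbox a b)"
    then obtain Z where Z: "cbox a b \<subseteq> (\<Union>i\<le>k. \<Union>(Z i))"
      "\<And>i A x y. i \<le> k \<Longrightarrow> A \<in> Z i \<Longrightarrow> x \<in> A \<Longrightarrow> y \<in> A \<Longrightarrow> dist x y \<le> \<epsilon>"
      "\<And>i A B x y. i \<le> k \<Longrightarrow> A \<in> Z i \<Longrightarrow> B \<in> Z i \<Longrightarrow> A \<noteq> B \<Longrightarrow> x \<in> A \<Longrightarrow> y \<in> B \<Longrightarrow> \<delta> \<le> dist x y"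
      by (rule sep_coverE) metis
    have "card {..k} \<le> card S" using card by simp
    then obtain col where col: "inj_on col {..k}" "col ` {..k} \<subseteq> S"
      using card_le_inj[of "{..k}" S] \<open>finite S\<close> by auto
    define idx where "idx = inv_into {..k} col"
    have idx: "idx (col i) = i" if "i \<le> k" for i
      unfolding idx_def using col(1) that by simp
    define low where "low i A \<longleftrightarrow> (\<exists>x\<in>A. x $ col i \<le> a $ col i + \<epsilon>)" for i and A :: "(real ^ 'n) set"
    \<comment> \<open>Adjoining the opposite faces is what yields the contradiction: at a fixed
      point of \<open>G\<close>, \<open>f i x = 0\<close> forces \<open>x\<close> onto the upper
      face, which lies in \<open>Q i\<close>, where \<open>f i\<close> is 1; likewise with the roles
      exchanged.\<close>
    define P where "P i = {x. x $ col i \<le> a $ col i} \<union> \<Union>{A \<in> Z i. low i A}" for i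
    define Q where "Q i = {x. b $ col i \<le> x $ col i} \<union> \<Union>{A \<in> Z i. \<not> low i A}" for i
    define d where "d = min \<delta> \<epsilon>"
    have d: "0 < d" using \<delta> \<epsilon> by (simp add: d_def)
    have comp: "\<bar>x $ c - y $ c\<bar> \<le> dist x y" for x y :: "real ^ 'n" and c
      using component_le_norm_cart[of "x - y" c] by (simp add: dist_norm)
    have PQ: "d \<le> dist p q" if i: "i \<le> k" and p: "p \<in> P i" and q: "q \<in> Q i" for i p q
    proof -
      have *: "a $ col i + 4 * \<epsilon> \<le> b $ col i" using \<epsilon>_le col(2) i by auto
      have lowP: "x $ col i \<le> a $ col i + 2 * \<epsilon>" if A: "A \<in> Z i" "low i A" "x \<in> A" for A x
      proof -
        obtain y where "y \<in> A" "y $ col i \<le> a $ col i + \<epsilon>" using \<open>low i A\<close> by (auto simp: low_def)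
        moreover have "dist x y \<le> \<epsilon>" using Z(2)[of i A x y] i A \<open>y \<in> A\<close> by simp
        ultimately show ?thesis using comp[of x "col i" y] by linarith
      qed
      consider "p $ col i \<le> a $ col i" "b $ col i \<le> q $ col i"
        | B where "p $ col i \<le> a $ col i" "B \<in> Z i" "\<not> low i B" "q \<in> B"
        | A where "A \<in> Z i" "low i A" "p \<in> A" "b $ col i \<le> q $ col i"
        | A B where "A \<in> Z i" "low i A" "p \<in> A" "B \<in> Z i" "\<not> low i B" "q \<in> B"
        using p q unfolding P_def Q_def by blast
      then show ?thesis
      proof cases
        case 1
        then show ?thesis using comp[of p "col i" q] * \<epsilon> by (simp add: d_def)
      next
        case 2
        then have "q $ col i > a $ col i + \<epsilon>" by (auto simp: low_def)
        then show ?thesis using 2 comp[of p "col i" q] by (simp add: d_def)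
      next
        case 3
        then show ?thesis using comp[of p "col i" q] lowP[of A p] * \<epsilon> by (simp add: d_def)
      next
        case 4
        then have "\<delta> \<le> dist p q" using Z(3)[of i A B p q] i by blast
        then show ?thesis by (simp add: d_def)
      qed
    qed
    define f where "f i x = min 1 (infdist x (P i) / d)" for i x
    have aP: "a \<in> P i" for i by (simp add: P_def)
    have f0: "f i x = 0" if "x \<in> P i" for i x
      using that by (simp add: f_def)
    have f1: "f i x = 1" if "i \<le> k" "x \<in> Q i" for i x
    proof -
      have ne: "P i \<noteq> {}" using aP by blast
      have "d \<le> infdist x (P i)"
        unfolding infdist_notempty[OF ne]
        using PQ[OF that(1) _ that(2)] aP by (intro cINF_greatest) (auto simp: dist_commute)
      then show ?thesis using d by (simp add: f_def)
    qed
    have f01: "0 \<le> f i x" "f i x \<le> 1" for i x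
      using d by (auto simp: f_def infdist_nonneg)
    \<comment> \<open>Directions that carry no colour are frozen at \<open>a\<close>. This takes
      care of degenerate sides and of an \<open>S\<close> with more than \<open>k + 1\<close>
      elements.\<close>
    define G where "G x = (\<chi> c. if c \<in> col ` {..k} then b $ c - (b $ c - a $ c) * f (idx c) x else a $ c)" for x
    have le: "a $ c \<le> b $ c" for c using less eq by (metis less_eq_real_def)
    have "continuous_on (cbox a b) G"
      unfolding G_def
    proof (rule continuous_on_vec_lambda)
      fix c
      show "continuous_on (cbox a b) (\<lambda>x. if c \<in> col ` {..k} then b $ c - (b $ c - a $ c) * f (idx c) x else a $ c)"
        unfolding f_def using d by (cases "c \<in> col ` {..k}") (auto intro!: continuous_intros)
    qed
    moreover have "G \<in> cbox a b \<rightarrow> cbox a b"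
    proof
      fix x
      have "a $ c \<le> b $ c - (b $ c - a $ c) * f i x" "b $ c - (b $ c - a $ c) * f i x \<le> b $ c" for c i
        using mult_left_mono[OF f01(2)[of i x], of "b $ c - a $ c"] le[of c] f01(1)[of i x] by auto
      then show "G x \<in> cbox a b" using le by (auto simp: G_def mem_box_cart)
    qed
    moreover have "a \<in> cbox a b" using le by (simp add: mem_box_cart)
    ultimately obtain x where x: "x \<in> cbox a b" "G x = x"
      using brouwer[OF compact_cbox convex_box(1), of a b G] by blast
    then obtain i A where i: "i \<le> k" "A \<in> Z i" "x \<in> A" using Z(1) by blast
    have xi: "x $ col i = b $ col i - (b $ col i - a $ col i) * f i x"
      using arg_cong[OF x(2), of "\<lambda>v. v $ col i"] i idx by (simp add: G_def)
    show False
    proof (cases "low i A")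
      case True
      then have "f i x = 0" using f0 i by (auto simp: P_def)
      then have "x \<in> Q i" using xi by (simp add: Q_def)
      then show False using f1[OF i(1)] \<open>f i x = 0\<close> by auto
    next
      case False
      then have "f i x = 1" using f1 i by (auto simp: Q_def)
      then have "x \<in> P i" using xi by (simp add: P_def)
      then show False using f0 \<open>f i x = 1\<close> by auto
    qed
  qed
  then show thesis using that \<epsilon> by blast
qed

text \<open>The \<open>k + 1\<close> colours are shifts of one another, and the gaps between intervals of different colours are
  disjoint; hence a point is missed by one colour at most.\<close>

lemma interval_bricks:
  fixes \<epsilon> :: real
  assumes "0 < \<epsilon>"
  obtains J :: "nat \<Rightarrow> real set set" and \<delta> and bad :: "real \<Rightarrow> nat" where "0 < \<delta>"
    "\<And>i A x y. A \<in> J i \<Longrightarrow> x \<in> A \<Longrightarrow> y \<in> A \<Longrightarrow> \<bar>x - y\<bar> \<le> \<epsilon>"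
    "\<And>i A B x y. A \<in> J i \<Longrightarrow> B \<in> J i \<Longrightarrow> A \<noteq> B \<Longrightarrow> x \<in> A \<Longrightarrow> y \<in> B \<Longrightarrow> \<delta> \<le> \<bar>x - y\<bar>"
    "\<And>t i. i \<le> k \<Longrightarrow> i \<noteq> bad t \<Longrightarrow> t \<in> \<Union>(J i)"
proof -
  define K where "K = int k + 1"
  define L where "L = real_of_int K / \<epsilon>"
  have K: "K > 0" by (simp add: K_def)
  then have L: "L > 0" using assms by (simp add: L_def)
  \<comment> \<open>Measured in units of \<open>1 / L\<close>, the intervals of colour
    \<open>i\<close> have length \<open>K - 1\<close> and omit only the open unit intervals that
    start at integers congruent to \<open>i\<close> modulo \<open>K\<close>. So
    \<open>\<lfloor>t * L\<rfloor> mod K\<close> is the only colour that can miss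
    \<open>t\<close>.\<close>
  define I where "I i a = {t. real_of_int (K * a + int i + 1) \<le> t * L \<and> t * L \<le> real_of_int (K * a + int i + K)}" for i a
  define bad where "bad t = nat (\<lfloor>t * L\<rfloor> mod K)" for t
  have diam: "\<bar>x - y\<bar> \<le> \<epsilon>" if "x \<in> I i a" "y \<in> I i a" for x y i a
  proof -
    have "\<bar>x * L - y * L\<bar> \<le> K - 1" using that unfolding I_def by simp linarith
    then have "\<bar>x - y\<bar> * L \<le> K" using L by (simp add: abs_mult flip: left_diff_distrib)
    then show ?thesis using assms K by (simp add: L_def field_simps)
  qed
  have sep: "1 / L \<le> \<bar>x - y\<bar>" if "x \<in> I i a" "y \<in> I i b" "a < b" for x y i a b
  proof -
    have "K * (a + 1) \<le> K * b" using that(3) K by (intro mult_left_mono) auto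
    then have "real_of_int (K * a + int i + K + 1) \<le> real_of_int (K * b + int i + 1)"
      by (subst of_int_le_iff) (simp add: algebra_simps)
    then have "x * L + 1 \<le> y * L" using that(1,2) unfolding I_def by simp
    then have "1 \<le> (y - x) * L" by (simp add: algebra_simps)
    also have "\<dots> \<le> \<bar>x - y\<bar> * L" using L by (intro mult_right_mono) auto
    finally have "1 \<le> \<bar>x - y\<bar> * L" .
    then show ?thesis using L by (simp add: field_simps)
  qed
  show thesis
  proof (rule that[of "1 / L" "\<lambda>i. range (I i)" bad])
    show "0 < 1 / L" using L by simp
    show "\<bar>x - y\<bar> \<le> \<epsilon>" if "A \<in> range (I i)" "x \<in> A" "y \<in> A" for i A x y
      using that diam by auto
    show "1 / L \<le> \<bar>x - y\<bar>" if AB: "A \<in> range (I i)" "B \<in> range (I i)" "A \<noteq> B" "x \<in> A" "y \<in> B" for i A B x y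
    proof -
      obtain a b where ab: "A = I i a" "B = I i b" "a \<noteq> b" using AB by auto
      then consider "a < b" | "b < a" by linarith
      then show ?thesis using sep[of x i a y b] sep[of y i b x a] AB ab by cases (auto simp: abs_minus_commute)
    qed
    fix t i assume i: "i \<le> k" "i \<noteq> bad t"
    define q where "q = \<lfloor>t * L\<rfloor>"
    define r where "r = q mod K"
    define e where "e = q div K"
    have q: "q = K * e + r" "0 \<le> r" "r < K" using K by (simp_all add: e_def r_def)
    have tL: "real_of_int q \<le> t * L" "t * L \<le> real_of_int (q + 1)" by (simp_all add: q_def)
    have "r \<noteq> int i" using i q(2) by (auto simp: bad_def q_def r_def)
    then consider "int i < r" | "r < int i" by linarith
    then show "t \<in> \<Union>(range (I i))"
    proof cases
      case 1
      then have "K * e + int i + 1 \<le> q" "q + 1 \<le> K * e + int i + K" using q by auto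
      then have "t \<in> I i e" unfolding I_def using tL by (auto intro: order_trans[OF _ tL(1)] order_trans[OF tL(2)] simp del: of_int_add of_int_mult)
      then show ?thesis by blast
    next
      case 2
      then have "K * (e - 1) + int i + 1 \<le> q" "q + 1 \<le> K * (e - 1) + int i + K"
        using q i(1) by (auto simp: K_def algebra_simps)
      then have "t \<in> I i (e - 1)" unfolding I_def using tL by (auto intro: order_trans[OF _ tL(1)] order_trans[OF tL(2)] simp del: of_int_add of_int_mult)
      then show ?thesis by blast
    qed
  qed
qed

section \<open>Separated coverings of products with nowhere dense factors\<close>

text \<open>Cut points outside \<open>N\<close> exist in every interval of length
  \<open>\<epsilon>/2\<close>, so one can be chosen in each interval of a grid, and consecutive ones
  are less than \<epsilon> apart. Points of \<open>N\<close> in different pieces have a cut point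
  between them, and the finitely many relevant cuts keep a positive distance from the compact
  \<open>N\<close>.\<close>

lemma nowhere_dense_real_pieces:
  fixes N :: "real set"
  assumes "compact N" "interior N = {}" "0 < \<epsilon>"
  obtains Z \<delta> where "0 < \<delta>" "N \<subseteq> \<Union>Z"
    "\<And>A x y. A \<in> Z \<Longrightarrow> x \<in> A \<Longrightarrow> y \<in> A \<Longrightarrow> \<bar>x - y\<bar> \<le> \<epsilon>"
    "\<And>A B x y. A \<in> Z \<Longrightarrow> B \<in> Z \<Longrightarrow> A \<noteq> B \<Longrightarrow> x \<in> A \<Longrightarrow> y \<in> B \<Longrightarrow> \<delta> \<le> \<bar>x - y\<bar>"
proof (cases "N = {}")
  case True
  then show thesis by (intro that[of 1 "{}"]) auto
next
  case False
  define \<eta> where "\<eta> = \<epsilon> / 2"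
  have \<eta>: "0 < \<eta>" using assms by (simp add: \<eta>_def)
  have "\<exists>q. of_int j * \<eta> < q \<and> q < of_int (j + 1) * \<eta> \<and> q \<notin> N" for j :: int
  proof (rule ccontr)
    assume "\<nexists>q. of_int j * \<eta> < q \<and> q < of_int (j + 1) * \<eta> \<and> q \<notin> N"
    then have "{of_int j * \<eta> <..< of_int (j + 1) * \<eta>} \<subseteq> N" by auto
    then have "{of_int j * \<eta> <..< of_int (j + 1) * \<eta>} \<subseteq> interior N" by (intro interior_maximal) auto
    moreover have "(of_int j + 1 / 2) * \<eta> \<in> {of_int j * \<eta> <..< of_int (j + 1) * \<eta>}"
      using \<eta> by (auto simp: algebra_simps)
    ultimately show False using assms(2) by auto
  qed
  then obtain q where q: "\<And>j. of_int j * \<eta> < q j" "\<And>j. q j < of_int (j + 1) * \<eta>" "\<And>j. q j \<notin> N"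
    by metis
  have q_mono: "q i \<le> q j" if "i \<le> j" for i j
  proof (cases "i = j")
    case False
    then have "real_of_int (i + 1) * \<eta> \<le> of_int j * \<eta>" using that \<eta> by (intro mult_right_mono) auto
    then show ?thesis using q(2)[of i] q(1)[of j] by linarith
  qed simp
  obtain r where r: "\<And>t. t \<in> N \<Longrightarrow> \<bar>t\<bar> \<le> r"
    using compact_imp_bounded[OF assms(1)] by (auto simp: bounded_real)
  \<comment> \<open>A point with \<open>\<lfloor>t / \<eta>\<rfloor> = j\<close> lies in piece
    \<open>j\<close> or \<open>j - 1\<close>, according to its side of \<open>q j\<close>; the
    margin 2 keeps both indices in range.\<close>
  define M where "M = \<lceil>r / \<eta>\<rceil> + 2"
  define Q where "Q = q ` {-M..M}"
  \<comment> \<open>\<open>setdist\<close> is 0 when one of the sets is empty; hence the separate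
    case \<open>N = {}\<close> and the proof of \<open>0 \<le> M\<close>.\<close>
  define \<delta> where "\<delta> = setdist N Q"
  have "0 \<le> r" using False r by force
  then have "0 \<le> r / \<eta>" using \<eta> by simp
  then have "0 \<le> M" unfolding M_def by linarith
  then have \<delta>: "0 < \<delta>" unfolding \<delta>_def
    using setdist_gt_0_compact_closed[OF assms(1), of Q] False q(3)
    by (auto simp: Q_def finite_imp_closed)
  have \<delta>_le: "\<delta> \<le> \<bar>t - q j\<bar>" if "t \<in> N" "j \<in> {-M..M}" for t j
    using setdist_le_dist[of t N "q j" Q] that by (auto simp: \<delta>_def Q_def dist_real_def)
  define A where "A j = {t \<in> N. q j < t \<and> t < q (j + 1)}" for j
  have sep: "\<delta> \<le> \<bar>x - y\<bar>" if "i \<in> {-M..<M}" "i < j" "x \<in> A i" "y \<in> A j" for x y i j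
    using \<delta>_le[of x "i + 1"] that q_mono[of "i + 1" j] by (auto simp: A_def)
  show thesis
  proof (rule that[of \<delta> "A ` {-M..<M}"])
    show "0 < \<delta>" by fact
    show "N \<subseteq> \<Union> (A ` {- M..<M})"
    proof
      fix t assume t: "t \<in> N"
      define j where "j = \<lfloor>t / \<eta>\<rfloor>"
      have j: "of_int j * \<eta> \<le> t" "t < of_int (j + 1) * \<eta>"
        using \<eta> floor_divide_lower[OF \<eta>, of t] floor_divide_upper[OF \<eta>, of t] by (auto simp: j_def)
      have "t / \<eta> \<le> r / \<eta>" "- (r / \<eta>) \<le> t / \<eta>"
        using r[OF t] \<eta> by (auto simp: field_simps abs_le_iff)
      then have "j \<le> \<lceil>r / \<eta>\<rceil>" "- \<lceil>r / \<eta>\<rceil> - 1 \<le> j" unfolding j_def by linarith+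
      then have jM: "j \<in> {-M..<M}" "j - 1 \<in> {-M..<M}" by (auto simp: M_def)
      have "t \<noteq> q j" using q(3) t by auto
      then consider "q j < t" | "t < q j" by linarith
      then show "t \<in> \<Union> (A ` {- M..<M})"
      proof cases
        case 1
        then have "t \<in> A j" using q(1)[of "j + 1"] j t by (auto simp: A_def)
        then show ?thesis using jM by blast
      next
        case 2
        then have "t \<in> A (j - 1)" using q(2)[of "j - 1"] j t by (auto simp: A_def)
        then show ?thesis using jM by blast
      qed
    qed
    show "\<bar>x - y\<bar> \<le> \<epsilon>" if B: "B \<in> A ` {-M..<M}" "x \<in> B" "y \<in> B" for B x y
    proof -
      obtain j where "x \<in> A j" "y \<in> A j" using B by auto
      then show ?thesis using q(1)[of j] q(2)[of "j + 1"] by (auto simp: A_def \<eta>_def algebra_simps)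
    qed
    show "\<delta> \<le> \<bar>x - y\<bar>" if BC: "B \<in> A ` {-M..<M}" "C \<in> A ` {-M..<M}" "B \<noteq> C" "x \<in> B" "y \<in> C" for B C x y
    proof -
      obtain i j where ij: "B = A i" "C = A j" "i \<noteq> j" "i \<in> {-M..<M}" "j \<in> {-M..<M}" using BC(1-3) by blast
      then consider "i < j" | "j < i" by linarith
      then show ?thesis using sep[of i j x y] sep[of j i y x] BC ij by cases (auto simp: abs_minus_commute)
    qed
  qed
qed

text \<open>The directions in \<open>T\<close> are cut into bricks, the others into pieces that
  serve all colours alike. At a given point each direction of \<open>T\<close> spoils at most one of
  the \<open>k + 1\<close> colours, and there are at most \<open>k\<close> such directions, so some
  colour covers the point in every direction.\<close>

lemma sep_cover_product:
  fixes N :: "'n::finite \<Rightarrow> real set"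
  assumes "\<And>c. compact (N c)" and nd: "\<And>c. c \<notin> T \<Longrightarrow> interior (N c) = {}" and "card T \<le> k" and "0 < \<epsilon>"
  obtains \<delta> where "0 < \<delta>" "sep_cover k \<epsilon> \<delta> {x :: real ^ 'n. \<forall>c. x $ c \<in> N c}"
proof -
  define e where "e = \<epsilon> / CARD('n)"
  have e: "0 < e" using \<open>0 < \<epsilon>\<close> by (simp add: e_def)
  obtain J \<delta>J and bad :: "real \<Rightarrow> nat" where J: "0 < \<delta>J"
    "\<And>i A x y. A \<in> J i \<Longrightarrow> x \<in> A \<Longrightarrow> y \<in> A \<Longrightarrow> \<bar>x - y\<bar> \<le> e"
    "\<And>i A B x y. A \<in> J i \<Longrightarrow> B \<in> J i \<Longrightarrow> A \<noteq> B \<Longrightarrow> x \<in> A \<Longrightarrow> y \<in> B \<Longrightarrow> \<delta>J \<le> \<bar>x - y\<bar>"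
    "\<And>t i. i \<le> k \<Longrightarrow> i \<noteq> bad t \<Longrightarrow> t \<in> \<Union>(J i)"
    by (rule interval_bricks[OF e, of k]) blast
  have "\<exists>Z \<delta>. 0 < \<delta> \<and> N c \<subseteq> \<Union>Z \<and> (\<forall>A\<in>Z. \<forall>x\<in>A. \<forall>y\<in>A. \<bar>x - y\<bar> \<le> e) \<and>
    (\<forall>A\<in>Z. \<forall>B\<in>Z. A \<noteq> B \<longrightarrow> (\<forall>x\<in>A. \<forall>y\<in>B. \<delta> \<le> \<bar>x - y\<bar>))" if "c \<notin> T" for c
    by (rule nowhere_dense_real_pieces[OF assms(1)[of c] nd[OF that] e]) metis
  then obtain Z \<delta>Z where *: "\<And>c. c \<notin> T \<Longrightarrow> 0 < \<delta>Z c \<and> N c \<subseteq> \<Union>(Z c) \<and>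
    (\<forall>A\<in>Z c. \<forall>x\<in>A. \<forall>y\<in>A. \<bar>x - y\<bar> \<le> e) \<and>
    (\<forall>A\<in>Z c. \<forall>B\<in>Z c. A \<noteq> B \<longrightarrow> (\<forall>x\<in>A. \<forall>y\<in>B. \<delta>Z c \<le> \<bar>x - y\<bar>))"
    by metis
  then have Z: "\<And>c. c \<notin> T \<Longrightarrow> 0 < \<delta>Z c" "\<And>c. c \<notin> T \<Longrightarrow> N c \<subseteq> \<Union>(Z c)"
    "\<And>c A x y. c \<notin> T \<Longrightarrow> A \<in> Z c \<Longrightarrow> x \<in> A \<Longrightarrow> y \<in> A \<Longrightarrow> \<bar>x - y\<bar> \<le> e"
    "\<And>c A B x y. c \<notin> T \<Longrightarrow> A \<in> Z c \<Longrightarrow> B \<in> Z c \<Longrightarrow> A \<noteq> B \<Longrightarrow> x \<in> A \<Longrightarrow> y \<in> B \<Longrightarrow> \<delta>Z c \<le> \<bar>x - y\<bar>"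
    by simp_all
  define W where "W i c = (if c \<in> T then J i else Z c)" for i c
  define \<delta> where "\<delta> = Min (range (\<lambda>c. if c \<in> T then \<delta>J else \<delta>Z c))"
  have \<delta>: "0 < \<delta>" using J(1) Z(1) by (auto simp: \<delta>_def)
  have \<delta>_le: "\<delta> \<le> (if c \<in> T then \<delta>J else \<delta>Z c)" for c
    unfolding \<delta>_def by (rule Min_le) auto
  have W_diam: "\<bar>x - y\<bar> \<le> e" if "A \<in> W i c" "x \<in> A" "y \<in> A" for i c A x y
    using J(2) Z(3) that unfolding W_def by (metis (full_types))
  have W_sep: "\<delta> \<le> \<bar>x - y\<bar>" if "A \<in> W i c" "B \<in> W i c" "A \<noteq> B" "x \<in> A" "y \<in> B" for i c A B x y
  proof (cases "c \<in> T")
    case True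
    then have "\<delta>J \<le> \<bar>x - y\<bar>" using J(3)[of A i B x y] that by (simp add: W_def)
    then show ?thesis using \<delta>_le[of c] True by simp
  next
    case False
    then have "\<delta>Z c \<le> \<bar>x - y\<bar>" using Z(4)[of c A B x y] that by (simp add: W_def)
    then show ?thesis using \<delta>_le[of c] False by simp
  qed
  have "sep_cover k \<epsilon> \<delta> {x :: real ^ 'n. \<forall>c. x $ c \<in> N c}"
  proof (rule sep_coverI[where Z = "\<lambda>i. (\<lambda>h. {x. \<forall>c. x $ c \<in> h c}) ` {h. \<forall>c. h c \<in> W i c}"])
    show "{x :: real ^ 'n. \<forall>c. x $ c \<in> N c} \<subseteq>
      (\<Union>i\<le>k. \<Union> ((\<lambda>h. {x. \<forall>c. x $ c \<in> h c}) ` {h. \<forall>c. h c \<in> W i c}))"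
    proof
      fix x :: "real ^ 'n" assume "x \<in> {x. \<forall>c. x $ c \<in> N c}"
      then have x: "x $ c \<in> N c" for c by simp
      have "card ((\<lambda>c. bad (x $ c)) ` T) \<le> k" using card_image_le[of T] \<open>card T \<le> k\<close> by (meson finite le_trans)
      then have "\<not> {..k} \<subseteq> (\<lambda>c. bad (x $ c)) ` T"
        using card_mono[of "(\<lambda>c. bad (x $ c)) ` T" "{..k}"] by auto
      then obtain i where i: "i \<le> k" "\<And>c. c \<in> T \<Longrightarrow> i \<noteq> bad (x $ c)" by blast
      have "\<exists>A\<in>W i c. x $ c \<in> A" for c
      proof (cases "c \<in> T")
        case True
        then show ?thesis using J(4)[OF i(1) i(2)[OF True]] by (auto simp: W_def)
      next
        case False
        then show ?thesis using Z(2)[OF False] x[of c] by (auto simp: W_def)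
      qed
      then obtain h where "\<forall>c. h c \<in> W i c \<and> x $ c \<in> h c" by metis
      then show "x \<in> (\<Union>i\<le>k. \<Union> ((\<lambda>h. {x. \<forall>c. x $ c \<in> h c}) ` {h. \<forall>c. h c \<in> W i c}))"
        using i(1) by blast
    qed
  next
    fix i A and x y :: "real ^ 'n"
    assume "A \<in> (\<lambda>h. {x. \<forall>c. x $ c \<in> h c}) ` {h. \<forall>c. h c \<in> W i c}" "x \<in> A" "y \<in> A"
    then obtain h where h: "\<And>c. h c \<in> W i c" "\<And>c. x $ c \<in> h c" "\<And>c. y $ c \<in> h c" by auto
    have "dist x y \<le> (\<Sum>c\<in>UNIV. \<bar>x $ c - y $ c\<bar>)"
      using norm_le_l1_cart[of "x - y"] by (simp add: dist_norm)
    also have "\<dots> \<le> (\<Sum>c\<in>(UNIV::'n set). e)" by (intro sum_mono W_diam[OF h])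
    also have "\<dots> = \<epsilon>" by (simp add: e_def)
    finally show "dist x y \<le> \<epsilon>" .
  next
    fix i A B and x y :: "real ^ 'n"
    assume A: "A \<in> (\<lambda>h. {x. \<forall>c. x $ c \<in> h c}) ` {h. \<forall>c. h c \<in> W i c}" "x \<in> A"
      and B: "B \<in> (\<lambda>h. {x. \<forall>c. x $ c \<in> h c}) ` {h. \<forall>c. h c \<in> W i c}" "y \<in> B" and "A \<noteq> B"
    obtain h where h: "\<And>c. h c \<in> W i c" "\<And>c. x $ c \<in> h c" "A = {x. \<forall>c. x $ c \<in> h c}" using A by auto
    obtain g where g: "\<And>c. g c \<in> W i c" "\<And>c. y $ c \<in> g c" "B = {x. \<forall>c. x $ c \<in> g c}" using B by auto
    obtain c where c: "h c \<noteq> g c" using \<open>A \<noteq> B\<close> h(3) g(3) by auto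
    have "\<delta> \<le> \<bar>x $ c - y $ c\<bar>" using W_sep[OF h(1) g(1) c h(2) g(2)] .
    also have "\<dots> \<le> dist x y" using component_le_norm_cart[of "x - y" c] by (simp add: dist_norm)
    finally show "\<delta> \<le> dist x y" .
  qed
  then show thesis using that \<delta> by blast
qed

section \<open>Meager sets in the Cantor space\<close>

definition cylinder :: "(nat \<Rightarrow> bool) \<Rightarrow> nat \<Rightarrow> (nat \<Rightarrow> bool) set" where
  "cylinder y m = {z. \<forall>i<m. z i = y i}"

text \<open>The usual notion for the product topology, expressed through basic clopen sets.\<close>

definition cantor_nowhere_dense :: "(nat \<Rightarrow> bool) set \<Rightarrow> bool" where
  "cantor_nowhere_dense N \<longleftrightarrow> (\<forall>y m. \<exists>z n. cylinder z n \<subseteq> cylinder y m \<and> cylinder z n \<inter> N = {})"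

definition cantor_meager :: "(nat \<Rightarrow> bool) set set" where
  "cantor_meager = {A. \<exists>N :: nat \<Rightarrow> _. (\<forall>i. cantor_nowhere_dense (N i)) \<and> A \<subseteq> (\<Union>i. N i)}"

lemma self_in_cylinder [simp]: "y \<in> cylinder y m"
  by (simp add: cylinder_def)

lemma cylinder_mono: "z \<in> cylinder y m \<Longrightarrow> m \<le> n \<Longrightarrow> cylinder z n \<subseteq> cylinder y m"
  by (auto simp: cylinder_def)

lemma cantor_nowhere_dense_Un:
  assumes "cantor_nowhere_dense M" "cantor_nowhere_dense N"
  shows "cantor_nowhere_dense (M \<union> N)"
  unfolding cantor_nowhere_dense_def
proof (intro allI)
  fix y m
  obtain z n where z: "cylinder z n \<subseteq> cylinder y m" "cylinder z n \<inter> M = {}"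
    using assms(1) unfolding cantor_nowhere_dense_def by meson
  obtain w l where w: "cylinder w l \<subseteq> cylinder z n" "cylinder w l \<inter> N = {}"
    using assms(2) unfolding cantor_nowhere_dense_def by meson
  show "\<exists>z n. cylinder z n \<subseteq> cylinder y m \<and> cylinder z n \<inter> (M \<union> N) = {}"
    using z w by (intro exI[of _ w] exI[of _ l]) blast
qed

lemma cantor_nowhere_dense_empty: "cantor_nowhere_dense {}"
  by (auto simp: cantor_nowhere_dense_def)

lemma cantor_nowhere_dense_UN_finite:
  "finite I \<Longrightarrow> (\<And>i. i \<in> I \<Longrightarrow> cantor_nowhere_dense (N i)) \<Longrightarrow> cantor_nowhere_dense (\<Union>i\<in>I. N i)"
  by (induction I rule: finite_induct)
    (auto intro: cantor_nowhere_dense_Un cantor_nowhere_dense_empty)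

lemma cantor_meager_subset: "B \<in> cantor_meager \<Longrightarrow> A \<subseteq> B \<Longrightarrow> A \<in> cantor_meager"
  unfolding cantor_meager_def by blast

lemma cantor_meager_UN:
  assumes "\<And>i :: nat. A i \<in> cantor_meager"
  shows "(\<Union>i. A i) \<in> cantor_meager"
proof -
  have "\<forall>i. \<exists>N :: nat \<Rightarrow> _. (\<forall>j. cantor_nowhere_dense (N j)) \<and> A i \<subseteq> (\<Union>j. N j)"
    using assms unfolding cantor_meager_def by blast
  then obtain N :: "nat \<Rightarrow> nat \<Rightarrow> _" where N: "\<And>i j. cantor_nowhere_dense (N i j)" "\<And>i. A i \<subseteq> (\<Union>j. N i j)"
    by metis
  have "(\<Union>i. A i) \<subseteq> (\<Union>p. case prod_decode p of (i, j) \<Rightarrow> N i j)"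
  proof
    fix y assume "y \<in> (\<Union>i. A i)"
    then obtain i j where "y \<in> N i j" using N(2) by blast
    then show "y \<in> (\<Union>p. case prod_decode p of (i, j) \<Rightarrow> N i j)"
      by (intro UN_I[of "prod_encode (i, j)"]) auto
  qed
  then show ?thesis
    unfolding cantor_meager_def using N(1)
    by (intro CollectI exI[of _ "\<lambda>p. case prod_decode p of (i, j) \<Rightarrow> N i j"]) (auto split: prod.splits)
qed

text \<open>The pattern \<open>s\<close> must work after every prefix of length \<open>a\<close>.
  There are finitely many, so they are handled one at a time, each step prolonging the pattern found
  so far.\<close>

lemma cantor_nowhere_dense_block:
  assumes N: "cantor_nowhere_dense N"
  shows "\<exists>b>a. \<exists>s. \<forall>y. (\<forall>i\<in>{a..<b}. y i = s i) \<longrightarrow> y \<notin> N"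
proof -
  \<comment> \<open>The prefixes of length \<open>a\<close>, each represented by its extension with
    zeros.\<close>
  define F where "F = {p :: nat \<Rightarrow> bool. \<forall>i\<ge>a. \<not> p i}"
  have "F \<subseteq> (\<lambda>S i. i \<in> S) ` Pow {..<a}"
  proof
    fix p assume "p \<in> F"
    then have "p = (\<lambda>i. i \<in> {i. p i})" "{i. p i} \<in> Pow {..<a}"
      by (auto simp: F_def not_less[symmetric])
    then show "p \<in> (\<lambda>S i. i \<in> S) ` Pow {..<a}" by blast
  qed
  then have "finite F" by (rule finite_subset) simp
  then have "\<exists>b\<ge>a. \<exists>s. \<forall>p\<in>F. \<forall>y. (\<forall>i<a. y i = p i) \<and> (\<forall>i\<in>{a..<b}. y i = s i) \<longrightarrow> y \<notin> N"
  proof (induction F rule: finite_induct)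
    case empty
    then show ?case by auto
  next
    case (insert p F)
    obtain b s where b: "b \<ge> a"
      and s: "\<forall>p\<in>F. \<forall>y. (\<forall>i<a. y i = p i) \<and> (\<forall>i\<in>{a..<b}. y i = s i) \<longrightarrow> y \<notin> N"
      using insert.IH by (elim exE conjE)
    define w where "w i = (if i < a then p i else s i)" for i
    obtain z n where z: "cylinder z n \<subseteq> cylinder w b" "cylinder z n \<inter> N = {}"
      using N unfolding cantor_nowhere_dense_def by meson
    \<comment> \<open>The new pattern agrees with the old one on \<open>{a..<b}\<close>, so the
      prefixes already treated remain settled.\<close>
    have zw: "z i = w i" if "i < b" for i
      using z(1) self_in_cylinder[of z n] that by (auto simp: cylinder_def)
    show ?case
    proof (intro exI[of _ "max b n"] conjI exI[of _ z] ballI allI impI)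
      show "a \<le> max b n" using b by simp
      fix q y assume q: "q \<in> insert p F" and y: "(\<forall>i<a. y i = q i) \<and> (\<forall>i\<in>{a..<max b n}. y i = z i)"
      show "y \<notin> N"
      proof (cases "q = p")
        case True
        have "y i = z i" if "i < n" for i
          using y zw[of i] that b True by (cases "i < a") (auto simp: w_def)
        then show ?thesis using z(2) by (auto simp: cylinder_def)
      next
        case False
        moreover have "y i = s i" if "i \<in> {a..<b}" for i
          using y zw[of i] that by (auto simp: w_def)
        ultimately show ?thesis using s[rule_format, of q y] q y by simp
      qed
    qed
  qed
  then obtain b s where b: "b \<ge> a"
    and s: "\<forall>p\<in>F. \<forall>y. (\<forall>i<a. y i = p i) \<and> (\<forall>i\<in>{a..<b}. y i = s i) \<longrightarrow> y \<notin> N"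
    by (elim exE conjE)
  \<comment> \<open>\<open>Suc b\<close> in place of \<open>b\<close> makes the block nonempty even
    when \<open>b = a\<close>.\<close>
  have "y \<notin> N" if "\<forall>i\<in>{a..<Suc b}. y i = s i" for y
    using that by (intro s[rule_format, of "\<lambda>i. i < a \<and> y i" y]) (auto simp: F_def)
  then show ?thesis using b by (intro exI[of _ "Suc b"]) auto
qed

text \<open>The description of meager sets by a chopped real. The pattern on block \<open>j\<close>
  forces a point out of the first \<open>j + 1\<close> nowhere dense sets whatever precedes it, so
  matching \<open>x\<close> on infinitely many blocks means leaving all of them.\<close>

lemma cantor_meager_blocks:
  assumes "B \<in> cantor_meager"
  obtains x and a :: "nat \<Rightarrow> nat" where "strict_mono a"
    "\<And>y. \<exists>\<^sub>\<infinity>j. \<forall>i\<in>{a j..<a (Suc j)}. y i = x i \<Longrightarrow> y \<notin> B"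
proof -
  obtain N :: "nat \<Rightarrow> _" where N: "\<And>i. cantor_nowhere_dense (N i)" "B \<subseteq> (\<Union>i. N i)"
    using assms unfolding cantor_meager_def by blast
  have nd: "cantor_nowhere_dense (\<Union>i\<le>j. N i)" for j
    using N(1) by (intro cantor_nowhere_dense_UN_finite) auto
  define P where "P j a b s \<longleftrightarrow> a < b \<and> (\<forall>y. (\<forall>i\<in>{a..<b}. y i = s i) \<longrightarrow> y \<notin> (\<Union>i\<le>j. N i))" for j a b s
  have "\<exists>b s. P j a b s" for j a
    using cantor_nowhere_dense_block[OF nd[of j], of a] unfolding P_def by (elim exE conjE) (intro exI conjI)
  then obtain b s where bs: "\<And>j a. P j a (b j a) (s j a)"
    by metis
  then have b: "a < b j a" for j a by (simp add: P_def)
  have s: "y \<notin> (\<Union>i\<le>j. N i)" if "\<And>i. i \<in> {a..<b j a} \<Longrightarrow> y i = s j a i" for j a y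
    using bs[of j a] that by (simp add: P_def)
  define a where "a = rec_nat 0 b"
  have a: "a (Suc j) = b j (a j)" for j by (simp add: a_def)
  then have mono: "strict_mono a" using b by (simp add: strict_mono_Suc_iff)
  define x where "x i \<longleftrightarrow> (\<exists>j. i \<in> {a j..<a (Suc j)} \<and> s j (a j) i)" for i
  have unique: "j = j'" if "i \<in> {a j..<a (Suc j)}" "i \<in> {a j'..<a (Suc j')}" for i j j'
  proof (rule ccontr)
    assume "j \<noteq> j'"
    then have "Suc j \<le> j' \<or> Suc j' \<le> j" by auto
    then have "a (Suc j) \<le> a j' \<or> a (Suc j') \<le> a j" using strict_mono_less_eq[OF mono] by blast
    then show False using that by auto
  qed
  have xs: "x i = s j (a j) i" if "i \<in> {a j..<a (Suc j)}" for i j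
    using that unique unfolding x_def by blast
  show thesis
  proof (rule that[OF mono])
    fix y assume y: "\<exists>\<^sub>\<infinity>j. \<forall>i\<in>{a j..<a (Suc j)}. y i = x i"
    show "y \<notin> B"
    proof
      assume "y \<in> B"
      then obtain l where l: "y \<in> N l" using N(2) by blast
      obtain j where j: "l < j" "\<forall>i\<in>{a j..<a (Suc j)}. y i = x i"
        using y unfolding INFM_nat by blast
      then have "y \<notin> (\<Union>i\<le>j. N i)" using xs a by (intro s[of "a j"]) auto
      then show False using l j(1) by auto
    qed
  qed
qed

section \<open>Coding coverings by points of the Cantor space\<close>

text \<open>
  A point \<open>y\<close> is read through the pairs \<open>(m, e)\<close> of consecutive ones: such a pair announces the set \<open>Gen e\<close>.
  Its mesh must be small against \<open>(1/4)\<^sup>m\<close>, which bounds the gaps of everything announced up to \<open>m\<close>, and its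
  gaps must be at least \<open>(1/4)\<^sup>e\<close>. The condition \<open>Suc m < e\<close> ensures that a run of ones announces nothing.
\<close>

definition consecutive :: "(nat \<Rightarrow> bool) \<Rightarrow> nat \<Rightarrow> nat \<Rightarrow> bool" where
  "consecutive y m e \<longleftrightarrow> m < e \<and> y m \<and> y e \<and> (\<forall>i. m < i \<and> i < e \<longrightarrow> \<not> y i)"

definition valid_code :: "nat \<Rightarrow> (nat \<Rightarrow> 'a::metric_space set) \<Rightarrow> nat \<Rightarrow> nat \<Rightarrow> bool" where
  "valid_code k Gen m e \<longleftrightarrow> Suc m < e \<and> sep_cover k ((1/4) ^ m / 2) ((1/4) ^ e) (Gen e)"

definition decode :: "nat \<Rightarrow> (nat \<Rightarrow> 'a::metric_space set) \<Rightarrow> (nat \<Rightarrow> bool) \<Rightarrow> nat \<Rightarrow> nat \<Rightarrow> 'a set" where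
  "decode k Gen y a b = \<Union>{Gen e | m e. a \<le> m \<and> e \<le> b \<and> consecutive y m e \<and> valid_code k Gen m e}"

text \<open>Induction along the positions where \<open>y\<close> has a one: the last announced set
  is merged with all that was decoded up to the preceding such position \<open>m\<close>. The gaps
  there are at least \<open>(1/4) ^ m\<close> and exceed the new mesh; the mesh bound is a
  telescoping sum.\<close>

lemma sep_cover_decode:
  assumes "y a" "y b" "a \<le> b"
  shows "sep_cover k (2 * ((1/4) ^ a - (1/4) ^ b)) ((1/4) ^ b) (decode k Gen y a b)"
  using assms(2,3)
proof (induction b rule: less_induct)
  case (less e)
  show ?case
  proof (cases "e = a")
    case True
    then have "decode k Gen y a e = {}" by (auto simp: decode_def consecutive_def)
    then show ?thesis by (simp add: sep_cover_empty)
  next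
    case False
    then have "a < e" using less.prems by simp
    define m where "m = Max {i. a \<le> i \<and> i < e \<and> y i}"
    have fin: "finite {i. a \<le> i \<and> i < e \<and> y i}" by (rule finite_subset[of _ "{..e}"]) auto
    have "m \<in> {i. a \<le> i \<and> i < e \<and> y i}"
      unfolding m_def using \<open>a < e\<close> assms(1) by (intro Max_in fin) auto
    then have m: "a \<le> m" "m < e" "y m" by auto
    have m_max: "i \<le> m" if "a \<le> i" "i < e" "y i" for i
      unfolding m_def using that by (intro Max_ge fin) auto
    have IH: "sep_cover k (2 * ((1/4) ^ a - (1/4) ^ m)) ((1/4) ^ m) (decode k Gen y a m)"
      using less.IH m by simp
    define G where "G = (if valid_code k Gen m e then Gen e else {})"
    have G: "sep_cover k ((1/4) ^ m / 2) ((1/4) ^ e) G"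
      by (simp add: G_def valid_code_def sep_cover_empty)
    have sub: "decode k Gen y a e \<subseteq> decode k Gen y a m \<union> G"
    proof
      fix x assume "x \<in> decode k Gen y a e"
      then obtain m' e' where *: "a \<le> m'" "e' \<le> e" "consecutive y m' e'" "valid_code k Gen m' e'" "x \<in> Gen e'"
        unfolding decode_def by blast
      show "x \<in> decode k Gen y a m \<union> G"
      proof (cases "e' = e")
        case True
        have "m' \<le> m" using m_max[of m'] * by (auto simp: consecutive_def)
        moreover have "\<not> m' < m" using * True m by (auto simp: consecutive_def)
        ultimately show ?thesis using * True by (auto simp: G_def)
      next
        case False
        then have "e' \<le> m" using m_max[of e'] * by (auto simp: consecutive_def)
        then show ?thesis using * unfolding decode_def by blast
      qed
    qed
    have pow: "(1/4 :: real) ^ e \<le> (1/4) ^ m / 4"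
      using power_decreasing[of "Suc m" e "1/4 :: real"] m(2) by simp
    have pow': "(1/4 :: real) ^ m \<le> (1/4) ^ a"
      using power_decreasing[of a m "1/4 :: real"] m(1) by simp
    have pos: "0 < (1/4 :: real) ^ e" by simp
    \<comment> \<open>The origin of the base 4: from \<open>(1/4) ^ e \<le> (1/4) ^ m / 4\<close>
      follow the gap condition \<open>2 * (1/4) ^ e + (1/4) ^ m / 2 \<le> (1/4) ^ m\<close> and the
      bound of the new mesh by \<open>2 * ((1/4) ^ a - (1/4) ^ e)\<close>. Both are equalities for
      \<open>e = m + 1\<close>.\<close>
    have "sep_cover k (2 * ((1/4) ^ a - (1/4) ^ m) + 2 * ((1/4) ^ m / 2) + 2 * (1/4) ^ e) ((1/4) ^ e)
      (decode k Gen y a m \<union> G)"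
      by (rule sep_cover_Un[OF IH G]) (use pow pow' pos in auto)
    then show ?thesis
      by (rule sep_cover_mono[OF _ sub]) (use pow in auto)
  qed
qed

lemma compact_decode:
  fixes Gen :: "nat \<Rightarrow> 'a::metric_space set"
  assumes "\<And>e. compact (Gen e)"
  shows "compact (decode k Gen y a b)"
proof -
  have "decode k Gen y a b =
    (\<Union>e\<in>{e. e \<le> b \<and> (\<exists>m. a \<le> m \<and> consecutive y m e \<and> valid_code k Gen m e)}. Gen e)"
    unfolding decode_def by blast
  then show ?thesis using assms by (simp add: compact_UN)
qed

text \<open>Up to a small enlargement a compact set is a finite union of balls of one radius
  \<open>1 / Suc i\<close> with centres in a countable dense set, so countably many sets suffice.
  The second component of the decoded pair is free, which gives each of them arbitrarily large
  codes.\<close>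

lemma universal_codes:
  obtains Gen :: "nat \<Rightarrow> 'a::euclidean_space set"
  where "\<And>e. compact (Gen e)"
    "\<And>K k \<epsilon> \<delta> \<epsilon>' n. compact K \<Longrightarrow> sep_cover k \<epsilon> \<delta> K \<Longrightarrow> 0 < \<delta> \<Longrightarrow> \<epsilon> < \<epsilon>' \<Longrightarrow>
       \<exists>e\<ge>n. K \<subseteq> Gen e \<and> sep_cover k \<epsilon>' (\<delta> / 2) (Gen e)"
proof -
  obtain D :: "'a set" where D: "countable D" "\<And>X. open X \<Longrightarrow> X \<noteq> {} \<Longrightarrow> \<exists>d\<in>D. d \<in> X"
    by (rule countable_dense_setE) blast
  define balls where "balls = (\<lambda>(F :: 'a set, i :: nat). \<Union>p\<in>F. cball p (1 / Suc i))"
  define \<G> :: "'a set set" where "\<G> = balls ` ({F. finite F \<and> F \<subseteq> D} \<times> UNIV)"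
  have "countable {F. finite F \<and> F \<subseteq> D}"
    using countable_Collect_finite_subset[OF D(1)] by (simp add: conj_commute)
  then have "countable \<G>" unfolding \<G>_def by auto
  have "\<G> \<noteq> {}" by (auto simp: \<G>_def)
  have comp: "compact G" if "G \<in> \<G>" for G
    using that by (auto simp: \<G>_def balls_def intro!: compact_UN)
  define Gen where "Gen e = from_nat_into \<G> (fst (prod_decode e))" for e
  show thesis
  proof (rule that[of Gen])
    show "compact (Gen e)" for e
      unfolding Gen_def by (intro comp from_nat_into \<open>\<G> \<noteq> {}\<close>)
    fix K :: "'a set" and k \<epsilon> \<delta> \<epsilon>' and n :: nat
    assume K: "compact K" and sep: "sep_cover k \<epsilon> \<delta> K" and pos: "0 < \<delta>" "\<epsilon> < \<epsilon>'"
    have "0 < min ((\<epsilon>' - \<epsilon>) / 4) (\<delta> / 8)" using pos by simp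
    then obtain i where i: "1 / Suc i < min ((\<epsilon>' - \<epsilon>) / 4) (\<delta> / 8)" using nat_approx_posE by blast
    define \<rho> where "\<rho> = 1 / real (Suc i)"
    \<comment> \<open>Thickening by \<open>2 * \<rho>\<close> costs \<open>4 * \<rho>\<close> both
      in the mesh and in the gaps, and the loss in the gaps may be at most
      \<open>\<delta> / 2\<close>.\<close>
    have \<rho>: "0 < \<rho>" "4 * \<rho> \<le> \<epsilon>' - \<epsilon>" "8 * \<rho> \<le> \<delta>" using i by (auto simp: \<rho>_def)
    define D' where "D' = {p \<in> D. \<exists>x\<in>K. dist x p < \<rho>}"
    have "K \<subseteq> (\<Union>p\<in>D'. ball p \<rho>)"
    proof
      fix x assume x: "x \<in> K"
      obtain d where "d \<in> D" "d \<in> ball x \<rho>" using D(2)[of "ball x \<rho>"] \<rho>(1) by auto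
      then show "x \<in> (\<Union>p\<in>D'. ball p \<rho>)" using x by (auto simp: D'_def dist_commute)
    qed
    then obtain F where F: "F \<subseteq> D'" "finite F" "K \<subseteq> (\<Union>p\<in>F. ball p \<rho>)"
      using compactE_image[OF K, of D' "\<lambda>p. ball p \<rho>"] by auto
    define G where "G = balls (F, i)"
    have G: "G = (\<Union>p\<in>F. cball p \<rho>)" by (simp add: G_def balls_def \<rho>_def)
    have "G \<in> \<G>" unfolding G_def \<G>_def using F by (intro imageI) (auto simp: D'_def)
    then obtain j where j: "from_nat_into \<G> j = G"
      using from_nat_into_surj[OF \<open>countable \<G>\<close>] by blast
    define e where "e = prod_encode (j, n)"
    have e: "n \<le> e" "Gen e = G" unfolding e_def Gen_def using j by (simp_all add: le_prod_encode_2)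
    have "K \<subseteq> G" unfolding G using F(3) ball_subset_cball by (meson UN_mono order_trans subset_refl)
    moreover have "G \<subseteq> {y. \<exists>x\<in>K. dist x y \<le> 2 * \<rho>}"
    proof
      fix y assume "y \<in> G"
      then obtain p where p: "p \<in> F" "dist p y \<le> \<rho>" by (auto simp: G)
      then obtain x where x: "x \<in> K" "dist x p < \<rho>" using F(1) by (auto simp: D'_def)
      then have "dist x y \<le> 2 * \<rho>" using p(2) dist_triangle[of x y p] by linarith
      then show "y \<in> {y. \<exists>x\<in>K. dist x y \<le> 2 * \<rho>}" using x by blast
    qed
    then have "sep_cover k \<epsilon>' (\<delta> / 2) G"
      by (rule sep_cover_mono[OF sep_cover_thicken[OF sep, of "2 * \<rho>"]]) (use \<rho> in auto)
    ultimately show "\<exists>e\<ge>n. K \<subseteq> Gen e \<and> sep_cover k \<epsilon>' (\<delta> / 2) (Gen e)"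
      using e by (intro exI[of _ e]) simp
  qed
qed

definition no_guess :: "nat \<Rightarrow> (nat \<Rightarrow> 'a::metric_space set) \<Rightarrow> 'a set \<Rightarrow> (nat \<Rightarrow> bool) set" where
  "no_guess k Gen K = {y. \<forall>m e. consecutive y m e \<and> valid_code k Gen m e \<longrightarrow> \<not> K \<subseteq> Gen e}"

text \<open>Any prefix of length \<open>n\<close> can be continued by ones exactly at
  \<open>n\<close> and at a valid code \<open>e\<close> for \<open>K\<close>; the one at
  \<open>n\<close> detaches the announcement from the prefix.\<close>

lemma cantor_nowhere_dense_no_guess:
  assumes code: "\<And>m. \<exists>e. valid_code k Gen m e \<and> K \<subseteq> Gen e"
  shows "cantor_nowhere_dense (no_guess k Gen K)"
  unfolding cantor_nowhere_dense_def
proof (intro allI)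
  fix y :: "nat \<Rightarrow> bool" and n
  obtain e where e: "valid_code k Gen n e" "K \<subseteq> Gen e" using code by blast
  define z where "z i = (if i < n then y i else i = n \<or> i = e)" for i
  have me: "n < e" using e(1) by (simp add: valid_code_def)
  have "w \<notin> no_guess k Gen K" if "w \<in> cylinder z (Suc e)" for w
  proof -
    have "w i = z i" if "i \<le> e" for i using \<open>w \<in> cylinder z (Suc e)\<close> that by (simp add: cylinder_def)
    then have "consecutive w n e"
      using me by (auto simp: consecutive_def z_def)
    then show ?thesis using e unfolding no_guess_def mem_Collect_eq by blast
  qed
  moreover have "cylinder z (Suc e) \<subseteq> cylinder y n"
    using me by (intro cylinder_mono) (auto simp: cylinder_def z_def)
  ultimately show "\<exists>z l. cylinder z l \<subseteq> cylinder y n \<and> cylinder z l \<inter> no_guess k Gen K = {}"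
    by blast
qed

text \<open>
  If the guesses failed in infinitely many blocks, the point that agrees with \<open>x\<close> on a sparse infinite set
  of those blocks and is constantly one elsewhere would never guess \<open>K\<close>, although it lies outside \<open>B\<close>.
\<close>

lemma blocks_guess:
  assumes "strict_mono a" and x: "\<And>y. \<exists>\<^sub>\<infinity>j. \<forall>i\<in>{a j..<a (Suc j)}. y i = x i \<Longrightarrow> y \<notin> B"
    and K: "no_guess k Gen K \<subseteq> B"
  shows "\<exists>j0\<ge>1. \<forall>j\<ge>j0. K \<subseteq> decode k Gen (\<lambda>i. i = a j - 1 \<or> i = a (Suc j) \<or> (a j \<le> i \<and> i < a (Suc j) \<and> x i))
    (a j - 1) (a (Suc j))"
proof (rule ccontr)
  define Y where "Y j = (\<lambda>i. i = a j - 1 \<or> i = a (Suc j) \<or> (a j \<le> i \<and> i < a (Suc j) \<and> x i))" for j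
  \<comment> \<open>For \<open>1 \<le> j\<close> the position \<open>a j - 1\<close> really precedes
    the block.\<close>
  define bad where "bad j \<longleftrightarrow> 1 \<le> j \<and> \<not> K \<subseteq> decode k Gen (Y j) (a j - 1) (a (Suc j))" for j
  assume "\<not> ?thesis"
  then have *: "\<exists>j\<ge>j0. bad j" if "1 \<le> j0" for j0
    using that unfolding Y_def bad_def by (meson le_trans)
  have ex: "\<exists>j>n. bad j" for n using *[of "Suc n"] by (auto simp: Suc_le_eq)
  define nxt where "nxt n = (SOME j. n < j \<and> bad j)" for n
  have nxt: "n < nxt n" "bad (nxt n)" for n
    using someI_ex[OF ex[of n]] by (auto simp: nxt_def)
  \<comment> \<open>The chosen blocks are pairwise non-adjacent, so the positions just before and
    just after each of them lie outside the others and carry ones, as in \<open>Y\<close>.\<close>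
  define g where "g = rec_nat (nxt 0) (\<lambda>_ r. nxt (Suc r))"
  have g: "g (Suc i) = nxt (Suc (g i))" "g 0 = nxt 0" for i by (simp_all add: g_def)
  have g_bad: "bad (g i)" for i using nxt g by (cases i) auto
  have g_gap: "Suc (g i) < g (Suc i)" for i using nxt(1)[of "Suc (g i)"] g by simp
  then have g_mono: "strict_mono g" by (metis strict_mono_Suc_iff less_trans lessI)
  have a_mono: "a i \<le> a j \<longleftrightarrow> i \<le> j" "a i < a j \<longleftrightarrow> i < j" for i j
    using strict_mono_less_eq[OF assms(1)] strict_mono_less[OF assms(1)] by auto
  define J where "J = range g"
  have J_gap: "Suc j < j'" if jJ: "j \<in> J" "j' \<in> J" "j < j'" for j j'
  proof -
    obtain i i' where i: "j = g i" "j' = g i'" using jJ unfolding J_def by blast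
    then have "Suc i \<le> i'" using jJ(3) strict_mono_less[OF g_mono] by auto
    then have "g (Suc i) \<le> g i'" using strict_mono_less_eq[OF g_mono] by auto
    then show ?thesis using g_gap[of i] i by linarith
  qed
  define y where "y i = (\<forall>j\<in>J. i \<in> {a j..<a (Suc j)} \<longrightarrow> x i)" for i
  have y_block: "y i = x i" if "j \<in> J" "i \<in> {a j..<a (Suc j)}" for i j
  proof -
    have "j' = j" if "i \<in> {a j'..<a (Suc j')}" for j'
    proof (rule ccontr)
      assume "j' \<noteq> j"
      then have "Suc j \<le> j' \<or> Suc j' \<le> j" by auto
      then have "a (Suc j) \<le> a j' \<or> a (Suc j') \<le> a j" using a_mono by blast
      then show False using that \<open>i \<in> {a j..<a (Suc j)}\<close> by auto
    qed
    then show ?thesis using that unfolding y_def by blast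
  qed
  have "\<exists>\<^sub>\<infinity>j. \<forall>i\<in>{a j..<a (Suc j)}. y i = x i"
    unfolding INFM_nat
  proof
    fix n
    have "n \<le> g n" using g_mono by (rule strict_mono_imp_increasing)
    then have "n < g (Suc n)" using g_gap[of n] by linarith
    then show "\<exists>j>n. \<forall>i\<in>{a j..<a (Suc j)}. y i = x i"
      using y_block[of "g (Suc n)"] by (intro exI[of _ "g (Suc n)"]) (simp add: J_def)
  qed
  then have "y \<notin> B" by (rule x)
  moreover have "y \<in> no_guess k Gen K"
    unfolding no_guess_def
  proof (intro CollectI allI impI, elim conjE)
    fix m e assume me: "consecutive y m e" "valid_code k Gen m e"
    \<comment> \<open>A valid code leaves room for a zero right after \<open>m\<close>, and
      \<open>y\<close> has zeros only inside chosen blocks. The announcement is thereby located in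
      one block together with its two flanking ones.\<close>
    then have "Suc m < e" "\<not> y (Suc m)" by (auto simp: valid_code_def consecutive_def)
    then obtain j where j: "j \<in> J" "a j \<le> Suc m" "Suc m < a (Suc j)" unfolding y_def by auto
    have "bad j" using j(1) g_bad by (auto simp: J_def)
    then have "1 \<le> j" by (simp add: bad_def)
    then have "0 < a j" using a_mono(2)[of 0 j] by linarith
    have y_out: "y i" if i: "i = a j - 1 \<or> i = a (Suc j)" for i
      unfolding y_def
    proof (intro ballI impI)
      fix j' assume j': "j' \<in> J" "i \<in> {a j'..<a (Suc j')}"
      have "j' \<noteq> j" using j'(2) i \<open>0 < a j\<close> by auto
      then consider "Suc j < j'" | "Suc j' < j" using J_gap[of j j'] J_gap[of j' j] j j'(1) by linarith
      then have False
      proof cases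
        case 1
        then have "a (Suc j) < a j'" using a_mono by blast
        moreover have "a j < a (Suc j)" using a_mono by blast
        ultimately show ?thesis using i j'(2) by auto
      next
        case 2
        then have "a (Suc j') < a j" using a_mono by blast
        moreover have "a j < a (Suc j)" using a_mono by blast
        ultimately show ?thesis using i j'(2) by auto
      qed
      then show "x i" ..
    qed
    have "e \<le> a (Suc j)"
    proof (rule ccontr)
      assume "\<not> e \<le> a (Suc j)"
      then show False using me(1) y_out[of "a (Suc j)"] j(3) by (auto simp: consecutive_def)
    qed
    have "a j - 1 \<le> m" using j(2) by simp
    have Yy: "Y j i = y i" if "a j - 1 \<le> i" "i \<le> a (Suc j)" for i
    proof (cases "i = a j - 1 \<or> i = a (Suc j)")
      case True
      then show ?thesis using y_out by (auto simp: Y_def)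
    next
      case False
      then have "i \<in> {a j..<a (Suc j)}" using that by auto
      then show ?thesis using y_block[OF j(1)] False by (auto simp: Y_def)
    qed
    have "consecutive (Y j) m e"
      using me(1) Yy \<open>a j - 1 \<le> m\<close> \<open>e \<le> a (Suc j)\<close> by (auto simp: consecutive_def)
    then have "Gen e \<subseteq> decode k Gen (Y j) (a j - 1) (a (Suc j))"
      unfolding decode_def using me(2) \<open>a j - 1 \<le> m\<close> \<open>e \<le> a (Suc j)\<close> by blast
    then show "\<not> K \<subseteq> Gen e" using \<open>bad j\<close> unfolding bad_def by blast
  qed
  ultimately show False using K by blast
qed

section \<open>Reduction of the dimension ideal to the meager ideal of the Cantor space\<close>

lemma sigma_closed_dim_compacts:
  fixes A :: "'a::euclidean_space set"
  assumes "A \<in> sigma_closed_dim k"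
  obtains K :: "nat \<Rightarrow> 'a set" where "\<And>i. compact (K i)" "\<And>i. covering_dim_le (top_of_set (K i)) k"
    "A \<subseteq> (\<Union>i. K i)"
proof -
  obtain \<C> where \<C>: "countable \<C>" "\<And>C. C \<in> \<C> \<Longrightarrow> closed C"
    "\<And>C. C \<in> \<C> \<Longrightarrow> covering_dim_le (top_of_set C) k" "A \<subseteq> \<Union>\<C>"
    using assms unfolding sigma_closed_dim_def by blast
  \<comment> \<open>The empty set is added so that the collection can be enumerated even when
    \<open>\<C>\<close> is empty.\<close>
  define \<K> where "\<K> = insert {} ((\<lambda>(C, n :: nat). C \<inter> cball 0 (real n)) ` (\<C> \<times> UNIV))"
  have "countable \<K>" using \<C>(1) by (auto simp: \<K>_def)
  have "\<K> \<noteq> {}" by (auto simp: \<K>_def)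
  have *: "compact K \<and> covering_dim_le (top_of_set K) k" if inK: "K \<in> \<K>" for K
  proof (cases "K = {}")
    case True
    have "\<exists>\<delta>>0. sep_cover k \<epsilon> \<delta> ({} :: 'a set)" for \<epsilon>
      by (intro exI[of _ 1]) (simp add: sep_cover_empty)
    then show ?thesis using True sep_cover_imp_covering_dim[of "{} :: 'a set" k] by auto
  next
    case False
    then obtain C n where C: "C \<in> \<C>" "K = C \<inter> cball 0 (real n)" using inK False by (auto simp: \<K>_def)
    then have "compact K" using \<C>(2) by (simp add: closed_Int_compact)
    then show ?thesis
      using covering_dim_le_closed_subset[OF \<C>(3)[OF C(1)], of K] C(2) by (auto simp: compact_imp_closed)
  qed
  have "A \<subseteq> \<Union>\<K>"
  proof
    fix x assume "x \<in> A"
    then obtain C where C: "C \<in> \<C>" "x \<in> C" using \<C>(4) by blast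
    obtain n :: nat where "norm x \<le> n" using real_arch_simple by blast
    then have "x \<in> C \<inter> cball 0 (real n)" using C by simp
    then show "x \<in> \<Union>\<K>" using C(1) unfolding \<K>_def by force
  qed
  also have "\<Union>\<K> = (\<Union>i. from_nat_into \<K> i)"
    using range_from_nat_into[OF \<open>\<K> \<noteq> {}\<close> \<open>countable \<K>\<close>] by simp
  finally show thesis
    using * from_nat_into[OF \<open>\<K> \<noteq> {}\<close>] by (intro that[of "from_nat_into \<K>"]) auto
qed

lemma sigma_closed_dimI:
  fixes K :: "nat \<Rightarrow> 'a::euclidean_space set"
  assumes "\<And>i. compact (K i)" "\<And>i \<epsilon>. 0 < \<epsilon> \<Longrightarrow> \<exists>\<delta>>0. sep_cover k \<epsilon> \<delta> (K i)" "A \<subseteq> (\<Union>i. K i)"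
  shows "A \<in> sigma_closed_dim k"
  unfolding sigma_closed_dim_def
  using assms sep_cover_imp_covering_dim[OF assms(1,2)]
  by (intro CollectI exI[of _ "range K"]) (auto simp: compact_imp_closed)

text \<open>\<open>\<phi> A\<close> consists of the points that never guess some compact piece of
  \<open>A\<close>, and \<open>\<psi> B\<close> is the lower limit of the sets decoded from the
  blocks of \<open>B\<close>. A tail intersection lies in every later decoded set and so inherits
  separated coverings of arbitrarily small mesh.\<close>

lemma sigma_closed_dim_tukey_cantor:
  obtains \<phi> \<psi> where "tukey \<phi> \<psi> (sigma_closed_dim k :: 'a::euclidean_space set set) cantor_meager"
proof -
  obtain Gen :: "nat \<Rightarrow> 'a set" where Gen: "\<And>e. compact (Gen e)"
    "\<And>K k \<epsilon> \<delta> \<epsilon>' n. compact K \<Longrightarrow> sep_cover k \<epsilon> \<delta> K \<Longrightarrow> 0 < \<delta> \<Longrightarrow> \<epsilon> < \<epsilon>' \<Longrightarrow>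
       \<exists>e\<ge>n. K \<subseteq> Gen e \<and> sep_cover k \<epsilon>' (\<delta> / 2) (Gen e)"
    by (rule universal_codes) blast
  have code: "\<exists>e. valid_code k Gen m e \<and> K \<subseteq> Gen e"
    if K: "compact K" "covering_dim_le (top_of_set K) k" for K m
  proof -
    \<comment> \<open>Half of the admissible mesh \<open>(1/4) ^ m / 2\<close> is kept back for the
      enlargement of \<open>K\<close> to some \<open>Gen e\<close>. Then \<open>e\<close> is taken
      so large that \<open>(1/4) ^ e\<close> is below the remaining gaps
      \<open>\<delta> / 2\<close>, and at least \<open>m + 2\<close>.\<close>
    have "0 < (1/4 :: real) ^ m / 4" by simp
    then obtain \<delta> where \<delta>: "0 < \<delta>" "sep_cover k ((1/4) ^ m / 4) \<delta> K"
      using covering_dim_imp_sep_cover[OF K] by blast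
    obtain n where n: "(1/4 :: real) ^ n < \<delta> / 2"
      using real_arch_pow_inv[of "\<delta> / 2" "1/4"] \<delta>(1) by auto
    obtain e where e: "max n (m + 2) \<le> e" "K \<subseteq> Gen e" "sep_cover k ((1/4) ^ m / 2) (\<delta> / 2) (Gen e)"
      using Gen(2)[OF K(1) \<delta>(2,1), of "(1/4) ^ m / 2" "max n (m + 2)"] by auto
    have "(1/4 :: real) ^ e \<le> (1/4) ^ n" using e(1) by (intro power_decreasing) auto
    then have "sep_cover k ((1/4) ^ m / 2) ((1/4) ^ e) (Gen e)"
      using n by (intro sep_cover_mono[OF e(3)] order_refl) linarith
    then show ?thesis using e by (intro exI[of _ e]) (simp add: valid_code_def)
  qed
  have "\<exists>K :: nat \<Rightarrow> 'a set. A \<in> sigma_closed_dim k \<longrightarrow>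
    (\<forall>i. compact (K i) \<and> covering_dim_le (top_of_set (K i)) k) \<and> A \<subseteq> (\<Union>i. K i)" for A
    using sigma_closed_dim_compacts[of A k] by metis
  then obtain K :: "'a set \<Rightarrow> nat \<Rightarrow> 'a set" where K: "\<And>A i. A \<in> sigma_closed_dim k \<Longrightarrow> compact (K A i)"
    "\<And>A i. A \<in> sigma_closed_dim k \<Longrightarrow> covering_dim_le (top_of_set (K A i)) k"
    "\<And>A. A \<in> sigma_closed_dim k \<Longrightarrow> A \<subseteq> (\<Union>i. K A i)"
    by metis
  define \<phi> where "\<phi> A = (\<Union>i. no_guess k Gen (K A i))" for A
  define blocks where "blocks B x a \<longleftrightarrow> strict_mono a \<and>
    (\<forall>y. (\<exists>\<^sub>\<infinity>j. \<forall>i\<in>{a j..<a (Suc j)}. y i = x i) \<longrightarrow> y \<notin> B)" for B and x :: "nat \<Rightarrow> bool" and a :: "nat \<Rightarrow> nat"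
  have "\<exists>x a. blocks B x a" if "B \<in> cantor_meager" for B
    by (rule cantor_meager_blocks[OF that]) (auto simp: blocks_def)
  then obtain x a where xa: "\<And>B. B \<in> cantor_meager \<Longrightarrow> blocks B (x B) (a B)"
    by metis
  have a: "strict_mono (a B)" if "B \<in> cantor_meager" for B
    using xa[OF that] by (simp add: blocks_def)
  have x: "y \<notin> B" if "B \<in> cantor_meager" "\<exists>\<^sub>\<infinity>j. \<forall>i\<in>{a B j..<a B (Suc j)}. y i = x B i" for B y
    using xa[OF that(1)] that(2) by (simp add: blocks_def)
  define Y where "Y B j = (\<lambda>i. i = a B j - 1 \<or> i = a B (Suc j) \<or> (a B j \<le> i \<and> i < a B (Suc j) \<and> x B i))" for B j
  define X where "X B j = decode k Gen (Y B j) (a B j - 1) (a B (Suc j))" for B j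
  define \<psi> where "\<psi> B = (\<Union>j0. \<Inter>j\<in>{j0..}. X B j)" for B
  have "tukey \<phi> \<psi> (sigma_closed_dim k) cantor_meager"
    unfolding tukey_def
  proof (intro conjI ballI impI)
    fix A :: "'a set" assume A: "A \<in> sigma_closed_dim k"
    show "\<phi> A \<in> cantor_meager"
      unfolding cantor_meager_def \<phi>_def
      using cantor_nowhere_dense_no_guess[OF code[OF K(1,2)[OF A]]]
      by (intro CollectI exI[of _ "\<lambda>i. no_guess k Gen (K A i)"]) auto
    fix B assume B: "B \<in> cantor_meager" and sub: "\<phi> A \<subseteq> B"
    have "K A i \<subseteq> \<psi> B" for i
    proof -
      have "no_guess k Gen (K A i) \<subseteq> B" using sub by (auto simp: \<phi>_def)
      then obtain j0 where "\<forall>j\<ge>j0. K A i \<subseteq> X B j"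
        using blocks_guess[where a = "a B" and x = "x B" and B = B and k = k and Gen = Gen and K = "K A i"]
          a[OF B] x[OF B] unfolding X_def Y_def by blast
      then have "K A i \<subseteq> (\<Inter>j\<in>{j0..}. X B j)" by (simp add: le_INF_iff)
      then show ?thesis unfolding \<psi>_def by blast
    qed
    then show "A \<subseteq> \<psi> B" using K(3)[OF A] by blast
  next
    fix B assume B: "B \<in> cantor_meager"
    have compX: "compact (X B j)" for j
      unfolding X_def by (rule compact_decode) (rule Gen(1))
    have sepX: "sep_cover k (2 * (1/4) ^ (a B j - 1)) ((1/4) ^ a B (Suc j)) (X B j)" for j
    proof -
      have "a B j < a B (Suc j)" using a[OF B] by (simp add: strict_mono_Suc_iff)
      then have "sep_cover k (2 * ((1/4) ^ (a B j - 1) - (1/4) ^ a B (Suc j))) ((1/4) ^ a B (Suc j)) (X B j)"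
        unfolding X_def by (intro sep_cover_decode) (auto simp: Y_def)
      then show ?thesis by (rule sep_cover_mono) auto
    qed
    show "\<psi> B \<in> sigma_closed_dim k"
    proof (rule sigma_closed_dimI[where K = "\<lambda>j0. \<Inter>j\<in>{j0..}. X B j"])
      show "compact (\<Inter>j\<in>{j0..}. X B j)" for j0
        using compX by (intro compact_Inter) auto
      show "\<psi> B \<subseteq> (\<Union>j0. \<Inter>j\<in>{j0..}. X B j)" by (simp add: \<psi>_def)
      fix j0 and \<epsilon> :: real assume "0 < \<epsilon>"
      then obtain n where n: "(1/4 :: real) ^ n < \<epsilon> / 2"
        using real_arch_pow_inv[of "\<epsilon> / 2" "1/4"] by auto
      define j where "j = max j0 (Suc n)"
      have "j \<le> a B j" using a[OF B] by (rule strict_mono_imp_increasing)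
      then have "Suc n \<le> a B j" by (simp add: j_def)
      then have "n \<le> a B j - 1" by linarith
      then have "(1/4 :: real) ^ (a B j - 1) \<le> (1/4) ^ n" by (intro power_decreasing) auto
      then have le: "2 * (1/4) ^ (a B j - 1) \<le> \<epsilon>" using n by linarith
      have "(\<Inter>j\<in>{j0..}. X B j) \<subseteq> X B j" by (rule INF_lower) (simp add: j_def)
      then have "sep_cover k \<epsilon> ((1/4) ^ a B (Suc j)) (\<Inter>j\<in>{j0..}. X B j)"
        by (rule sep_cover_mono[OF sepX[of j] _ order_refl le order_refl])
      then show "\<exists>\<delta>>0. sep_cover k \<epsilon> \<delta> (\<Inter>j\<in>{j0..}. X B j)"
        by (intro exI[of _ "(1/4) ^ a B (Suc j)"]) auto
    qed
  qed
  then show thesis by (rule that)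
qed

section \<open>Meager sets in Euclidean space\<close>

lemma nowhere_dense_iff:
  "nowhere_dense N \<longleftrightarrow> (\<forall>W. open W \<and> W \<noteq> {} \<longrightarrow> (\<exists>V. open V \<and> V \<noteq> {} \<and> V \<subseteq> W \<and> V \<inter> N = {}))"
proof
  assume N: "nowhere_dense N"
  show "\<forall>W. open W \<and> W \<noteq> {} \<longrightarrow> (\<exists>V. open V \<and> V \<noteq> {} \<and> V \<subseteq> W \<and> V \<inter> N = {})"
  proof (intro allI impI)
    fix W :: "'a set" assume W: "open W \<and> W \<noteq> {}"
    then have "\<not> W \<subseteq> closure N" using N interior_maximal[of W "closure N"] by (auto simp: nowhere_dense_def)
    then show "\<exists>V. open V \<and> V \<noteq> {} \<and> V \<subseteq> W \<and> V \<inter> N = {}"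
      using W closure_subset[of N] by (intro exI[of _ "W - closure N"]) auto
  qed
next
  assume *: "\<forall>W. open W \<and> W \<noteq> {} \<longrightarrow> (\<exists>V. open V \<and> V \<noteq> {} \<and> V \<subseteq> W \<and> V \<inter> N = {})"
  show "nowhere_dense N"
    unfolding nowhere_dense_def
  proof (rule ccontr)
    assume "interior (closure N) \<noteq> {}"
    then obtain V where V: "open V" "V \<noteq> {}" "V \<subseteq> interior (closure N)" "V \<inter> N = {}"
      using *[rule_format, of "interior (closure N)"] by auto
    then have "V \<inter> closure N = {}" by (simp add: open_Int_closure_eq_empty)
    then show False using V(2,3) interior_subset by blast
  qed
qed

lemma nowhere_dense_subset: "nowhere_dense N \<Longrightarrow> M \<subseteq> N \<Longrightarrow> nowhere_dense M"
  unfolding nowhere_dense_def by (metis closure_mono interior_mono subset_empty)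

lemma nowhere_dense_empty: "nowhere_dense {}"
  by (simp add: nowhere_dense_def)

lemma meager_iff: "A \<in> meager_sets \<longleftrightarrow> (\<exists>N :: nat \<Rightarrow> _. (\<forall>i. nowhere_dense (N i)) \<and> A \<subseteq> (\<Union>i. N i))"
proof
  assume "A \<in> meager_sets"
  then obtain \<N> where \<N>: "countable \<N>" "\<And>N. N \<in> \<N> \<Longrightarrow> nowhere_dense N" "A = \<Union>\<N>"
    unfolding meager_sets_def by blast
  have "range (from_nat_into (insert {} \<N>)) = insert {} \<N>"
    using \<N>(1) by (intro range_from_nat_into) auto
  moreover have "nowhere_dense (from_nat_into (insert {} \<N>) i)" for i
    using from_nat_into[of "insert {} \<N>" i] \<N>(2) nowhere_dense_empty by auto
  ultimately show "\<exists>N :: nat \<Rightarrow> _. (\<forall>i. nowhere_dense (N i)) \<and> A \<subseteq> (\<Union>i. N i)"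
    using \<N>(3) by (intro exI[of _ "from_nat_into (insert {} \<N>)"]) auto
next
  assume "\<exists>N :: nat \<Rightarrow> _. (\<forall>i. nowhere_dense (N i)) \<and> A \<subseteq> (\<Union>i. N i)"
  then obtain N :: "nat \<Rightarrow> _" where N: "\<And>i. nowhere_dense (N i)" "A \<subseteq> (\<Union>i. N i)" by blast
  show "A \<in> meager_sets"
    unfolding meager_sets_def
    using N nowhere_dense_subset[OF N(1), of "N i \<inter> A" for i]
    by (intro CollectI exI[of _ "range (\<lambda>i. N i \<inter> A)"]) auto
qed

lemma meager_subset: "B \<in> meager_sets \<Longrightarrow> A \<subseteq> B \<Longrightarrow> A \<in> meager_sets"
  unfolding meager_iff by (meson order_trans)

lemma nowhere_dense_imp_meager: "nowhere_dense N \<Longrightarrow> N \<in> meager_sets"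
  unfolding meager_iff by (intro exI[of _ "\<lambda>_. N"]) auto

lemma meager_UN_nat:
  assumes "\<And>i :: nat. A i \<in> meager_sets"
  shows "(\<Union>i. A i) \<in> meager_sets"
proof -
  have "\<exists>\<N>. countable \<N> \<and> (\<forall>N\<in>\<N>. nowhere_dense N) \<and> A i = \<Union>\<N>" for i
    using assms unfolding meager_sets_def by blast
  then obtain \<N> where "\<And>i. countable (\<N> i)" "\<And>i. \<forall>N\<in>\<N> i. nowhere_dense N" "\<And>i. A i = \<Union>(\<N> i)"
    by metis
  then show ?thesis
    unfolding meager_sets_def by (intro CollectI exI[of _ "\<Union>i. \<N> i"]) auto
qed

lemma meager_UN:
  assumes "countable I" "\<And>i. i \<in> I \<Longrightarrow> A i \<in> meager_sets"
  shows "(\<Union>i\<in>I. A i) \<in> meager_sets"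
proof (cases "I = {}")
  case True
  then show ?thesis using nowhere_dense_imp_meager[OF nowhere_dense_empty] by simp
next
  case False
  have "(\<Union>n. A (from_nat_into I n)) \<in> meager_sets"
    using from_nat_into[OF False] assms(2) by (intro meager_UN_nat) auto
  moreover have "(\<Union>n. A (from_nat_into I n)) = (\<Union>i\<in>I. A i)"
    using range_from_nat_into[OF False assms(1)] by (metis image_image)
  ultimately show ?thesis by simp
qed

lemma open_not_meager:
  fixes V :: "'a::euclidean_space set"
  assumes "open V" "V \<noteq> {}"
  shows "V \<notin> meager_sets"
proof
  assume "V \<in> meager_sets"
  then obtain N :: "nat \<Rightarrow> 'a set" where N: "\<And>i. nowhere_dense (N i)" "V \<subseteq> (\<Union>i. N i)"
    unfolding meager_iff by blast
  define \<G> where "\<G> = range (\<lambda>i. - closure (N i))"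
  have "UNIV \<subseteq> closure (\<Inter>\<G>)"
  proof (rule Baire)
    show "countable \<G>" by (simp add: \<G>_def)
    fix T assume "T \<in> \<G>"
    then obtain i where "T = - closure (N i)" by (auto simp: \<G>_def)
    then show "openin (top_of_set UNIV) T \<and> UNIV \<subseteq> closure T"
      using N(1)[of i] by (simp add: nowhere_dense_def closure_complement open_Compl)
  qed simp
  then have "V \<inter> closure (\<Inter>\<G>) \<noteq> {}" using assms by auto
  then have "V \<inter> \<Inter>\<G> \<noteq> {}" using open_Int_closure_eq_empty[OF assms(1), of "\<Inter>\<G>"] by simp
  then obtain x where x: "x \<in> V" "x \<in> \<Inter>\<G>" by blast
  then obtain i where "x \<in> N i" using N(2) by blast
  then have "x \<in> closure (N i)" using closure_subset by blast
  then show False using x(2) by (simp add: \<G>_def)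
qed

section \<open>Binary expansion and the transfer between the Cantor space and Euclidean
  space\<close>

definition bin :: "(nat \<Rightarrow> bool) \<Rightarrow> real" where
  "bin y = (\<Sum>j. if y j then (1/2) ^ Suc j else 0)"

lemma bin_summable: "summable (\<lambda>j. if y j then (1/2 :: real) ^ Suc j else 0)"
proof (rule summable_comparison_test)
  show "\<exists>N. \<forall>n\<ge>N. norm (if y n then (1/2 :: real) ^ Suc n else 0) \<le> (1/2) ^ n"
    by auto
qed (simp add: summable_geometric)

lemma bin_shift: "bin y = ((if y 0 then 1 else 0) + bin (\<lambda>j. y (Suc j))) / 2"
proof -
  have "bin y = (if y 0 then 1/2 else 0) + (\<Sum>j. if y (Suc j) then (1/2 :: real) ^ Suc (Suc j) else 0)"
    using suminf_split_head[OF bin_summable[of y]] by (simp add: bin_def)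
  also have "(\<Sum>j. if y (Suc j) then (1/2 :: real) ^ Suc (Suc j) else 0) =
    (\<Sum>j. (if y (Suc j) then (1/2 :: real) ^ Suc j else 0) / 2)"
    by (intro arg_cong[where f = suminf]) auto
  also have "\<dots> = bin (\<lambda>j. y (Suc j)) / 2"
    unfolding bin_def by (rule suminf_divide[OF bin_summable])
  finally show ?thesis by simp
qed

lemma bin_nonneg: "0 \<le> bin y"
  unfolding bin_def by (intro suminf_nonneg bin_summable) auto

lemma bin_le_1: "bin y \<le> 1"
proof -
  have "bin y \<le> (\<Sum>j. (1/2 :: real) ^ Suc j)"
    unfolding bin_def by (intro suminf_le bin_summable) (auto simp: summable_geometric)
  also have "\<dots> = 1" using power_half_series by (simp add: sums_iff)
  finally show ?thesis .
qed

lemma bin_agree: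
  assumes "\<And>i. i < m \<Longrightarrow> y i = z i"
  shows "\<bar>bin y - bin z\<bar> \<le> (1/2) ^ m"
  using assms
proof (induction m arbitrary: y z)
  case 0
  show ?case using bin_nonneg[of y] bin_le_1[of y] bin_nonneg[of z] bin_le_1[of z] by auto
next
  case (Suc m)
  have "\<bar>bin (\<lambda>j. y (Suc j)) - bin (\<lambda>j. z (Suc j))\<bar> \<le> (1/2) ^ m"
    using Suc.prems by (intro Suc.IH) auto
  moreover have "y 0 = z 0" using Suc.prems by simp
  ultimately show ?case by (simp add: bin_shift[of y] bin_shift[of z] field_simps abs_le_iff)
qed

text \<open>The interval is the interior of a dyadic interval; the strict inequalities avoid its end
  points, where a number may have two expansions.\<close>

lemma bin_isolates:
  obtains l u where "0 \<le> l" "l < u" "u \<le> 1" "\<And>z i. l < bin z \<Longrightarrow> bin z < u \<Longrightarrow> i < m \<Longrightarrow> z i = y i"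
proof -
  have "\<exists>l u. 0 \<le> l \<and> l < u \<and> u \<le> 1 \<and> (\<forall>z i. l < bin z \<longrightarrow> bin z < u \<longrightarrow> i < m \<longrightarrow> z i = y i)"
  proof (induction m arbitrary: y)
    case 0
    show ?case by (intro exI[of _ 0] exI[of _ 1]) auto
  next
    case (Suc m)
    obtain l u where lu: "0 \<le> l" "l < u" "u \<le> 1"
      "\<And>z i. l < bin z \<Longrightarrow> bin z < u \<Longrightarrow> i < m \<Longrightarrow> z i = y (Suc i)"
      using Suc.IH[of "\<lambda>j. y (Suc j)"] by metis
    define b :: real where "b = (if y 0 then 1 else 0)"
    have *: "z i = y i" if z: "(b + l) / 2 < bin z" "bin z < (b + u) / 2" and "i < Suc m" for z i
    proof -
      define z' where "z' = (\<lambda>j. z (Suc j))"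
      have bz: "bin z = ((if z 0 then 1 else 0) + bin z') / 2" unfolding z'_def by (rule bin_shift)
      have "z 0 = y 0"
      proof (rule ccontr)
        assume "z 0 \<noteq> y 0"
        then show False using bz z lu bin_nonneg[of z'] bin_le_1[of z'] by (auto simp: b_def split: if_splits)
      qed
      then have "l < bin z'" "bin z' < u" using bz z by (auto simp: b_def split: if_splits)
      then have "z (Suc j) = y (Suc j)" if "j < m" for j
        using lu(4)[of z' j] that by (simp add: z'_def)
      then show ?thesis using \<open>z 0 = y 0\<close> \<open>i < Suc m\<close> by (cases i) auto
    qed
    show ?case
    proof (intro exI conjI allI impI)
      show "0 \<le> (b + l) / 2" "(b + l) / 2 < (b + u) / 2" "(b + u) / 2 \<le> 1"
        using lu(1-3) by (auto simp: b_def)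
    qed (rule *)
  qed
  then show thesis using that by blast
qed

text \<open>The digits are read off the orbit of \<open>t\<close> under doubling. The discrepancy
  between \<open>T n\<close> and the value of the digits from \<open>n\<close> on is half of that at
  \<open>n + 1\<close>, hence below every power of 1/2.\<close>

lemma bin_surj:
  assumes "0 \<le> t" "t \<le> 1"
  obtains y where "bin y = t"
proof -
  define T where "T = rec_nat t (\<lambda>_ r. 2 * r - (if r \<ge> 1/2 then 1 else 0 :: real))"
  define y where "y n \<longleftrightarrow> T n \<ge> 1/2" for n
  have T: "T 0 = t" "T (Suc n) = 2 * T n - (if y n then 1 else 0)" for n
    by (simp_all add: T_def y_def)
  have T01: "0 \<le> T n \<and> T n \<le> 1" for n
    by (induction n) (use assms in \<open>auto simp: T y_def\<close>)
  have close: "\<bar>bin (\<lambda>j. y (j + n)) - T n\<bar> \<le> (1/2) ^ m" for m n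
  proof (induction m arbitrary: n)
    case 0
    show ?case using bin_nonneg[of "\<lambda>j. y (j + n)"] bin_le_1[of "\<lambda>j. y (j + n)"] T01[of n] by auto
  next
    case (Suc m)
    have *: "bin (\<lambda>j. y (j + n)) - T n = (bin (\<lambda>j. y (j + Suc n)) - T (Suc n)) / 2"
      using bin_shift[of "\<lambda>j. y (j + n)"] by (simp add: T field_simps)
    show ?case unfolding * using Suc.IH[of "Suc n"] by (simp add: abs_divide)
  qed
  have "\<bar>bin y - t\<bar> \<le> 0"
  proof (rule field_le_epsilon)
    fix e :: real assume "0 < e"
    then obtain m where "(1/2 :: real) ^ m < e" using real_arch_pow_inv[of e "1/2"] by auto
    then show "\<bar>bin y - t\<bar> \<le> 0 + e" using close[of 0 m] by (simp add: T)
  qed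
  then show thesis using that[of y] by simp
qed

text \<open>The second clause is an irreducibility condition: it makes images, not only preimages, of nowhere dense
  sets nowhere dense.\<close>

definition category_map :: "((nat \<Rightarrow> bool) \<Rightarrow> 'a::topological_space) \<Rightarrow> bool" where
  "category_map p \<longleftrightarrow>
     (\<forall>y W. open W \<and> p y \<in> W \<longrightarrow> (\<exists>m. p ` cylinder y m \<subseteq> W)) \<and>
     (\<forall>y m. \<exists>V. open V \<and> V \<noteq> {} \<and> V \<subseteq> range p \<and> p -` V \<subseteq> cylinder y m)"

lemma category_map_cylinder:
  "category_map p \<Longrightarrow> open W \<Longrightarrow> p y \<in> W \<Longrightarrow> \<exists>m. p ` cylinder y m \<subseteq> W"
  unfolding category_map_def by simp

lemma category_map_isolates:
  assumes "category_map p"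
  obtains V where "open V" "V \<noteq> {}" "V \<subseteq> range p" "p -` V \<subseteq> cylinder y m"
proof -
  have "\<exists>V. open V \<and> V \<noteq> {} \<and> V \<subseteq> range p \<and> p -` V \<subseteq> cylinder y m"
    using assms unfolding category_map_def by simp
  then show thesis using that by (elim exE conjE)
qed

text \<open>The digits of the coordinates are interleaved, with digit \<open>j\<close> of coordinate
  \<open>b\<close> at position \<open>j * d + e b\<close>. A prefix of length \<open>m * d\<close>
  fixes \<open>m\<close> digits of every coordinate, and conversely a product of isolating intervals
  fixes a prefix.\<close>

lemma category_map_exists: "\<exists>p :: (nat \<Rightarrow> bool) \<Rightarrow> 'a::euclidean_space. category_map p"
proof -
  define d where "d = DIM('a)"
  have d: "0 < d" by (simp add: d_def)
  obtain e :: "'a \<Rightarrow> nat" where e: "bij_betw e Basis {0..<d}"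
    unfolding d_def using ex_bij_betw_finite_nat[OF finite_Basis] by blast
  then have e_less: "e b < d" if "b \<in> Basis" for b
    using that by (auto dest: bij_betwE)
  define sub where "sub y b = (\<lambda>j. y (j * d + e b))" for y :: "nat \<Rightarrow> bool" and b :: 'a
  define p :: "(nat \<Rightarrow> bool) \<Rightarrow> 'a" where "p y = (\<Sum>b\<in>Basis. bin (sub y b) *\<^sub>R b)" for y
  have p_inner: "p y \<bullet> b = bin (sub y b)" if "b \<in> Basis" for y b
    unfolding p_def using that by (simp add: inner_sum_left_Basis)
  have "category_map p"
    unfolding category_map_def
  proof (intro conjI allI impI)
    fix y and W :: "'a set" assume W: "open W \<and> p y \<in> W"
    then obtain r where r: "0 < r" "ball (p y) r \<subseteq> W" by (meson openE)
    have "0 < r / d" using r d by simp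
    then obtain m where m: "(1/2 :: real) ^ m < r / d" using real_arch_pow_inv[of "r / d" "1/2"] by auto
    have "p z \<in> W" if z: "z \<in> cylinder y (m * d)" for z
    proof -
      have "norm (p y - p z) \<le> (\<Sum>b\<in>Basis. \<bar>(p y - p z) \<bullet> b\<bar>)" by (rule norm_le_l1)
      also have "\<dots> \<le> (\<Sum>b\<in>(Basis :: 'a set). (1/2) ^ m)"
      proof (rule sum_mono)
        fix b :: 'a assume b: "b \<in> Basis"
        have "sub y b i = sub z b i" if "i < m" for i
        proof -
          have "i * d + e b < Suc i * d" using e_less[OF b] by simp
          also have "\<dots> \<le> m * d" using that by (intro mult_le_mono1) simp
          finally show ?thesis using z by (simp add: sub_def cylinder_def)
        qed
        then have "\<bar>bin (sub y b) - bin (sub z b)\<bar> \<le> (1/2) ^ m" by (rule bin_agree)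
        then show "\<bar>(p y - p z) \<bullet> b\<bar> \<le> (1/2) ^ m" using p_inner[OF b] by (simp add: inner_diff_left)
      qed
      also have "\<dots> = d * (1/2) ^ m" by (simp add: d_def)
      also have "\<dots> < r" using m d by (simp add: field_simps)
      finally show ?thesis using r(2) by (auto simp: dist_norm)
    qed
    then show "\<exists>m. p ` cylinder y m \<subseteq> W" by blast
  next
    fix y and m
    have "\<exists>l u. 0 \<le> l \<and> l < u \<and> u \<le> 1 \<and> (\<forall>z i. l < bin z \<longrightarrow> bin z < u \<longrightarrow> i < m \<longrightarrow> z i = sub y b i)" for b
      by (rule bin_isolates[of m "sub y b"]) blast
    then obtain l u where lu: "\<And>b. 0 \<le> l b" "\<And>b. l b < u b" "\<And>b. u b \<le> 1"
      "\<And>b z i. l b < bin z \<Longrightarrow> bin z < u b \<Longrightarrow> i < m \<Longrightarrow> z i = sub y b i"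
      by metis
    define V where "V = box (\<Sum>b\<in>Basis. l b *\<^sub>R b) (\<Sum>b\<in>Basis. u b *\<^sub>R b :: 'a)"
    have V: "x \<in> V \<longleftrightarrow> (\<forall>b\<in>Basis. l b < x \<bullet> b \<and> x \<bullet> b < u b)" for x
      by (simp add: V_def mem_box)
    show "\<exists>V. open V \<and> V \<noteq> {} \<and> V \<subseteq> range p \<and> p -` V \<subseteq> cylinder y m"
    proof (intro exI[of _ V] conjI)
      show "open V" by (simp add: V_def open_box)
      show "V \<noteq> {}" using lu(2) by (auto simp: V_def box_ne_empty)
      show "p -` V \<subseteq> cylinder y m"
      proof
        fix z assume "z \<in> p -` V"
        then have z: "l b < bin (sub z b)" "bin (sub z b) < u b" if "b \<in> Basis" for b
          using that p_inner[of b z] by (auto simp: V)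
        have "z i = y i" if "i < m" for i
        proof -
          obtain b where b: "b \<in> Basis" "e b = i mod d"
            using bij_betw_imp_surj_on[OF e] d by (metis (no_types, lifting) atLeastLessThan_iff imageE mod_less_divisor zero_le)
          have "i div d < m" using that d by (meson div_le_dividend le_less_trans)
          then have "sub z b (i div d) = sub y b (i div d)" using lu(4) z[OF b(1)] by blast
          then show ?thesis using b(2) by (simp add: sub_def)
        qed
        then show "z \<in> cylinder y m" by (simp add: cylinder_def)
      qed
      show "V \<subseteq> range p"
      proof
        fix x assume x: "x \<in> V"
        have "\<exists>w. bin w = x \<bullet> b" if "b \<in> Basis" for b
        proof -
          have "0 \<le> x \<bullet> b" "x \<bullet> b \<le> 1" using x that lu(1,3)[of b] unfolding V by force+
          then show ?thesis by (metis bin_surj)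
        qed
        then obtain w where w: "\<And>b. b \<in> Basis \<Longrightarrow> bin (w b) = x \<bullet> b" by metis
        define z where "z i = w (inv_into Basis e (i mod d)) (i div d)" for i
        have *: "p z \<bullet> b = x \<bullet> b" if b: "b \<in> Basis" for b
        proof -
          have "inv_into Basis e (e b) = b" using e b by (simp add: bij_betw_def)
          then have "sub z b = w b" using e_less[OF b] by (simp add: sub_def z_def)
          then show ?thesis using p_inner[OF b] w[OF b] by simp
        qed
        have "x = p z" by (rule euclidean_eqI) (rule *[symmetric])
        then show "x \<in> range p" by blast
      qed
    qed
  qed
  then show ?thesis by blast
qed

text \<open>Continuity provides a cylinder mapped into \<open>W\<close>, and inside it one that
  avoids \<open>N i\<close>. By irreducibility some open set has its whole preimage there, so none
  of its points is a value of \<open>p\<close> on \<open>N i\<close>.\<close>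

lemma category_map_image_meager:
  assumes p: "category_map p" and "A \<in> cantor_meager"
  shows "p ` A \<in> meager_sets"
proof -
  obtain N :: "nat \<Rightarrow> _" where N: "\<And>i. cantor_nowhere_dense (N i)" "A \<subseteq> (\<Union>i. N i)"
    using assms(2) unfolding cantor_meager_def by blast
  have "nowhere_dense (p ` N i)" for i
    unfolding nowhere_dense_iff
  proof (intro allI impI)
    fix W :: "'a set" assume W: "open W \<and> W \<noteq> {}"
    show "\<exists>V. open V \<and> V \<noteq> {} \<and> V \<subseteq> W \<and> V \<inter> p ` N i = {}"
    proof (cases "W \<inter> range p = {}")
      case True
      then show ?thesis using W by (intro exI[of _ W]) auto
    next
      case False
      then obtain y where "p y \<in> W" by auto
      then obtain m where m: "p ` cylinder y m \<subseteq> W" using category_map_cylinder[OF p] W by meson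
      obtain z n where z: "cylinder z n \<subseteq> cylinder y m" "cylinder z n \<inter> N i = {}"
        using N(1)[of i] unfolding cantor_nowhere_dense_def by meson
      obtain V where V: "open V" "V \<noteq> {}" "V \<subseteq> range p" "p -` V \<subseteq> cylinder z n"
        by (rule category_map_isolates[OF p])
      have "V \<subseteq> W" using V(3,4) z(1) m by blast
      moreover have "V \<inter> p ` N i = {}" using V(4) z(2) by blast
      ultimately show ?thesis using V by blast
    qed
  qed
  then show ?thesis
    unfolding meager_iff using N(2) by (intro exI[of _ "\<lambda>i. p ` N i"] conjI allI) blast+
qed

lemma category_map_vimage_meager:
  assumes p: "category_map p" and "B \<in> meager_sets"
  shows "p -` B \<in> cantor_meager"
proof -
  obtain N :: "nat \<Rightarrow> _" where N: "\<And>i. nowhere_dense (N i)" "B \<subseteq> (\<Union>i. N i)"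
    using assms(2) unfolding meager_iff by blast
  have "cantor_nowhere_dense (p -` N i)" for i
    unfolding cantor_nowhere_dense_def
  proof (intro allI)
    fix y m
    obtain V where V: "open V" "V \<noteq> {}" "V \<subseteq> range p" "p -` V \<subseteq> cylinder y m"
      by (rule category_map_isolates[OF p])
    obtain V' where V': "open V'" "V' \<noteq> {}" "V' \<subseteq> V" "V' \<inter> N i = {}"
      using N(1)[of i] V unfolding nowhere_dense_iff by meson
    obtain z where z: "p z \<in> V'" using V(3) V'(2,3) by blast
    obtain n where n: "p ` cylinder z n \<subseteq> V'" using category_map_cylinder[OF p V'(1) z] by (elim exE)
    show "\<exists>z n. cylinder z n \<subseteq> cylinder y m \<and> cylinder z n \<inter> p -` N i = {}"
      using n V'(3,4) V(4) by (intro exI[of _ z] exI[of _ n]) blast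
  qed
  then show ?thesis
    unfolding cantor_meager_def using N(2) by (intro CollectI exI[of _ "\<lambda>i. p -` N i"] conjI allI) blast+
qed

lemma meager_translate:
  fixes A :: "'a::real_normed_vector set"
  assumes "A \<in> meager_sets"
  shows "(\<lambda>x. d + x) ` A \<in> meager_sets"
proof -
  obtain N :: "nat \<Rightarrow> _" where N: "\<And>i. nowhere_dense (N i)" "A \<subseteq> (\<Union>i. N i)"
    using assms unfolding meager_iff by blast
  have "nowhere_dense ((\<lambda>x. d + x) ` N i)" for i
    using N(1)[of i] by (simp add: nowhere_dense_def closure_translation interior_translation)
  then show ?thesis
    unfolding meager_iff using N(2) by (intro exI[of _ "\<lambda>i. (\<lambda>x. d + x) ` N i"] conjI allI) blast+
qed

text \<open>The range of \<open>p\<close> has interior but need not be everything. Countably many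
  translates of it cover the space, and \<open>f x\<close> codes \<open>x\<close> within a translate
  chosen for it; both properties of \<open>f\<close> follow by countable unions over the
  translations.\<close>

lemma cantor_transfer:
  obtains p :: "(nat \<Rightarrow> bool) \<Rightarrow> 'a::euclidean_space" and f :: "'a \<Rightarrow> nat \<Rightarrow> bool"
  where "\<And>A. A \<in> cantor_meager \<Longrightarrow> p ` A \<in> meager_sets" "\<And>B. B \<in> meager_sets \<Longrightarrow> p -` B \<in> cantor_meager"
    "\<And>A. A \<in> meager_sets \<Longrightarrow> f ` A \<in> cantor_meager" "\<And>B. B \<in> cantor_meager \<Longrightarrow> f -` B \<in> meager_sets"
proof -
  obtain p :: "(nat \<Rightarrow> bool) \<Rightarrow> 'a" where p: "category_map p" using category_map_exists by blast
  obtain V where V: "open V" "V \<noteq> {}" "V \<subseteq> range p" by (rule category_map_isolates[OF p])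
  obtain D :: "'a set" where D: "countable D" "\<And>X. open X \<Longrightarrow> X \<noteq> {} \<Longrightarrow> \<exists>d\<in>D. d \<in> X"
    by (rule countable_dense_setE) blast
  have "\<exists>d\<in>D. \<exists>y. x = d + p y" for x
  proof -
    \<comment> \<open>A point \<open>d\<close> of \<open>D\<close> in the open set
      \<open>x - V\<close> makes \<open>x - d\<close> a value of \<open>p\<close>.\<close>
    have "open ((+) x ` uminus ` V)" using V(1) by (intro open_translation open_negations)
    then have "open ((\<lambda>v. x - v) ` V)" by (simp add: image_image)
    then obtain d where "d \<in> D" "d \<in> (\<lambda>v. x - v) ` V" using D(2) V(2) by blast
    then show ?thesis using V(3) by force
  qed
  then obtain d f where df: "\<And>x. d x \<in> D" "\<And>x. x = d x + p (f x)" by metis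
  show thesis
  proof (rule that[of p f])
    show "p ` A \<in> meager_sets" if "A \<in> cantor_meager" for A
      using p that by (rule category_map_image_meager)
    show vim: "p -` B \<in> cantor_meager" if "B \<in> meager_sets" for B
      using p that by (rule category_map_vimage_meager)
    show "f ` A \<in> cantor_meager" if "A \<in> meager_sets" for A
    proof -
      have "D \<noteq> {}" using df(1) by blast
      have "(\<Union>i. p -` ((\<lambda>x. - from_nat_into D i + x) ` A)) \<in> cantor_meager"
        by (intro cantor_meager_UN vim meager_translate that)
      then show ?thesis
      proof (rule cantor_meager_subset)
        show "f ` A \<subseteq> (\<Union>i. p -` ((\<lambda>x. - from_nat_into D i + x) ` A))"
        proof
          fix y assume "y \<in> f ` A"
          then obtain x where x: "x \<in> A" "y = f x" by blast
          obtain i where "from_nat_into D i = d x" using from_nat_into_surj[OF D(1) df(1)[of x]] by blast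
          then have "p y = - from_nat_into D i + x" using df(2)[of x] x(2) by (simp add: algebra_simps)
          then show "y \<in> (\<Union>i. p -` ((\<lambda>x. - from_nat_into D i + x) ` A))" using x(1) by blast
        qed
      qed
    qed
    show "f -` B \<in> meager_sets" if "B \<in> cantor_meager" for B
    proof -
      have "(\<Union>d\<in>D. (\<lambda>x. d + x) ` (p ` B)) \<in> meager_sets"
        by (intro meager_UN D(1) meager_translate category_map_image_meager[OF p that])
      then show ?thesis
        by (rule meager_subset) (use df in blast)
    qed
  qed
qed

text \<open>Baire's theorem for the Cantor space is inherited from the line, because the preimage of
  \<open>UNIV\<close> is \<open>UNIV\<close>.\<close>

lemma UNIV_not_cantor_meager: "UNIV \<notin> cantor_meager"
proof
  assume *: "UNIV \<in> cantor_meager"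
  obtain p :: "(nat \<Rightarrow> bool) \<Rightarrow> real" and f where "\<And>B. B \<in> cantor_meager \<Longrightarrow> f -` B \<in> (meager_sets :: real set set)"
    by (rule cantor_transfer) blast
  from this[OF *] show False using open_not_meager[of "UNIV :: real set"] by simp
qed

lemma covering_ideal_meager: "covering_ideal (meager_sets :: 'a::euclidean_space set set)"
  unfolding covering_ideal_def
proof (intro conjI allI impI)
  show "A \<in> meager_sets" if "B \<in> meager_sets" "A \<subseteq> B" for A B :: "'a set"
    using that by (rule meager_subset)
  have "{x} \<in> meager_sets" for x :: 'a
    by (intro nowhere_dense_imp_meager) (simp add: nowhere_dense_def)
  then show "\<Union>meager_sets = (UNIV :: 'a set)" by blast
  show "(UNIV :: 'a set) \<notin> meager_sets" by (rule open_not_meager) auto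
qed

lemma covering_ideal_cantor_meager: "covering_ideal cantor_meager"
  unfolding covering_ideal_def
proof (intro conjI allI impI)
  show "A \<in> cantor_meager" if "B \<in> cantor_meager" "A \<subseteq> B" for A B
    using that by (rule cantor_meager_subset)
  show "UNIV \<notin> cantor_meager" by (rule UNIV_not_cantor_meager)
  have "cantor_nowhere_dense {x}" for x
    unfolding cantor_nowhere_dense_def
  proof (intro allI)
    fix y m
    define z where "z = y(m := \<not> x m)"
    have "cylinder z (Suc m) \<subseteq> cylinder y m" by (intro cylinder_mono) (auto simp: cylinder_def z_def)
    moreover have "cylinder z (Suc m) \<inter> {x} = {}" by (auto simp: cylinder_def z_def)
    ultimately show "\<exists>z n. cylinder z n \<subseteq> cylinder y m \<and> cylinder z n \<inter> {x} = {}" by blast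
  qed
  then have "{x} \<in> cantor_meager" for x
    unfolding cantor_meager_def by (intro CollectI exI[of _ "\<lambda>_. {x}"]) auto
  then show "\<Union>cantor_meager = UNIV" by blast
qed

section \<open>The dimension ideal and the meager ideal\<close>

lemma closed_covering_dim_no_box:
  fixes a b :: "real ^ 'n" and S :: "'n::finite set"
  assumes "covering_dim_le (top_of_set C) k" and "k < card S"
    and "\<And>c. c \<in> S \<Longrightarrow> a $ c < b $ c" "\<And>c. c \<notin> S \<Longrightarrow> a $ c = b $ c"
  shows "\<not> cbox a b \<subseteq> C"
proof
  assume "cbox a b \<subseteq> C"
  then have dim: "covering_dim_le (top_of_set (cbox a b)) k"
    by (intro covering_dim_le_closed_subset[OF assms(1)]) auto
  obtain \<epsilon> where \<epsilon>: "0 < \<epsilon>" "\<And>\<delta>. 0 < \<delta> \<Longrightarrow> \<not> sep_cover k \<epsilon> \<delta> (cbox a b)"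
    using no_sep_cover_box[OF assms(2-4)] by blast
  show False
    using covering_dim_imp_sep_cover[OF compact_cbox dim \<epsilon>(1)] \<epsilon>(2) by blast
qed

text \<open>A closed set with interior contains a box with all sides nondegenerate, too large for
  dimension \<open>k\<close>. The inclusion makes the identity a point map, which settles one
  inequality each for \<open>cov\<close> and \<open>non\<close>.\<close>

lemma sigma_closed_dim_subset_meager:
  assumes "k < CARD('n::finite)" and "A \<in> (sigma_closed_dim k :: (real ^ 'n) set set)"
  shows "A \<in> meager_sets"
proof -
  obtain \<C> where \<C>: "countable \<C>" "\<And>C. C \<in> \<C> \<Longrightarrow> closed C"
    "\<And>C. C \<in> \<C> \<Longrightarrow> covering_dim_le (top_of_set C) k" "A \<subseteq> \<Union>\<C>"
    using assms(2) unfolding sigma_closed_dim_def by blast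
  have "interior C = {}" if "C \<in> \<C>" for C
  proof (rule ccontr)
    assume "interior C \<noteq> {}"
    then obtain x where "x \<in> interior C" by blast
    then obtain a b where ab: "cbox a b \<subseteq> interior C" "x \<in> box a b"
      using open_contains_cbox[OF open_interior, of x C] by metis
    have "a $ c < b $ c" for c using ab(2) unfolding mem_box_cart by (meson less_trans)
    then have "\<not> cbox a b \<subseteq> C"
      using assms(1) by (intro closed_covering_dim_no_box[OF \<C>(3)[OF that], of UNIV]) auto
    then show False using ab(1) interior_subset by blast
  qed
  then have "nowhere_dense C" if "C \<in> \<C>" for C
    using \<C>(2) that by (simp add: nowhere_dense_def)
  then have "(\<Union>C\<in>\<C>. C) \<in> meager_sets"
    by (intro meager_UN \<C>(1) nowhere_dense_imp_meager)
  then show ?thesis by (rule meager_subset) (use \<C>(4) in simp)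
qed

section \<open>Products of subsets of the line\<close>

lemma meager_real_compacts:
  fixes A :: "real set"
  assumes "A \<in> meager_sets"
  obtains K :: "nat \<Rightarrow> real set" where "\<And>i. compact (K i)" "\<And>i. interior (K i) = {}"
    "\<And>i j. i \<le> j \<Longrightarrow> K i \<subseteq> K j" "A \<subseteq> (\<Union>i. K i)"
proof -
  obtain N :: "nat \<Rightarrow> real set" where N: "\<And>i. nowhere_dense (N i)" "A \<subseteq> (\<Union>i. N i)"
    using assms unfolding meager_iff by blast
  \<comment> \<open>The finite unions make the sequence increasing, so that in a product one common
    index serves all coordinates.\<close>
  define K where "K i = (\<Union>j\<le>i. closure (N j)) \<inter> {- real i..real i}" for i
  have int: "interior (\<Union>j\<le>i. closure (N j)) = {}" for i
  proof (induction i)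
    case 0
    then show ?case using N(1)[of 0] by (simp add: nowhere_dense_def)
  next
    case (Suc i)
    have "(\<Union>j\<le>Suc i. closure (N j)) = closure (N (Suc i)) \<union> (\<Union>j\<le>i. closure (N j))"
      by (auto simp: atMost_Suc)
    then show ?case
      using interior_closed_Un_empty_interior[OF closed_closure Suc.IH] N(1)[of "Suc i"]
      by (simp add: nowhere_dense_def)
  qed
  show thesis
  proof (rule that[of K])
    show "compact (K i)" for i
      unfolding K_def by (intro closed_Int_compact closed_UN) auto
    show "interior (K i) = {}" for i
      using int[of i] interior_mono[of "K i" "\<Union>j\<le>i. closure (N j)"] by (auto simp: K_def)
    show "K i \<subseteq> K j" if "i \<le> j" for i j
      using that by (fastforce simp: K_def)
    show "A \<subseteq> (\<Union>i. K i)"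
    proof
      fix x assume "x \<in> A"
      then obtain i where "x \<in> N i" using N(2) by blast
      then have i: "x \<in> closure (N i)" using closure_subset by blast
      obtain n :: nat where n: "\<bar>x\<bar> \<le> n" using real_arch_simple by blast
      have "x \<in> {- real (max i n)..real (max i n)}" using n by (auto simp: abs_le_iff)
      then have "x \<in> K (max i n)" using i unfolding K_def by (intro IntI UN_I[of i]) auto
      then show "x \<in> (\<Union>i. K i)" by blast
    qed
  qed
qed

lemma compact_product_cart:
  fixes N :: "'n::finite \<Rightarrow> real set"
  assumes "\<And>c. compact (N c)"
  shows "compact {x :: real ^ 'n. \<forall>c. x $ c \<in> N c}"
proof -
  have "\<exists>r. \<forall>t\<in>N c. \<bar>t\<bar> \<le> r" for c
    using compact_imp_bounded[OF assms] by (simp add: bounded_real)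
  then obtain r where *: "\<And>c t. t \<in> N c \<Longrightarrow> \<bar>t\<bar> \<le> r c" by metis
  have r: "- r c \<le> t" "t \<le> r c" if "t \<in> N c" for c t
    using *[OF that] by linarith+
  have "closed (\<Inter>c. (\<lambda>x :: real ^ 'n. x $ c) -` N c)"
    using assms by (intro closed_INT ballI closed_vimage) (auto simp: compact_imp_closed intro!: continuous_intros)
  moreover have "{x :: real ^ 'n. \<forall>c. x $ c \<in> N c} = (\<Inter>c. (\<lambda>x. x $ c) -` N c) \<inter> cbox (\<chi> c. - r c) (\<chi> c. r c)"
    using r by (auto simp: mem_box_cart)
  ultimately show ?thesis by (simp add: closed_Int_compact)
qed

text \<open>All factors of the compact pieces have empty interior, so no direction is cut into
  bricks and \<open>sep_cover_product\<close> applies with \<open>T = {}\<close> for every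
  \<open>k\<close>.\<close>

lemma product_meager_sigma_closed_dim:
  fixes B :: "'n::finite \<Rightarrow> real set"
  assumes "\<And>c. B c \<in> meager_sets"
  shows "{x :: real ^ 'n. \<forall>c. x $ c \<in> B c} \<in> sigma_closed_dim k"
proof -
  have "\<exists>K :: nat \<Rightarrow> real set. (\<forall>i. compact (K i) \<and> interior (K i) = {}) \<and> (\<forall>i j. i \<le> j \<longrightarrow> K i \<subseteq> K j) \<and> B c \<subseteq> (\<Union>i. K i)" for c
    by (rule meager_real_compacts[OF assms[of c]]) blast
  then obtain K :: "'n \<Rightarrow> nat \<Rightarrow> real set" where K: "\<And>c. (\<forall>i. compact (K c i) \<and> interior (K c i) = {}) \<and>
    (\<forall>i j. i \<le> j \<longrightarrow> K c i \<subseteq> K c j) \<and> B c \<subseteq> (\<Union>i. K c i)"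
    by metis
  show ?thesis
  proof (rule sigma_closed_dimI[where K = "\<lambda>i. {x. \<forall>c. x $ c \<in> K c i}"])
    show "compact {x :: real ^ 'n. \<forall>c. x $ c \<in> K c i}" for i
      using K by (intro compact_product_cart) blast
    show "\<exists>\<delta>>0. sep_cover k \<epsilon> \<delta> {x :: real ^ 'n. \<forall>c. x $ c \<in> K c i}" if "0 < \<epsilon>" for i \<epsilon>
      by (rule sep_cover_product[where N = "\<lambda>c. K c i" and T = "{}" and k = k, OF _ _ _ that])
        (use K in auto)
    show "{x :: real ^ 'n. \<forall>c. x $ c \<in> B c} \<subseteq> (\<Union>i. {x. \<forall>c. x $ c \<in> K c i})"
    proof
      fix x :: "real ^ 'n" assume x: "x \<in> {x. \<forall>c. x $ c \<in> B c}"
      have "\<exists>i. x $ c \<in> K c i" for c using x K[of c] by blast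
      then obtain i where i: "\<And>c. x $ c \<in> K c (i c)" by metis
      have "i c \<le> Max (range i)" for c by (rule Max_ge) auto
      then have "x $ c \<in> K c (Max (range i))" for c using i[of c] K[of c] by blast
      then show "x \<in> (\<Union>i. {x. \<forall>c. x $ c \<in> K c i})" by blast
    qed
  qed
qed

text \<open>Otherwise every \<open>Q \<inter> - C\<close> would be open and dense in
  \<open>Q\<close>, and so their intersection, which is empty, would be dense.\<close>

lemma Baire_countable_closed_cover:
  fixes Q :: "'a::euclidean_space set"
  assumes "closed Q" "Q \<noteq> {}" "countable \<C>" "\<And>C. C \<in> \<C> \<Longrightarrow> closed C" "Q \<subseteq> \<Union>\<C>"
  obtains C W where "C \<in> \<C>" "open W" "Q \<inter> W \<noteq> {}" "Q \<inter> W \<subseteq> C"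
proof (rule ccontr)
  assume neg: "\<not> thesis"
  define \<G> where "\<G> = (\<lambda>C. Q \<inter> - C) ` \<C>"
  have "Q \<subseteq> closure (\<Inter>\<G>)"
  proof (rule Baire[OF assms(1)])
    show "countable \<G>" using assms(3) by (simp add: \<G>_def)
    fix T assume "T \<in> \<G>"
    then obtain C where C: "C \<in> \<C>" "T = Q \<inter> - C" by (auto simp: \<G>_def)
    have "Q \<subseteq> closure T"
    proof (rule ccontr)
      assume "\<not> Q \<subseteq> closure T"
      then have "Q \<inter> - closure T \<noteq> {}" by blast
      moreover have "Q \<inter> - closure T \<subseteq> C" using C(2) closure_subset[of T] by blast
      ultimately show False using neg that[OF C(1), of "- closure T"] by (simp add: open_Compl)
    qed
    then show "openin (top_of_set Q) T \<and> Q \<subseteq> closure T"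
      using C assms(4) by (auto intro!: openin_open_Int)
  qed
  moreover have "\<Inter>\<G> = {}"
  proof -
    obtain q C where q: "q \<in> Q" "C \<in> \<C>" using assms(2,5) by blast
    then have "\<Inter>\<G> \<subseteq> Q" by (auto simp: \<G>_def)
    then show ?thesis using assms(5) by (auto simp: \<G>_def)
  qed
  ultimately show False using assms(2) by simp
qed

text \<open>\<open>Q\<close> is a cube in the \<open>k\<close> directions of \<open>T\<close>, and
  the slices are its translates along one more direction \<open>c0\<close>. If the slices inside a
  member of the ideal were indexed by a non-meager set, a single closed set of dimension at most
  \<open>k\<close> would contain a box with \<open>k + 1\<close> nondegenerate sides.\<close>

lemma meager_tukey_sigma_closed_dim:
  assumes "k < CARD('n::finite)"
  obtains \<phi> \<psi> where "tukey \<phi> \<psi> (meager_sets :: real set set) (sigma_closed_dim k :: (real ^ 'n) set set)"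
proof -
  obtain S :: "'n set" where S: "card S = Suc k"
    using assms obtain_subset_with_card_n[of "Suc k" "UNIV :: 'n set"] by auto
  then obtain c0 T where c0: "S = insert c0 T" "c0 \<notin> T" "card T = k" by (auto simp: card_Suc_eq)
  define Q where "Q = {u :: real ^ 'n. \<forall>c. u $ c \<in> (if c \<in> T then {0..1} else {0})}"
  have "compact Q" unfolding Q_def by (rule compact_product_cart) auto
  then have "closed Q" by (rule compact_imp_closed)
  have "0 \<in> Q" by (simp add: Q_def)
  define slice where "slice t = (\<lambda>u. u + t *\<^sub>R axis c0 1) ` Q" for t
  have slice: "x \<in> slice t \<longleftrightarrow> (\<forall>c. x $ c \<in> (if c = c0 then {t} else if c \<in> T then {0..1} else {0}))" for x t
  proof
    assume "x \<in> slice t"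
    then obtain u where u: "x = u + t *\<^sub>R axis c0 1" "\<And>c. u $ c \<in> (if c \<in> T then {0..1} else {0})"
      by (auto simp: slice_def Q_def)
    show "\<forall>c. x $ c \<in> (if c = c0 then {t} else if c \<in> T then {0..1} else {0})"
      using u(2) u(2)[of c0] c0(2) by (simp add: u(1) axis_def split: if_splits)
  next
    assume *: "\<forall>c. x $ c \<in> (if c = c0 then {t} else if c \<in> T then {0..1} else {0})"
    have "(x - t *\<^sub>R axis c0 1) $ c \<in> (if c \<in> T then {0..1} else {0})" for c
      using *[rule_format, of c] c0(2) by (auto simp: axis_def)
    then have "x - t *\<^sub>R axis c0 1 \<in> Q" unfolding Q_def by blast
    then show "x \<in> slice t" unfolding slice_def by (intro image_eqI[of _ _ "x - t *\<^sub>R axis c0 1"]) simp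
  qed
  define \<phi> where "\<phi> A = (\<Union>t\<in>A. slice t)" for A
  define \<psi> where "\<psi> B = {t. slice t \<subseteq> B}" for B
  have \<phi>: "\<phi> A \<in> sigma_closed_dim k" if A: "A \<in> meager_sets" for A
  proof -
    obtain K :: "nat \<Rightarrow> real set" where K: "\<And>i. compact (K i)" "\<And>i. interior (K i) = {}" "A \<subseteq> (\<Union>i. K i)"
      by (rule meager_real_compacts[OF A]) blast
    define N where "N i c = (if c = c0 then K i else if c \<in> T then {0..1} else {0})" for i c
    have N: "compact (N i c)" "c \<notin> T \<Longrightarrow> interior (N i c) = {}" for i c
      using K by (auto simp: N_def)
    show ?thesis
    proof (rule sigma_closed_dimI[where K = "\<lambda>i. {x. \<forall>c. x $ c \<in> N i c}"])
      show "compact {x :: real ^ 'n. \<forall>c. x $ c \<in> N i c}" for i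
        by (intro compact_product_cart N)
      show "\<exists>\<delta>>0. sep_cover k \<epsilon> \<delta> {x :: real ^ 'n. \<forall>c. x $ c \<in> N i c}" if "0 < \<epsilon>" for i \<epsilon>
        by (rule sep_cover_product[where N = "N i" and T = T and k = k, OF N _ that]) (use c0 in auto)
      show "\<phi> A \<subseteq> (\<Union>i. {x. \<forall>c. x $ c \<in> N i c})"
      proof
        fix x assume "x \<in> \<phi> A"
        then obtain t where t: "t \<in> A" "x \<in> slice t" by (auto simp: \<phi>_def)
        then obtain i where "t \<in> K i" using K(3) by blast
        then have "x $ c \<in> N i c" for c
          using t(2)[unfolded slice, rule_format, of c] by (auto simp: N_def split: if_splits)
        then show "x \<in> (\<Union>i. {x. \<forall>c. x $ c \<in> N i c})" by blast
      qed
    qed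
  qed
  have \<psi>: "\<psi> B \<in> meager_sets" if B: "B \<in> sigma_closed_dim k" for B
  proof -
    obtain \<C> where \<C>: "countable \<C>" "\<And>C. C \<in> \<C> \<Longrightarrow> closed C"
      "\<And>C. C \<in> \<C> \<Longrightarrow> covering_dim_le (top_of_set C) k" "B \<subseteq> \<Union>\<C>"
      using B unfolding sigma_closed_dim_def by blast
    obtain \<B> :: "(real ^ 'n) set set" where \<B>: "countable \<B>" "topological_basis \<B>"
      using ex_countable_basis by blast
    define \<V> where "\<V> = {V \<in> \<B>. Q \<inter> V \<noteq> {}}"
    \<comment> \<open>For every slice inside \<open>B\<close>, Baire's theorem on \<open>Q\<close>
      picks a member \<open>C\<close> and, by way of a countable basis, a relatively open part of
      \<open>Q\<close> whose translate lies in \<open>C\<close>. Countably many pairs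
      \<open>(C, V)\<close> thus account for all of \<open>\<psi> B\<close>.\<close>
    define H where "H C V = {t. \<forall>u\<in>Q \<inter> V. u + t *\<^sub>R axis c0 1 \<in> C}" for C V
    have "\<psi> B \<subseteq> (\<Union>(C, V)\<in>\<C> \<times> \<V>. H C V)"
    proof
      fix t assume "t \<in> \<psi> B"
      then have t: "slice t \<subseteq> \<Union>\<C>" using \<C>(4) by (auto simp: \<psi>_def)
      define \<D> where "\<D> = (\<lambda>C. (\<lambda>u. u + t *\<^sub>R axis c0 1) -` C) ` \<C>"
      have D: "countable \<D>" "\<And>D. D \<in> \<D> \<Longrightarrow> closed D"
        unfolding \<D>_def using \<C>(1,2) by (auto intro!: closed_vimage continuous_intros)
      have "Q \<subseteq> \<Union>\<D>" using t unfolding slice_def \<D>_def by blast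
      then obtain D W where DW: "D \<in> \<D>" "open W" "Q \<inter> W \<noteq> {}" "Q \<inter> W \<subseteq> D"
        using Baire_countable_closed_cover[OF \<open>closed Q\<close> _ D] \<open>0 \<in> Q\<close> by blast
      then obtain C where C: "C \<in> \<C>" "D = (\<lambda>u. u + t *\<^sub>R axis c0 1) -` C" by (auto simp: \<D>_def)
      obtain u where u: "u \<in> Q" "u \<in> W" using DW(3) by blast
      obtain V where V: "V \<in> \<B>" "u \<in> V" "V \<subseteq> W"
        using topological_basisE[OF \<B>(2) DW(2) u(2)] by blast
      have "V \<in> \<V>" using V u by (auto simp: \<V>_def)
      moreover have "t \<in> H C V" unfolding H_def using DW(4) V(3) C(2) by blast
      ultimately show "t \<in> (\<Union>(C, V)\<in>\<C> \<times> \<V>. H C V)" using C(1) by blast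
    qed
    moreover have "(\<Union>(C, V)\<in>\<C> \<times> \<V>. H C V) \<in> meager_sets"
    proof (rule meager_UN)
      show "countable (\<C> \<times> \<V>)" using \<C>(1) \<B>(1) by (simp add: \<V>_def countable_Collect)
      fix CV assume "CV \<in> \<C> \<times> \<V>"
      then obtain C V where CV: "CV = (C, V)" "C \<in> \<C>" "V \<in> \<V>" by blast
      have "H C V = (\<Inter>u\<in>Q \<inter> V. (\<lambda>t. u + t *\<^sub>R axis c0 1) -` C)"
        by (auto simp: H_def)
      then have "closed (H C V)"
        using \<C>(2)[OF CV(2)] by (auto intro!: closed_INT closed_vimage continuous_intros)
      moreover have "interior (H C V) = {}"
      proof (rule ccontr)
        assume "interior (H C V) \<noteq> {}"
        then obtain t r where r: "0 < r" "cball t r \<subseteq> H C V" by (auto simp: mem_interior_cball)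
        obtain u where u: "u \<in> Q" "u \<in> V" using CV(3) by (auto simp: \<V>_def)
        have "open V" using topological_basis_open[OF \<B>(2)] CV(3) by (simp add: \<V>_def)
        then obtain \<rho> where \<rho>: "0 < \<rho>" "cball u \<rho> \<subseteq> V" using u(2) open_contains_cball by blast
        define s where "s = \<rho> / CARD('n)"
        have s: "0 < s" using \<rho>(1) by (simp add: s_def)
        have near: "x \<in> V" if "\<And>c. \<bar>x $ c - u $ c\<bar> \<le> s" for x
        proof -
          have "dist u x \<le> (\<Sum>c\<in>UNIV. \<bar>x $ c - u $ c\<bar>)"
            using norm_le_l1_cart[of "x - u"] by (simp add: dist_norm norm_minus_commute)
          also have "\<dots> \<le> (\<Sum>c\<in>(UNIV :: 'n set). s)" by (intro sum_mono that)
          also have "\<dots> = \<rho>" by (simp add: s_def)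
          finally show ?thesis using \<rho>(2) by auto
        qed
        have uQ: "u $ c \<in> (if c \<in> T then {0..1} else {0})" for c using u(1) by (auto simp: Q_def)
        \<comment> \<open>The box has length \<open>2 * r\<close> along \<open>c0\<close> and is a
          neighbourhood of \<open>u\<close> cut down to \<open>Q\<close> in the directions of
          \<open>T\<close>. Cutting at 0 and 1 leaves positive length, since the coordinates of
          \<open>u\<close> lie in \<open>{0..1}\<close> there.\<close>
        define a :: "real ^ 'n" where
          "a = (\<chi> c. if c = c0 then t - r else if c \<in> T then max 0 (u $ c - s) else 0)"
        define b :: "real ^ 'n" where
          "b = (\<chi> c. if c = c0 then t + r else if c \<in> T then min 1 (u $ c + s) else 0)"
        have "cbox a b \<subseteq> C"
        proof
          fix x assume "x \<in> cbox a b"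
          then have x: "a $ c \<le> x $ c" "x $ c \<le> b $ c" for c by (auto simp: mem_box_cart)
          define v where "v = x - x $ c0 *\<^sub>R axis c0 1"
          have v: "v $ c = (if c = c0 then 0 else x $ c)" for c by (simp add: v_def axis_def)
          have "v $ c \<in> (if c \<in> T then {0..1} else {0})" for c
            using x[of c] c0(2) by (auto simp: v a_def b_def split: if_splits)
          then have "v \<in> Q" unfolding Q_def by blast
          moreover have "v \<in> V"
          proof (rule near)
            show "\<bar>v $ c - u $ c\<bar> \<le> s" for c
              using x[of c] uQ[of c] c0(2) s by (auto simp: v a_def b_def abs_le_iff split: if_splits)
          qed
          moreover have "x $ c0 \<in> H C V"
            using x[of c0] r(2) by (auto simp: a_def b_def dist_real_def abs_le_iff)
          ultimately have "v + x $ c0 *\<^sub>R axis c0 1 \<in> C" unfolding H_def by blast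
          then show "x \<in> C" by (simp add: v_def)
        qed
        moreover have "\<not> cbox a b \<subseteq> C"
        proof (rule closed_covering_dim_no_box[OF \<C>(3)[OF CV(2)], of S])
          show "k < card S" using S by simp
          show "a $ c < b $ c" if "c \<in> S" for c
            using that uQ[of c] r(1) s by (auto simp: c0 a_def b_def split: if_splits)
          show "a $ c = b $ c" if "c \<notin> S" for c
            using that by (auto simp: c0 a_def b_def)
        qed
        ultimately show False by simp
      qed
      ultimately have "nowhere_dense (H C V)" by (simp add: nowhere_dense_def)
      then show "(case CV of (C, V) \<Rightarrow> H C V) \<in> meager_sets"
        using CV(1) nowhere_dense_imp_meager by simp
    qed
    ultimately show ?thesis using meager_subset by blast
  qed
  have "A \<subseteq> \<psi> B" if "\<phi> A \<subseteq> B" for A B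
    using that unfolding \<phi>_def \<psi>_def by blast
  then have "tukey \<phi> \<psi> meager_sets (sigma_closed_dim k)"
    using \<phi> \<psi> unfolding tukey_def by simp
  then show thesis by (rule that)
qed

section \<open>Covering number and uniformity of the dimension ideal\<close>

text \<open>The coordinates are released one at a time, the others being held at a fixed member
  \<open>x\<close>. Each release multiplies by \<open>|\<A>|\<close>, which an infinite cardinal
  absorbs.\<close>

lemma card_of_finite_power_le:
  fixes \<A> :: "'b set"
  assumes inf: "infinite \<A>"
  shows "|{h :: 'n::finite \<Rightarrow> 'b. \<forall>c. h c \<in> \<A>}| \<le>o |\<A>|"
proof -
  obtain x where x: "x \<in> \<A>" using inf by (metis finite.emptyI ex_in_conv)
  have "|{h :: 'n \<Rightarrow> 'b. (\<forall>c\<in>S. h c \<in> \<A>) \<and> (\<forall>c. c \<notin> S \<longrightarrow> h c = x)}| \<le>o |\<A>|" if "finite S" for S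
    using that
  proof (induction S rule: finite_induct)
    case empty
    have "{h :: 'n \<Rightarrow> 'b. (\<forall>c\<in>{}. h c \<in> \<A>) \<and> (\<forall>c. c \<notin> {} \<longrightarrow> h c = x)} = {\<lambda>_. x}" by auto
    then show ?case using x by (simp only:) (rule card_of_singl_ordLeq, blast)
  next
    case (insert c S)
    define F where "F = {h :: 'n \<Rightarrow> 'b. (\<forall>c\<in>S. h c \<in> \<A>) \<and> (\<forall>c. c \<notin> S \<longrightarrow> h c = x)}"
    have "{h :: 'n \<Rightarrow> 'b. (\<forall>d\<in>insert c S. h d \<in> \<A>) \<and> (\<forall>d. d \<notin> insert c S \<longrightarrow> h d = x)}
      \<subseteq> (\<lambda>(h, a). h(c := a)) ` (F \<times> \<A>)"
    proof
      fix h :: "'n \<Rightarrow> 'b" assume h: "h \<in> {h. (\<forall>d\<in>insert c S. h d \<in> \<A>) \<and> (\<forall>d. d \<notin> insert c S \<longrightarrow> h d = x)}"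
      have "h(c := x) \<in> F" using h insert.hyps by (auto simp: F_def)
      then show "h \<in> (\<lambda>(h, a). h(c := a)) ` (F \<times> \<A>)"
        using h by (intro image_eqI[of _ _ "(h(c := x), h c)"]) auto
    qed
    then have "|{h :: 'n \<Rightarrow> 'b. (\<forall>d\<in>insert c S. h d \<in> \<A>) \<and> (\<forall>d. d \<notin> insert c S \<longrightarrow> h d = x)}|
      \<le>o |(\<lambda>(h, a). h(c := a)) ` (F \<times> \<A>)|"
      by (rule card_of_mono1)
    also have "|(\<lambda>(h, a). h(c := a)) ` (F \<times> \<A>)| \<le>o |F \<times> \<A>|" by (rule card_of_image)
    also have "|F \<times> \<A>| \<le>o |\<A>|"
      using inf insert.IH unfolding F_def[symmetric]
      by (intro card_of_Times_ordLeq_infinite_Field)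
        (simp_all add: Field_card_of card_of_card_order_on card_of_mono1)
    finally show ?case .
  qed
  from this[of UNIV] show ?thesis by simp
qed

text \<open>A cover of the line by meager sets is infinite by Baire's theorem, so the products of
  its members over all coordinates are no more numerous than the members themselves, and they cover
  the space.\<close>

lemma cov_sigma_closed_dim_le:
  assumes I: "covering_ideal (sigma_closed_dim k :: (real ^ 'n::finite) set set)"
  shows "cov_ideal (sigma_closed_dim k :: (real ^ 'n) set set) \<le>o cov_ideal (meager_sets :: real set set)"
  unfolding cov_ideal_def covering_idealD(2)[OF I] covering_idealD(2)[OF covering_ideal_meager]
proof (rule min_card_le)
  show "{\<A>. \<A> \<subseteq> meager_sets \<and> \<Union>\<A> = (UNIV :: real set)} \<noteq> {}"
    using covering_idealD(2)[OF covering_ideal_meager] by blast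
  fix \<A> :: "real set set" assume \<A>: "\<A> \<in> {\<A>. \<A> \<subseteq> meager_sets \<and> \<Union>\<A> = UNIV}"
  have "infinite \<A>"
  proof
    assume "finite \<A>"
    then have "(\<Union>A\<in>\<A>. A) \<in> meager_sets" using \<A> by (intro meager_UN countable_finite) auto
    then show False using \<A> covering_idealD(3)[OF covering_ideal_meager[where 'a = real]] by simp
  qed
  define P where "P h = {x :: real ^ 'n. \<forall>c. x $ c \<in> h c}" for h
  define \<H> where "\<H> = {h :: 'n \<Rightarrow> real set. \<forall>c. h c \<in> \<A>}"
  have "P ` \<H> \<subseteq> sigma_closed_dim k"
    using \<A> unfolding P_def \<H>_def by (auto intro!: product_meager_sigma_closed_dim)
  moreover have "\<Union>(P ` \<H>) = UNIV"
  proof (intro set_eqI iffI UNIV_I)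
    fix x :: "real ^ 'n"
    have "\<exists>A\<in>\<A>. x $ c \<in> A" for c using \<A> by blast
    then obtain h where "\<And>c. h c \<in> \<A> \<and> x $ c \<in> h c" by metis
    then show "x \<in> \<Union>(P ` \<H>)" unfolding P_def \<H>_def by blast
  qed
  moreover have "|P ` \<H>| \<le>o |\<A>|"
    using card_of_image card_of_finite_power_le[OF \<open>infinite \<A>\<close>] unfolding \<H>_def by (rule ordLeq_transitive)
  ultimately show "\<exists>\<B>\<in>{\<A>. \<A> \<subseteq> sigma_closed_dim k \<and> \<Union>\<A> = (UNIV :: (real ^ 'n) set)}. |\<B>| \<le>o |\<A>|"
    by (intro bexI[of _ "P ` \<H>"] CollectI conjI)
qed

text \<open>A set is contained in the product of its coordinate projections, so outside the ideal
  one of these must be non-meager.\<close>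

lemma non_sigma_closed_dim_ge:
  assumes I: "covering_ideal (sigma_closed_dim k :: (real ^ 'n::finite) set set)"
  shows "non_ideal (meager_sets :: real set set) \<le>o non_ideal (sigma_closed_dim k :: (real ^ 'n) set set)"
  unfolding non_ideal_def covering_idealD(2)[OF I] covering_idealD(2)[OF covering_ideal_meager]
proof (rule min_card_le)
  show "{A. A \<subseteq> UNIV \<and> A \<notin> (sigma_closed_dim k :: (real ^ 'n) set set)} \<noteq> {}"
    using covering_idealD(3)[OF I] by blast
  fix A assume A: "A \<in> {A. A \<subseteq> UNIV \<and> A \<notin> (sigma_closed_dim k :: (real ^ 'n) set set)}"
  have "\<exists>c. (\<lambda>x. x $ c) ` A \<notin> meager_sets"
  proof (rule ccontr)
    assume "\<not> ?thesis"
    then have "{x :: real ^ 'n. \<forall>c. x $ c \<in> (\<lambda>x. x $ c) ` A} \<in> sigma_closed_dim k"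
      by (intro product_meager_sigma_closed_dim) blast
    moreover have "A \<subseteq> {x. \<forall>c. x $ c \<in> (\<lambda>x. x $ c) ` A}" by blast
    ultimately have "A \<in> sigma_closed_dim k" by (rule covering_idealD(1)[OF I])
    then show False using A by simp
  qed
  then obtain c where "(\<lambda>x. x $ c) ` A \<notin> meager_sets" ..
  then show "\<exists>B\<in>{A. A \<subseteq> UNIV \<and> A \<notin> (meager_sets :: real set set)}. |B| \<le>o |A|"
    by (intro bexI[of _ "(\<lambda>x. x $ c) ` A"] card_of_image) simp
qed

lemma covering_ideal_sigma_closed_dim:
  assumes "k < CARD('n::finite)"
  shows "covering_ideal (sigma_closed_dim k :: (real ^ 'n) set set)"
  unfolding covering_ideal_def
proof (intro conjI allI impI)
  show "A \<in> sigma_closed_dim k" if B: "B \<in> sigma_closed_dim k" "A \<subseteq> B" for A B :: "(real ^ 'n) set"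
  proof -
    obtain \<C> where \<C>: "countable \<C>" "\<forall>C\<in>\<C>. closed C \<and> covering_dim_le (top_of_set C) k" "B \<subseteq> \<Union>\<C>"
      using B(1) unfolding sigma_closed_dim_def mem_Collect_eq by (elim exE conjE)
    have "A \<subseteq> \<Union>\<C>" using B(2) \<C>(3) by (rule order_trans)
    then show ?thesis unfolding sigma_closed_dim_def mem_Collect_eq using \<C>(1,2) by (intro exI conjI)
  qed
  have "{x} \<in> sigma_closed_dim k" for x :: "real ^ 'n"
  proof -
    have "{x $ c} \<in> meager_sets" for c
      by (intro nowhere_dense_imp_meager) (simp add: nowhere_dense_def)
    then have "{y :: real ^ 'n. \<forall>c. y $ c \<in> {x $ c}} \<in> sigma_closed_dim k"
      by (rule product_meager_sigma_closed_dim)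
    moreover have "{y :: real ^ 'n. \<forall>c. y $ c \<in> {x $ c}} = {x}" by (auto simp: vec_eq_iff)
    ultimately show ?thesis by simp
  qed
  then show "\<Union>(sigma_closed_dim k) = (UNIV :: (real ^ 'n) set)" by blast
  show "(UNIV :: (real ^ 'n) set) \<notin> sigma_closed_dim k"
    using sigma_closed_dim_subset_meager[OF assms] covering_idealD(3)[OF covering_ideal_meager] by blast
qed

theorem theorem2p7:
  fixes k :: nat
  assumes "k < CARD('n::finite)"
  shows "add_ideal (sigma_closed_dim k :: (real ^ 'n) set set)
           =o add_ideal (meager_sets :: (real ^ 'n) set set)
       \<and> cov_ideal (sigma_closed_dim k :: (real ^ 'n) set set)
           =o cov_ideal (meager_sets :: (real ^ 'n) set set)
       \<and> non_ideal (sigma_closed_dim k :: (real ^ 'n) set set)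
           =o non_ideal (meager_sets :: (real ^ 'n) set set)
       \<and> cof_ideal (sigma_closed_dim k :: (real ^ 'n) set set)
           =o cof_ideal (meager_sets :: (real ^ 'n) set set)"
proof -
  let ?D = "sigma_closed_dim k :: (real ^ 'n) set set"
  let ?M = "meager_sets :: (real ^ 'n) set set"
  let ?R = "meager_sets :: real set set"
  note D = covering_ideal_sigma_closed_dim[OF assms]
  note M = covering_ideal_meager[where 'a = "real ^ 'n"]
  note R = covering_ideal_meager[where 'a = real]
  note C = covering_ideal_cantor_meager
  note sub = sigma_closed_dim_subset_meager[OF assms]
  obtain p :: "(nat \<Rightarrow> bool) \<Rightarrow> real ^ 'n" and f where
    p: "\<And>A. A \<in> cantor_meager \<Longrightarrow> p ` A \<in> ?M" "\<And>B. B \<in> ?M \<Longrightarrow> p -` B \<in> cantor_meager"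
    and f: "\<And>A. A \<in> ?M \<Longrightarrow> f ` A \<in> cantor_meager" "\<And>B. B \<in> cantor_meager \<Longrightarrow> f -` B \<in> ?M"
    by (rule cantor_transfer) blast
  obtain q :: "(nat \<Rightarrow> bool) \<Rightarrow> real" and g where
    q: "\<And>A. A \<in> cantor_meager \<Longrightarrow> q ` A \<in> ?R" "\<And>B. B \<in> ?R \<Longrightarrow> q -` B \<in> cantor_meager"
    and g: "\<And>A. A \<in> ?R \<Longrightarrow> g ` A \<in> cantor_meager" "\<And>B. B \<in> cantor_meager \<Longrightarrow> g -` B \<in> ?R"
    by (rule cantor_transfer) blast
  note CM = tukey_map[of cantor_meager p ?M, OF p]
  note MC = tukey_map[of ?M f cantor_meager, OF f]
  note CR = tukey_map[of cantor_meager q ?R, OF q]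
  obtain \<phi> \<psi> where RD: "tukey \<phi> \<psi> ?R ?D" by (rule meager_tukey_sigma_closed_dim[OF assms])
  obtain \<phi>' \<psi>' where DC: "tukey \<phi>' \<psi>' ?D cantor_meager"
    by (rule sigma_closed_dim_tukey_cantor[of k])
  note [trans] = ordLeq_transitive
  \<comment> \<open>The comparisons close up in a cycle; the passage through the Cantor space
    exchanges the meager ideal of the line for that of \<open>real ^ 'n\<close>.\<close>
  have "add_ideal ?D \<le>o add_ideal ?R" by (rule add_ideal_tukey[OF R RD])
  also have "add_ideal ?R \<le>o add_ideal cantor_meager" by (rule add_ideal_tukey[OF C CR])
  also have "add_ideal cantor_meager \<le>o add_ideal ?M" by (rule add_ideal_tukey[OF M MC])
  finally have add1: "add_ideal ?D \<le>o add_ideal ?M" .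
  have "add_ideal ?M \<le>o add_ideal cantor_meager" by (rule add_ideal_tukey[OF C CM])
  also have "add_ideal cantor_meager \<le>o add_ideal ?D" by (rule add_ideal_tukey[OF D DC])
  finally have add2: "add_ideal ?M \<le>o add_ideal ?D" .
  have "cof_ideal ?M \<le>o cof_ideal cantor_meager" by (rule cof_ideal_tukey[OF MC])
  also have "cof_ideal cantor_meager \<le>o cof_ideal ?R" by (rule cof_ideal_tukey[OF CR])
  also have "cof_ideal ?R \<le>o cof_ideal ?D" by (rule cof_ideal_tukey[OF RD])
  finally have cof1: "cof_ideal ?M \<le>o cof_ideal ?D" .
  have "cof_ideal ?D \<le>o cof_ideal cantor_meager" by (rule cof_ideal_tukey[OF DC])
  also have "cof_ideal cantor_meager \<le>o cof_ideal ?M" by (rule cof_ideal_tukey[OF CM])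
  finally have cof2: "cof_ideal ?D \<le>o cof_ideal ?M" .
  have "cov_ideal ?D \<le>o cov_ideal ?R" by (rule cov_sigma_closed_dim_le[OF D])
  also have "cov_ideal ?R \<le>o cov_ideal cantor_meager" by (rule cov_ideal_vimage[OF R C g(2)])
  also have "cov_ideal cantor_meager \<le>o cov_ideal ?M" by (rule cov_ideal_vimage[OF C M p(2)])
  finally have cov1: "cov_ideal ?D \<le>o cov_ideal ?M" .
  have cov2: "cov_ideal ?M \<le>o cov_ideal ?D"
    using cov_ideal_vimage[OF M D, of id] sub by simp
  have "non_ideal ?M \<le>o non_ideal cantor_meager" by (rule non_ideal_vimage[OF C M p(2)])
  also have "non_ideal cantor_meager \<le>o non_ideal ?R" by (rule non_ideal_vimage[OF R C g(2)])
  also have "non_ideal ?R \<le>o non_ideal ?D" by (rule non_sigma_closed_dim_ge[OF D])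
  finally have non1: "non_ideal ?M \<le>o non_ideal ?D" .
  have non2: "non_ideal ?D \<le>o non_ideal ?M"
    using non_ideal_vimage[OF M D, of id] sub by simp
  show ?thesis
    using add1 add2 cov1 cov2 non1 non2 cof1 cof2 by (simp add: ordIso_iff_ordLeq)
qed

end
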